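(* Let $p,q$ be relatively prime positive integers with $p^2<\sqrt{2}\,q^2<2\sqrt{2}\,p^2$. Then the orbifold $\mathcal{O}_{p,q}(1)$ (defined in the context) has positive sectional curvature.
   Context: Let $\mathbb{H}$ be the quaternions with units $i,j,k$, conjugation $\bar h$ and norm $|h|^2=h\bar h$. Let $S^{11}=\{u=(u_0,u_1,u_2)\in\mathbb{H}^3: |u_0|^2+|u_1|^2+|u_2|^2=1\}$ be the unit sphere with its round metric, and let $\mathbb{H}P^2=S^{11}/\sim$, where $(u_0,u_1,u_2)\sim(u_0h,u_1h,u_2h)$ for unit quaternions $h$, with the metric making $S^{11}\to\mathbb{H}P^2$ a Riemannian submersion (so the quaternionic sectional curvature is $4$). For relatively prime positive integers $p,q$, the circle $S^1=\{e^{jt}=\cos t+j\sin t: t\in\mathbb{R}\}$ acts isometrically on $\mathbb{H}P^2$ by $\phi_t[u_0,u_1,u_2]=[e^{jqt}u_0,e^{jpt}u_1,e^{jpt}u_2]$. Put $$\mathcal{L}_{\mathbb{H}}=\{[u_0,u_1,u_2]\in\mathbb{H}P^2: q\bar u_0ju_0+p\bar u_1ju_1+p\bar u_2ju_2=0\},$$ a compact $5$-dimensional submanifold with the induced metric, preserved by the $S^1$-action, which is locally free on it. The quotient $\mathcal{O}_{p,q}(1)=\mathcal{L}_{\mathbb{H}}/S^1$ is a compact $4$-dimensional Riemannian orbifold with the metric making $\mathcal{L}_{\mathbb{H}}\to\mathcal{L}_{\mathbb{H}}/S^1$ a Riemannian submersion; it is the Galicki–Lawson orbifold. Sectional curvatures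 of the orbifold are computed on local uniformizing charts (equivalently, for local quotients of $\mathcal{L}_{\mathbb{H}}$ by the action). *)

theory Defs
  imports "HOL-Analysis.Analysis"
begin

section \<open>Riemannian metrics on open subsets of a Euclidean space\<close>

primrec Ck_on :: "nat \<Rightarrow> 'a::euclidean_space set \<Rightarrow> ('a \<Rightarrow> 'b::real_normed_vector) \<Rightarrow> bool" where
  "Ck_on 0 U f \<longleftrightarrow> continuous_on U f"
| "Ck_on (Suc k) U f \<longleftrightarrow>
     f differentiable_on U \<and> (\<forall>v. Ck_on k U (\<lambda>x. frechet_derivative f (at x) v))"

text \<open>Only used for open sets \<open>U\<close>.\<close>

definition smooth_on :: "'a::euclidean_space set \<Rightarrow> ('a \<Rightarrow> 'b::real_normed_vector) \<Rightarrow> bool" where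
  "smooth_on U f \<longleftrightarrow> (\<forall>k. Ck_on k U f)"

type_synonym 'a metric_field = "'a \<Rightarrow> 'a \<Rightarrow> 'a \<Rightarrow> real"

definition riemannian_metric_on :: "'a::euclidean_space set \<Rightarrow> 'a metric_field \<Rightarrow> bool" where
  "riemannian_metric_on U g \<longleftrightarrow>
     (\<forall>x\<in>U. bilinear (g x) \<and> (\<forall>v w. g x v w = g x w v) \<and> (\<forall>v. v \<noteq> 0 \<longrightarrow> g x v v > 0)) \<and>
     (\<forall>v w. smooth_on U (\<lambda>x. g x v w))"

text \<open>
  \<open>christoffel g x u v\<close> is the covariant derivative at \<open>x\<close>, in direction \<open>u\<close>, of the constant
  vector field \<open>v\<close> for the Levi-Civita connection; the defining equation is the Koszul formula,
  whose bracket terms vanish for constant fields. Accordingly \<open>curvature g x u v w\<close> is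
  \<open>\<nabla>\<^sub>u\<nabla>\<^sub>v w - \<nabla>\<^sub>v\<nabla>\<^sub>u w\<close> for the constant fields \<open>u\<close>, \<open>v\<close>, \<open>w\<close>.
\<close>

definition christoffel :: "'a::euclidean_space metric_field \<Rightarrow> 'a \<Rightarrow> 'a \<Rightarrow> 'a \<Rightarrow> 'a" where
  "christoffel g x u v = (THE z. \<forall>w. 2 * g x z w =
     frechet_derivative (\<lambda>y. g y v w) (at x) u
     + frechet_derivative (\<lambda>y. g y u w) (at x) v
     - frechet_derivative (\<lambda>y. g y u v) (at x) w)"

definition curvature :: "'a::euclidean_space metric_field \<Rightarrow> 'a \<Rightarrow> 'a \<Rightarrow> 'a \<Rightarrow> 'a \<Rightarrow> 'a" where
  "curvature g x u v w =
     frechet_derivative (\<lambda>y. christoffel g y v w) (at x) u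
     - frechet_derivative (\<lambda>y. christoffel g y u w) (at x) v
     + christoffel g x u (christoffel g x v w)
     - christoffel g x v (christoffel g x u w)"

definition sectional_curvature :: "'a::euclidean_space metric_field \<Rightarrow> 'a \<Rightarrow> 'a \<Rightarrow> 'a \<Rightarrow> real" where
  "sectional_curvature g x u v =
     g x (curvature g x u v v) u / (g x u u * g x v v - (g x u v)\<^sup>2)"

definition riemannian_immersion_on ::
    "'a::euclidean_space set \<Rightarrow> 'a metric_field \<Rightarrow> ('a \<Rightarrow> 'b::euclidean_space) \<Rightarrow> 'b metric_field \<Rightarrow> bool" where
  "riemannian_immersion_on U h f g \<longleftrightarrow> open U \<and> smooth_on U f \<and>
     (\<forall>x\<in>U. inj (frechet_derivative f (at x)) \<and>
        (\<forall>v w. h x v w = g (f x) (frechet_derivative f (at x) v) (frechet_derivative f (at x) w)))"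

definition horizontal :: "'a::euclidean_space metric_field \<Rightarrow> ('a \<Rightarrow> 'b::euclidean_space) \<Rightarrow> 'a \<Rightarrow> 'a set" where
  "horizontal h f x = {v. \<forall>w. frechet_derivative f (at x) w = 0 \<longrightarrow> h x v w = 0}"

definition riemannian_submersion_on ::
    "'a::euclidean_space set \<Rightarrow> 'a metric_field \<Rightarrow> ('a \<Rightarrow> 'b::euclidean_space) \<Rightarrow> 'b metric_field \<Rightarrow> bool" where
  "riemannian_submersion_on U h f g \<longleftrightarrow> open U \<and> smooth_on U f \<and>
     (\<forall>x\<in>U. surj (frechet_derivative f (at x)) \<and>
        (\<forall>v \<in> horizontal h f x. \<forall>w \<in> horizontal h f x.
           g (f x) (frechet_derivative f (at x) v) (frechet_derivative f (at x) w) = h x v w))"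


section \<open>Riemannian manifolds, submanifolds and quotients\<close>

text \<open>
  A Riemannian manifold modelled on \<open>'a\<close>, with points in \<open>'m\<close>, is given by the set of its charts
  \<open>(U, \<phi>, g)\<close>: \<open>\<phi>\<close> is a parametrization defined on the open set \<open>U\<close> (the inverse of a coordinate
  map), and \<open>g\<close> is the metric tensor in these coordinates. Values of \<open>\<phi>\<close> and \<open>g\<close> outside \<open>U\<close> are
  irrelevant.
\<close>

type_synonym ('a, 'm) atlas = "('a set \<times> ('a \<Rightarrow> 'm) \<times> 'a metric_field) set"

definition points :: "('a, 'm) atlas \<Rightarrow> 'm set" where
  "points M = (\<Union>(U, \<phi>, g)\<in>M. \<phi> ` U)"

definition open_in_atlas :: "('a::euclidean_space, 'm) atlas \<Rightarrow> 'm set \<Rightarrow> bool" where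
  "open_in_atlas M A \<longleftrightarrow> (\<forall>(U, \<phi>, g)\<in>M. open {x\<in>U. \<phi> x \<in> A})"

definition euclidean_atlas :: "('a::euclidean_space, 'a) atlas" where
  "euclidean_atlas = {(UNIV, \<lambda>x. x, \<lambda>x. inner)}"

text \<open>
  All charts of an embedded submanifold \<open>S\<close> of \<open>M\<close>, with the induced metric. The condition on the
  open subsets of \<open>V\<close> says that \<open>\<psi>\<close> is an open map onto its image in the subspace topology of \<open>S\<close>,
  so that \<open>\<psi>\<close> is a homeomorphism onto a relatively open subset of \<open>S\<close>. The dimension of \<open>S\<close> is
  that of the model space \<open>'b\<close>.
\<close>

definition submanifold_atlas ::
    "('a::euclidean_space, 'm) atlas \<Rightarrow> 'm set \<Rightarrow> ('b::euclidean_space, 'm) atlas" where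
  "submanifold_atlas M S = {(V, \<psi>, h).
     open V \<and> riemannian_metric_on V h \<and> inj_on \<psi> V \<and> \<psi> ` V \<subseteq> S \<inter> points M \<and>
     (\<forall>V'\<subseteq>V. open V' \<longrightarrow> (\<exists>A. open_in_atlas M A \<and> \<psi> ` V' = S \<inter> A)) \<and>
     (\<forall>(U, \<phi>, g)\<in>M. riemannian_immersion_on {y\<in>V. \<psi> y \<in> \<phi> ` U} h (inv_into U \<phi> \<circ> \<psi>) g)}"

text \<open>
  All charts of the quotient manifold of \<open>M\<close> along the map \<open>\<pi>\<close>, with the metric making \<open>\<pi>\<close> a
  Riemannian submersion.
\<close>

definition quotient_atlas ::
    "('a::euclidean_space, 'm) atlas \<Rightarrow> ('m \<Rightarrow> 'n) \<Rightarrow> ('b::euclidean_space, 'n) atlas" where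
  "quotient_atlas M \<pi> = {(V, \<psi>, g).
     open V \<and> riemannian_metric_on V g \<and> inj_on \<psi> V \<and> \<psi> ` V \<subseteq> \<pi> ` points M \<and>
     (\<forall>(U, \<phi>, h)\<in>M.
        riemannian_submersion_on {x\<in>U. \<pi> (\<phi> x) \<in> \<psi> ` V} h (inv_into V \<psi> \<circ> \<pi> \<circ> \<phi>) g)}"

text \<open>
  Local uniformizing charts of the quotient of \<open>M\<close> by a locally free action, where \<open>orb\<close> sends a
  point to its orbit and \<open>DIM('b)\<close> is the dimension of \<open>M\<close> minus that of the orbits. Such a chart is
  a local quotient: an open piece of \<open>M\<close>, with coordinate domain \<open>W\<close>, is submersed onto \<open>V\<close> with
  fibres contained in orbits, hence, by the dimension count, with fibres tangent to the orbits, and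
  the metric on \<open>V\<close> makes this a Riemannian submersion. Because of isotropy, the induced map \<open>\<kappa>\<close>
  from \<open>V\<close> to the orbit space need not be injective.
\<close>

definition orbifold_quotient_atlas ::
    "('a::euclidean_space, 'm) atlas \<Rightarrow> ('m \<Rightarrow> 'm set) \<Rightarrow> ('b::euclidean_space, 'm set) atlas" where
  "orbifold_quotient_atlas M orb = {(V, \<kappa>, g).
     open V \<and> riemannian_metric_on V g \<and>
     (\<exists>W \<sigma> h \<rho>. (W, \<sigma>, h) \<in> M \<and> \<rho> ` W = V \<and> (\<forall>x\<in>W. \<kappa> (\<rho> x) = orb (\<sigma> x)) \<and>
        riemannian_submersion_on W h \<rho> g)}"

definition positive_sectional_curvature :: "('a::euclidean_space, 'm) atlas \<Rightarrow> bool" where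
  "positive_sectional_curvature M \<longleftrightarrow>
     (\<forall>(U, \<phi>, g)\<in>M. \<forall>x\<in>U. \<forall>u v. u \<noteq> v \<and> independent {u, v} \<longrightarrow> sectional_curvature g x u v > 0)"


section \<open>Quaternions and the quaternionic projective plane\<close>

text \<open>\<open>(a, b, c, d)\<close> stands for \<open>a + b i + c j + d k\<close>.\<close>

type_synonym quat = "real \<times> real \<times> real \<times> real"

fun qmult :: "quat \<Rightarrow> quat \<Rightarrow> quat" (infixl "\<cdot>\<^sub>q" 70) where
  "(a, b, c, d) \<cdot>\<^sub>q (a', b', c', d') =
     (a * a' - b * b' - c * c' - d * d',
      a * b' + b * a' + c * d' - d * c',
      a * c' - b * d' + c * a' + d * b',
      a * d' + b * c' - c * b' + d * a')"

fun qcnj :: "quat \<Rightarrow> quat" where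
  "qcnj (a, b, c, d) = (a, - b, - c, - d)"

definition qj :: quat where
  "qj = (0, 0, 1, 0)"

definition qexp_j :: "real \<Rightarrow> quat" where
  "qexp_j t = (cos t, 0, sin t, 0)"

text \<open>
  The norm and inner product that the product type carries are the Euclidean ones, so \<open>norm h\<close> is
  the quaternion norm, and \<open>sphere 0 1\<close> in \<open>quat3\<close> is the unit sphere of dimension 11.
\<close>

type_synonym quat3 = "quat \<times> quat \<times> quat"

definition S11 :: "(real^11, quat3) atlas" where
  "S11 = submanifold_atlas euclidean_atlas (sphere 0 1)"

text \<open>Points of the projective plane are the equivalence classes in the sphere.\<close>

definition hp_class :: "quat3 \<Rightarrow> quat3 set" where
  "hp_class = (\<lambda>(u0, u1, u2). {(u0 \<cdot>\<^sub>q h, u1 \<cdot>\<^sub>q h, u2 \<cdot>\<^sub>q h) | h. norm h = 1})"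

definition HP2 :: "(real^8, quat3 set) atlas" where
  "HP2 = quotient_atlas S11 hp_class"


section \<open>The Galicki--Lawson orbifolds\<close>

definition circle_action :: "nat \<Rightarrow> nat \<Rightarrow> real \<Rightarrow> quat3 set \<Rightarrow> quat3 set" where
  "circle_action p q t c =
     (\<lambda>(u0, u1, u2). (qexp_j (q * t) \<cdot>\<^sub>q u0, qexp_j (p * t) \<cdot>\<^sub>q u1, qexp_j (p * t) \<cdot>\<^sub>q u2)) ` c"

definition circle_orbit :: "nat \<Rightarrow> nat \<Rightarrow> quat3 set \<Rightarrow> quat3 set set" where
  "circle_orbit p q c = range (\<lambda>t. circle_action p q t c)"

definition LH_set :: "nat \<Rightarrow> nat \<Rightarrow> quat3 set set" where
  "LH_set p q = {hp_class (u0, u1, u2) | u0 u1 u2. (u0, u1, u2) \<in> sphere 0 1 \<and>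
     real q *\<^sub>R (qcnj u0 \<cdot>\<^sub>q qj \<cdot>\<^sub>q u0) + real p *\<^sub>R (qcnj u1 \<cdot>\<^sub>q qj \<cdot>\<^sub>q u1)
       + real p *\<^sub>R (qcnj u2 \<cdot>\<^sub>q qj \<cdot>\<^sub>q u2) = 0}"

definition LH :: "nat \<Rightarrow> nat \<Rightarrow> (real^5, quat3 set) atlas" where
  "LH p q = submanifold_atlas HP2 (LH_set p q)"

definition galicki_lawson_orbifold :: "nat \<Rightarrow> nat \<Rightarrow> (real^4, quat3 set set) atlas" where
  "galicki_lawson_orbifold p q = orbifold_quotient_atlas (LH p q) (circle_orbit p q)"

end

theory Submission
  imports Defs
begin

text \<open>
  Locally the orbifold is the Riemannian quotient of the zero set of the moment map
  \<open>u \<mapsto> u\<^sup>* X u\<close> in the sphere, \<open>X = diag (q j, p j, p j)\<close>, by the group generated by the circle and the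
  unit quaternions. Its horizontal space at \<open>u\<close> is the quaternionic line orthogonal to \<open>u\<close> and \<open>X u\<close>. The
  Gauss equation in the flat space \<open>\<real>\<^sup>1\<^sup>2\<close> and O'Neill's formula, applied in one step to a local section that
  is horizontal at the given point, show that for an orthonormal pair \<open>a\<close>, \<open>a c\<close> in this line the curvature is
  \<open>4 + (6 \<langle>c, \<nu>\<rangle>\<^sup>2 - 2 |\<nu>|\<^sup>2) / |X u|\<^sup>2\<close> with \<open>\<nu> = a\<^sup>* X a\<close>. Since \<open>X\<close> has Dieudonne determinant
  \<open>p\<^sup>2 q\<close>, the norm of \<open>\<nu>\<close> is \<open>p\<^sup>2 q / |X u|\<^sup>2\<close>, so that positivity means \<open>p\<^sup>4 q\<^sup>2 < 2 |X u|\<^sup>6\<close>; it follows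
  from \<open>|X u|\<^sup>2 \<ge> min (p\<^sup>2) (p q)\<close>.
\<close>

section \<open>Finitely often differentiable functions\<close>

text \<open>Neither second fundamental forms nor O'Neill tensors are developed. Along a section
  whose derivative is horizontal at one point, the vertical parts of that derivative vanish there.
  The metric therefore agrees to first order with the one induced from flat space, and the quadratic
  vertical correction enters its second derivatives only through products of first derivatives,
  which is the source of O'Neill's term. In the coefficient 6, the product of \<open>\<nu>\<close>
  with its conjugate by \<open>c\<close> accounts for 2. The other 4 is 1 + 3: only imaginary
  components are normal to the zero set, so the real part must be taken out of a full square once,
  and O'Neill's formula adds it three times. The main obstacle lies in the charts: a uniformizing
  chart says only that fibres are contained in orbits as sets, so the tangent direction of a fibre
  must be derived, by compactness of the group acting on the sphere.\<close>

abbreviation dd :: "('a::euclidean_space \<Rightarrow> 'b::real_normed_vector) \<Rightarrow> 'a \<Rightarrow> 'a \<Rightarrow> 'b" where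
  "dd f v x \<equiv> frechet_derivative f (at x) v"

lemma differentiable_on_openD:
  "f differentiable_on U \<Longrightarrow> open U \<Longrightarrow> x \<in> U \<Longrightarrow> f differentiable (at x)"
  by (simp add: differentiable_on_eq_differentiable_at)

lemma differentiable_at_has_derivative:
  "f differentiable (at x) \<Longrightarrow> (f has_derivative frechet_derivative f (at x)) (at x)"
  using frechet_derivative_works by blast

lemma dd_eqI: "(f has_derivative f') (at x) \<Longrightarrow> dd f v x = f' v"
  using frechet_derivative_at by metis

lemma Ck_on_SucD: "Ck_on (Suc k) U f \<Longrightarrow> Ck_on k U f"
  by (induction k arbitrary: f) (auto intro: differentiable_imp_continuous_on)

lemma Ck_on_subset: "Ck_on k U f \<Longrightarrow> V \<subseteq> U \<Longrightarrow> Ck_on k V f"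
  by (induction k arbitrary: f) (auto intro: continuous_on_subset differentiable_on_subset)

lemma Ck_on_transform:
  assumes "open U" "Ck_on k U f" "\<And>x. x \<in> U \<Longrightarrow> f x = g x"
  shows "Ck_on k U g"
  using assms(2,3)
proof (induction k arbitrary: f g)
  case 0
  then show ?case using continuous_on_cong by force
next
  case (Suc k)
  have f: "f differentiable (at x)" if "x \<in> U" for x
    using Suc.prems assms(1) that by (auto intro: differentiable_on_openD)
  have eq: "frechet_derivative f (at x) = frechet_derivative g (at x)" if "x \<in> U" for x
    using frechet_derivative_transform_within_open[OF f[OF that] assms(1) that Suc.prems(2)] .
  have "g differentiable (at x)" if "x \<in> U" for x
    using has_derivative_transform_within_open[OF differentiable_at_has_derivative[OF f[OF that]] assms(1) that Suc.prems(2)]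
    by (auto simp: differentiable_def)
  moreover have "Ck_on k U (dd g v)" for v
    by (rule Suc.IH[of "dd f v"]) (use Suc.prems eq in auto)
  ultimately show ?case
    by (auto simp: differentiable_on_eq_differentiable_at[OF assms(1)])
qed

lemma Ck_on_const: "Ck_on k U (\<lambda>x. c)"
  by (induction k arbitrary: c) auto

lemma Ck_on_bounded_linear:
  assumes L: "bounded_linear L" and "open U" "Ck_on k U f"
  shows "Ck_on k U (\<lambda>x. L (f x))"
  using assms(3)
proof (induction k arbitrary: f)
  case 0
  then show ?case using bounded_linear.continuous_on[OF L] by auto
next
  case (Suc k)
  have f: "((\<lambda>x. L (f x)) has_derivative (\<lambda>v. L (dd f v x))) (at x)" if "x \<in> U" for x
    using Suc.prems assms(2) that
    by (auto intro!: bounded_linear.has_derivative[OF L] differentiable_at_has_derivative differentiable_on_openD)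
  have "Ck_on k U (dd (\<lambda>x. L (f x)) v)" for v
    by (rule Ck_on_transform[OF assms(2) Suc.IH[of "dd f v"]]) (use Suc.prems dd_eqI[OF f] in auto)
  then show ?case
    using f by (auto simp: differentiable_on_eq_differentiable_at[OF assms(2)] differentiable_def)
qed

lemma Ck_on_add:
  assumes "open U" "Ck_on k U f" "Ck_on k U g"
  shows "Ck_on k U (\<lambda>x. f x + g x)"
  using assms(2,3)
proof (induction k arbitrary: f g)
  case 0
  then show ?case by (auto intro: continuous_on_add)
next
  case (Suc k)
  have f: "((\<lambda>x. f x + g x) has_derivative (\<lambda>v. dd f v x + dd g v x)) (at x)" if "x \<in> U" for x
    using Suc.prems assms(1) that
    by (auto intro!: has_derivative_add differentiable_at_has_derivative differentiable_on_openD)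
  have "Ck_on k U (dd (\<lambda>x. f x + g x) v)" for v
    by (rule Ck_on_transform[OF assms(1) Suc.IH[of "dd f v" "dd g v"]]) (use Suc.prems dd_eqI[OF f] in auto)
  then show ?case
    using f by (auto simp: differentiable_on_eq_differentiable_at[OF assms(1)] differentiable_def)
qed

lemma Ck_on_bilinear:
  assumes B: "bounded_bilinear B" and "open U" "Ck_on k U f" "Ck_on k U g"
  shows "Ck_on k U (\<lambda>x. B (f x) (g x))"
  using assms(3,4)
proof (induction k arbitrary: f g)
  case 0
  then show ?case using bounded_bilinear.continuous_on[OF B] by auto
next
  case (Suc k)
  have f: "((\<lambda>x. B (f x) (g x)) has_derivative (\<lambda>v. B (f x) (dd g v x) + B (dd f v x) (g x))) (at x)"
    if "x \<in> U" for x
    using Suc.prems assms(2) that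
    by (auto intro!: bounded_bilinear.FDERIV[OF B] differentiable_at_has_derivative differentiable_on_openD)
  have "Ck_on k U (dd (\<lambda>x. B (f x) (g x)) v)" for v
    by (rule Ck_on_transform[OF assms(2) Ck_on_add[OF assms(2) Suc.IH[of f "dd g v"] Suc.IH[of "dd f v" g]]])
      (use Suc.prems dd_eqI[OF f] Suc.prems[THEN Ck_on_SucD] in auto)
  then show ?case
    using f by (auto simp: differentiable_on_eq_differentiable_at[OF assms(2)] differentiable_def)
qed

lemma Ck_on_sum:
  assumes "open U" "\<And>i. i \<in> I \<Longrightarrow> Ck_on k U (f i)"
  shows "Ck_on k U (\<lambda>x. \<Sum>i\<in>I. f i x)"
  using assms(2) by (induction I rule: infinite_finite_induct) (auto intro!: Ck_on_const Ck_on_add assms(1))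

section \<open>Families of linear maps, known argument by argument\<close>

lemma linear_basis_expansion:
  fixes L :: "'a::euclidean_space \<Rightarrow> 'b::real_vector"
  assumes "linear L"
  shows "L v = (\<Sum>b\<in>Basis. (v \<bullet> b) *\<^sub>R L b)"
proof -
  have "L v = L (\<Sum>b\<in>Basis. (v \<bullet> b) *\<^sub>R b)" by (simp add: euclidean_representation)
  then show ?thesis by (simp add: linear_sum[OF assms] linear_scale[OF assms])
qed

text \<open>Regularity of the family is known only for each fixed argument. Expanding
  \<open>w x\<close> in the basis lets the varying argument enter through scalar factors
  alone.\<close>

lemma Ck_on_apply_family:
  fixes A :: "'a::euclidean_space \<Rightarrow> 'b::euclidean_space \<Rightarrow> 'c::real_normed_vector"
  assumes "open U" "\<And>v. Ck_on k U (\<lambda>x. A x v)" "\<And>x. x \<in> U \<Longrightarrow> linear (A x)" "Ck_on k U w"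
  shows "Ck_on k U (\<lambda>x. A x (w x))"
proof (rule Ck_on_transform[OF assms(1)])
  show "Ck_on k U (\<lambda>x. \<Sum>b\<in>Basis. (w x \<bullet> b) *\<^sub>R A x b)"
    by (intro Ck_on_sum Ck_on_bilinear[OF bounded_bilinear_scaleR] assms
        Ck_on_bounded_linear[OF bounded_linear_inner_left])
  show "(\<Sum>b\<in>Basis. (w x \<bullet> b) *\<^sub>R A x b) = A x (w x)" if "x \<in> U" for x
    using linear_basis_expansion[OF assms(3)[OF that], of "w x"] by simp
qed

text \<open>A derivative of the composition is the family
  \<open>frechet_derivative f (at (g x))\<close> applied to a derivative of \<open>g\<close>, so the
  induction varies \<open>f\<close> and keeps \<open>g\<close> fixed.\<close>

lemma Ck_on_compose:
  fixes f :: "'b::euclidean_space \<Rightarrow> 'c::real_normed_vector" and g :: "'a::euclidean_space \<Rightarrow> 'b"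
  assumes "open U" "open V" "g ` U \<subseteq> V" "Ck_on k V f" "Ck_on k U g"
  shows "Ck_on k U (\<lambda>x. f (g x))"
  using assms(4,5)
proof (induction k arbitrary: f)
  case 0
  then show ?case using assms(3) by (auto intro: continuous_on_compose2)
next
  case (Suc k)
  have df: "f differentiable (at y)" if "y \<in> V" for y
    using Suc.prems assms that by (auto intro: differentiable_on_openD)
  have dg: "g differentiable (at x)" if "x \<in> U" for x
    using Suc.prems assms that by (auto intro: differentiable_on_openD)
  have f: "((\<lambda>x. f (g x)) has_derivative (\<lambda>v. dd f (dd g v x) (g x))) (at x)" if "x \<in> U" for x
    using diff_chain_at[OF differentiable_at_has_derivative[OF dg[OF that]] differentiable_at_has_derivative[OF df[of "g x"]]]
      that assms(3) by (auto simp: o_def)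
  have "Ck_on k U (\<lambda>x. dd f (dd g v x) (g x))" for v
  proof (rule Ck_on_apply_family[OF assms(1)])
    show "Ck_on k U (\<lambda>x. dd f w (g x))" for w
      by (rule Suc.IH) (use Suc.prems Suc.prems(2)[THEN Ck_on_SucD] in auto)
    show "linear (frechet_derivative f (at (g x)))" if "x \<in> U" for x
      using df that assms(3) by (auto intro: linear_frechet_derivative)
  qed (use Suc.prems Suc.prems(2)[THEN Ck_on_SucD] in auto)
  then have "Ck_on k U (dd (\<lambda>x. f (g x)) v)" for v
    by (rule Ck_on_transform[OF assms(1)]) (use dd_eqI[OF f] in auto)
  then show ?case
    using f by (auto simp: differentiable_on_eq_differentiable_at[OF assms(1)] differentiable_def)
qed

text \<open>A product rule with one factor merely continuous: where the scalar factor vanishes, the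
  increment of the other factor is multiplied by a quantity of first order. It serves to
  differentiate an inverse family known only to be continuous.\<close>

lemma has_derivative_scaleR_continuous:
  fixes \<phi> :: "'a::real_normed_vector \<Rightarrow> real" and \<psi> :: "'a \<Rightarrow> 'b::real_normed_vector"
  assumes "(\<phi> has_derivative \<phi>') (at x)" "\<phi> x = 0" "isCont \<psi> x"
  shows "((\<lambda>y. \<phi> y *\<^sub>R \<psi> y) has_derivative (\<lambda>h. \<phi>' h *\<^sub>R \<psi> x)) (at x)"
proof -
  interpret bounded_linear \<phi>' using assms(1) by (rule has_derivative_bounded_linear)
  obtain K where K: "\<And>h. norm (\<phi>' h) \<le> norm h * K" using bounded by blast
  have 1: "((\<lambda>y. ((\<phi> y - \<phi>' (y - x)) / norm (y - x)) *\<^sub>R \<psi> y) \<longlongrightarrow> 0 *\<^sub>R \<psi> x) (at x)"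
    using assms has_derivative_at_within[of \<phi> \<phi>' x UNIV]
    by (intro tendsto_scaleR) (auto simp: isCont_def divide_inverse mult.commute)
  have 2: "((\<lambda>y. (\<phi>' (y - x) / norm (y - x)) *\<^sub>R (\<psi> y - \<psi> x)) \<longlongrightarrow> 0) (at x)"
  proof (rule tendsto_0_le[where K = K])
    show "((\<lambda>y. \<psi> y - \<psi> x) \<longlongrightarrow> 0) (at x)"
      using assms(3) by (simp add: isCont_def LIM_zero)
    show "\<forall>\<^sub>F y in at x. norm ((\<phi>' (y - x) / norm (y - x)) *\<^sub>R (\<psi> y - \<psi> x)) \<le> norm (\<psi> y - \<psi> x) * K"
    proof -
      have "norm ((\<phi>' (y - x) / norm (y - x)) *\<^sub>R (\<psi> y - \<psi> x)) \<le> norm (\<psi> y - \<psi> x) * K"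
        if "y \<noteq> x" for y
      proof -
      from that have "\<bar>\<phi>' (y - x)\<bar> / norm (y - x) \<le> K"
        using K[of "y - x"] by (simp add: field_simps)
      then have "(\<bar>\<phi>' (y - x)\<bar> / norm (y - x)) * norm (\<psi> y - \<psi> x) \<le> K * norm (\<psi> y - \<psi> x)"
        by (rule mult_right_mono) simp
      then show "norm ((\<phi>' (y - x) / norm (y - x)) *\<^sub>R (\<psi> y - \<psi> x)) \<le> norm (\<psi> y - \<psi> x) * K"
        by (simp add: mult.commute)
    qed
    then show ?thesis by (auto simp: eventually_at_filter)
    qed
  qed
  have eq: "(1 / norm (y - x)) *\<^sub>R (\<phi> y *\<^sub>R \<psi> y - \<phi> x *\<^sub>R \<psi> x - \<phi>' (y - x) *\<^sub>R \<psi> x)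
     = ((\<phi> y - \<phi>' (y - x)) / norm (y - x)) *\<^sub>R \<psi> y + (\<phi>' (y - x) / norm (y - x)) *\<^sub>R (\<psi> y - \<psi> x)" for y
    using assms(2) by (simp add: algebra_simps divide_inverse)
  have "bounded_linear (\<lambda>h. \<phi>' h *\<^sub>R \<psi> x)"
    by (rule bounded_linear_compose[OF bounded_linear_scaleR_left bounded_linear_axioms])
  then show ?thesis
    using tendsto_add[OF 1 2] eq by (simp add: has_derivative_within diff_diff_eq)
qed


text \<open>If the left inverse at \<open>x\<close> has bound \<open>K\<close>, a perturbation of
  size below \<open>1 / (2 * K)\<close> costs at most half of \<open>norm v\<close>, so the bound
  \<open>2 * K\<close> survives nearby. Smallness of the perturbation need only be checked on the
  finitely many basis vectors.\<close>

lemma linear_family_bounded_below: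
  fixes A :: "'a::euclidean_space \<Rightarrow> 'b::euclidean_space \<Rightarrow> 'c::euclidean_space"
  assumes U: "open U" "x \<in> U" and cont: "\<And>v. continuous_on U (\<lambda>x. A x v)"
    and lin: "\<And>x. x \<in> U \<Longrightarrow> linear (A x)" "linear B" and B: "\<And>v. B (A x v) = v"
  obtains K where "K > 0" "\<forall>\<^sub>F y in at x. \<forall>v. norm v \<le> K * norm (A y v)"
proof -
  obtain K where K: "K > 0" "\<And>w. norm (B w) \<le> norm w * K"
    using bounded_linear.pos_bounded lin(2) linear_conv_bounded_linear by blast
  define \<epsilon> where "\<epsilon> = 1 / (2 * K)"
  define \<delta> where "\<delta> y = (\<Sum>b\<in>Basis. norm (A y b - A x b))" for y
  have "((\<lambda>y. norm (A y b - A x b)) \<longlongrightarrow> norm (A x b - A x b)) (at x)" for b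
    using cont U by (intro tendsto_intros) (auto simp: continuous_on_eq_continuous_at isCont_def)
  then have "(\<delta> \<longlongrightarrow> (\<Sum>b\<in>Basis. norm (A x (b::'b) - A x b))) (at x)"
    unfolding \<delta>_def by (intro tendsto_sum)
  then have "(\<delta> \<longlongrightarrow> 0) (at x)" by simp
  then have "\<forall>\<^sub>F y in at x. \<delta> y < \<epsilon>"
    using K by (intro order_tendstoD(2)) (auto simp: \<epsilon>_def)
  moreover have "\<forall>\<^sub>F y in at x. y \<in> U"
    using U by (simp add: eventually_at_in_open')
  ultimately have "\<forall>\<^sub>F y in at x. \<forall>v. norm v \<le> 2 * K * norm (A y v)"
  proof eventually_elim
    case (elim y)
    show ?case
    proof
      fix v
      have "A y v - A x v = (\<Sum>b\<in>Basis. (v \<bullet> b) *\<^sub>R (A y b - A x b))"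
        using linear_basis_expansion[OF lin(1)[OF elim(2)], of v] linear_basis_expansion[OF lin(1)[OF U(2)], of v]
        by (simp add: sum_subtractf scaleR_diff_right)
      also have "norm \<dots> \<le> (\<Sum>b\<in>Basis. norm v * norm (A y b - A x b))"
        by (rule sum_norm_le) (auto intro!: mult_right_mono simp: Basis_le_norm)
      also have "\<dots> = norm v * \<delta> y" by (simp add: \<delta>_def sum_distrib_left)
      also have "\<dots> \<le> norm v * \<epsilon>" using elim by (intro mult_left_mono) auto
      finally have 1: "norm (A y v - A x v) \<le> norm v * \<epsilon>" .
      have "norm v \<le> norm (A x v) * K" using K(2)[of "A x v"] B by simp
      also have "norm (A x v) \<le> norm (A y v) + norm v * \<epsilon>"
        using 1 norm_triangle_ineq3[of "A x v" "A y v"] by (simp add: norm_minus_commute)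
      finally have "norm v \<le> norm (A y v) * K + norm v * \<epsilon> * K"
        using K by (simp add: distrib_right)
      then have "norm v \<le> K * norm (A y v) + norm v / 2" using K(1) by (simp add: \<epsilon>_def mult.commute)
      then show "norm v \<le> 2 * K * norm (A y v)" by linarith
    qed
  qed
  then show thesis using K that[of "2 * K"] by simp
qed

text \<open>With \<open>z = B x w\<close> one has \<open>B y w = z - B y (A y z - w)\<close>. On the
  right the unknown family acts on a vector that vanishes at \<open>y = x\<close>, so its continuity
  suffices for differentiating.\<close>

lemma inverse_family_has_derivative:
  fixes A :: "'a::euclidean_space \<Rightarrow> 'b::euclidean_space \<Rightarrow> 'c::euclidean_space"
  assumes U: "open U" and A: "\<And>v. (\<lambda>x. A x v) differentiable_on U"
    and lin: "\<And>x. x \<in> U \<Longrightarrow> linear (A x)" "\<And>x. x \<in> U \<Longrightarrow> linear (B x)"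
    and inv: "\<And>x v. x \<in> U \<Longrightarrow> B x (A x v) = v" "\<And>x w. x \<in> U \<Longrightarrow> A x (B x w) = w"
    and x: "x \<in> U"
  shows "((\<lambda>y. B y w) has_derivative (\<lambda>h. - B x (dd (\<lambda>y. A y (B x w)) h x))) (at x)"
proof -
  have cont: "continuous_on U (\<lambda>x. A x v)" for v
    using A differentiable_imp_continuous_on by blast
  obtain K where K: "K > 0" "\<forall>\<^sub>F y in at x. \<forall>v. norm v \<le> K * norm (A y v)"
    using linear_family_bounded_below[OF U x cont lin(1) lin(2)[OF x]] inv x by blast
  have evU: "\<forall>\<^sub>F y in at x. y \<in> U" using U x by (simp add: eventually_at_in_open')
  \<comment> \<open>Since \<open>A y (B y w - B x w) = w - A y (B x w)\<close>, the lower bound for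
    \<open>A y\<close> turns continuity of \<open>A\<close> into continuity of
    \<open>B\<close>.\<close>
  have Bcont: "isCont (\<lambda>y. B y w) x" for w
  proof -
    have "((\<lambda>y. B y w - B x w) \<longlongrightarrow> 0) (at x)"
    proof (rule tendsto_0_le[where K = K])
      have "((\<lambda>y. A y (B x w)) \<longlongrightarrow> A x (B x w)) (at x)"
        using cont U x by (auto simp: continuous_on_eq_continuous_at isCont_def)
      then show "((\<lambda>y. w - A y (B x w)) \<longlongrightarrow> 0) (at x)"
        using inv x by (auto intro: tendsto_eq_intros)
      show "\<forall>\<^sub>F y in at x. norm (B y w - B x w) \<le> norm (w - A y (B x w)) * K"
        using K(2) evU
      proof eventually_elim
        case (elim y)
        then show ?case
          using elim(1)[rule_format, of "B y w - B x w"] inv(2)[OF elim(2)] linear_diff[OF lin(1)[OF elim(2)]]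
          by (simp add: mult.commute)
      qed
    qed
    then show ?thesis by (simp add: isCont_def LIM_zero_iff)
  qed
  define z where "z = B x w"
  have dA: "((\<lambda>y. A y z) has_derivative (\<lambda>h. dd (\<lambda>y. A y z) h x)) (at x)"
    using A U x by (intro differentiable_at_has_derivative) (auto intro: differentiable_on_openD)
  have "((\<lambda>y. z - (\<Sum>b\<in>Basis. ((A y z - w) \<bullet> b) *\<^sub>R B y b)) has_derivative
        (\<lambda>h. 0 - (\<Sum>b\<in>Basis. ((dd (\<lambda>y. A y z) h x - 0) \<bullet> b) *\<^sub>R B x b))) (at x)"
    using inv x Bcont
    by (intro has_derivative_diff has_derivative_const has_derivative_sum has_derivative_scaleR_continuous
        has_derivative_inner_left dA) (auto simp: z_def)
  moreover have "z - (\<Sum>b\<in>Basis. ((A y z - w) \<bullet> b) *\<^sub>R B y b) = B y w" if "y \<in> U" for y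
  proof -
    have "(\<Sum>b\<in>Basis. ((A y z - w) \<bullet> b) *\<^sub>R B y b) = z - B y w"
      using linear_basis_expansion[OF lin(2)[OF that], of "A y z - w"] linear_diff[OF lin(2)[OF that]]
        inv(1)[OF that] by simp
    then show ?thesis by simp
  qed
  moreover have "(\<Sum>b\<in>Basis. (v \<bullet> b) *\<^sub>R B x b) = B x v" for v
    using linear_basis_expansion[OF lin(2)[OF x], of v] by simp
  ultimately have "((\<lambda>y. z - (\<Sum>b\<in>Basis. ((A y z - w) \<bullet> b) *\<^sub>R B y b)) has_derivative
        (\<lambda>h. - B x (dd (\<lambda>y. A y (B x w)) h x))) (at x)"
    and "\<And>y. y \<in> U \<Longrightarrow> z - (\<Sum>b\<in>Basis. ((A y z - w) \<bullet> b) *\<^sub>R B y b) = B y w"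
    by (auto simp: z_def)
  then show ?thesis by (rule has_derivative_transform_within_open[OF _ U x])
qed

lemma Ck_on_uminus: "open U \<Longrightarrow> Ck_on k U f \<Longrightarrow> Ck_on k U (\<lambda>x. - f x)"
  by (rule Ck_on_bounded_linear[OF bounded_linear_minus[OF bounded_linear_ident]])

lemma linear_dd_family:
  fixes A :: "'a::euclidean_space \<Rightarrow> 'b::real_vector \<Rightarrow> 'c::real_normed_vector"
  assumes U: "open U" and x: "x \<in> U" and dA: "\<And>z. (\<lambda>y. A y z) differentiable (at x)"
    and lin: "\<And>y. y \<in> U \<Longrightarrow> linear (A y)"
  shows "linear (\<lambda>z. dd (\<lambda>y. A y z) v x)"
proof (rule linearI)
  fix z1 z2 and c :: real
  have "((\<lambda>y. A y z1 + A y z2) has_derivative (\<lambda>h. dd (\<lambda>y. A y z1) h x + dd (\<lambda>y. A y z2) h x)) (at x)"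
    using dA by (intro has_derivative_add differentiable_at_has_derivative)
  then have "((\<lambda>y. A y (z1 + z2)) has_derivative (\<lambda>h. dd (\<lambda>y. A y z1) h x + dd (\<lambda>y. A y z2) h x)) (at x)"
    by (rule has_derivative_transform_within_open[OF _ U x]) (simp add: linear_add lin)
  then show "dd (\<lambda>y. A y (z1 + z2)) v x = dd (\<lambda>y. A y z1) v x + dd (\<lambda>y. A y z2) v x"
    by (rule dd_eqI)
  have "((\<lambda>y. c *\<^sub>R A y z1) has_derivative (\<lambda>h. c *\<^sub>R dd (\<lambda>y. A y z1) h x)) (at x)"
    using dA by (intro has_derivative_scaleR_right differentiable_at_has_derivative)
  then have "((\<lambda>y. A y (c *\<^sub>R z1)) has_derivative (\<lambda>h. c *\<^sub>R dd (\<lambda>y. A y z1) h x)) (at x)"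
    by (rule has_derivative_transform_within_open[OF _ U x]) (simp add: linear_scale lin)
  then show "dd (\<lambda>y. A y (c *\<^sub>R z1)) v x = c *\<^sub>R dd (\<lambda>y. A y z1) v x" by (rule dd_eqI)
qed

text \<open>Bootstrapping: the derivative of the inverse contains \<open>B\<close> itself only
  undifferentiated, so each order of regularity of \<open>B\<close> yields the next one.\<close>

lemma Ck_on_inverse_family:
  fixes A :: "'a::euclidean_space \<Rightarrow> 'b::euclidean_space \<Rightarrow> 'c::euclidean_space"
  assumes U: "open U" and A: "\<And>v. Ck_on k U (\<lambda>x. A x v)" "\<And>v. (\<lambda>x. A x v) differentiable_on U"
    and lin: "\<And>x. x \<in> U \<Longrightarrow> linear (A x)" "\<And>x. x \<in> U \<Longrightarrow> linear (B x)"
    and inv: "\<And>x v. x \<in> U \<Longrightarrow> B x (A x v) = v" "\<And>x w. x \<in> U \<Longrightarrow> A x (B x w) = w"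
  shows "Ck_on k U (\<lambda>x. B x w)"
proof -
  have d: "((\<lambda>y. B y w) has_derivative (\<lambda>h. - B x (dd (\<lambda>y. A y (B x w)) h x))) (at x)"
    if "x \<in> U" for x w
    by (rule inverse_family_has_derivative[OF U A(2)]) (use lin inv that in auto)
  show ?thesis
    using A(1)
  proof (induction k arbitrary: w)
    case 0
    have "isCont (\<lambda>x. B x w) x" if "x \<in> U" for x
      by (rule has_derivative_continuous[OF d[OF that]])
    then show ?case by (simp add: continuous_at_imp_continuous_on)
  next
    case (Suc k)
    have B: "Ck_on k U (\<lambda>x. B x w)" for w
      by (rule Suc.IH) (rule Ck_on_SucD[OF Suc.prems])
    have dA: "(\<lambda>y. A y z) differentiable (at x)" if "x \<in> U" for x z
      using A(2) U that by (auto intro: differentiable_on_openD)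
    have "Ck_on k U (\<lambda>x. dd (\<lambda>y. A y (B x w)) v x)" for v
    proof (rule Ck_on_apply_family[OF U, where A = "\<lambda>x z. dd (\<lambda>y. A y z) v x", OF _ _ B])
      show "linear (\<lambda>z. dd (\<lambda>y. A y z) v x)" if "x \<in> U" for x
        by (rule linear_dd_family[OF U that]) (use A(2) lin dA that in auto)
      show "Ck_on k U (\<lambda>x. dd (\<lambda>y. A y z) v x)" for z
        using Suc.prems[of z] by simp
    qed
    then have "Ck_on k U (\<lambda>x. - B x (dd (\<lambda>y. A y (B x w)) v x))" for v
      by (intro Ck_on_uminus[OF U]) (rule Ck_on_apply_family[OF U B lin(2)])
    then have "Ck_on k U (dd (\<lambda>x. B x w) v)" for v
      by (rule Ck_on_transform[OF U]) (simp add: dd_eqI[OF d])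
    moreover have "(\<lambda>x. B x w) differentiable (at x)" if "x \<in> U" for x
      unfolding differentiable_def using d[OF that] by blast
    ultimately show ?case
      by (simp add: differentiable_on_eq_differentiable_at[OF U])
  qed
qed

section \<open>Smooth functions and symmetry of second derivatives\<close>

lemma smooth_on_Ck: "smooth_on U f \<Longrightarrow> Ck_on k U f"
  by (simp add: smooth_on_def)

lemma smooth_on_subset: "smooth_on U f \<Longrightarrow> V \<subseteq> U \<Longrightarrow> smooth_on V f"
  unfolding smooth_on_def using Ck_on_subset by blast

lemma smooth_on_transform:
  "open U \<Longrightarrow> smooth_on U f \<Longrightarrow> (\<And>x. x \<in> U \<Longrightarrow> f x = g x) \<Longrightarrow> smooth_on U g"
  unfolding smooth_on_def using Ck_on_transform by blast

lemma smooth_on_dd: "smooth_on U f \<Longrightarrow> smooth_on U (dd f v)"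
  unfolding smooth_on_def using Ck_on.simps(2) by blast

lemma smooth_on_differentiable: "smooth_on U f \<Longrightarrow> open U \<Longrightarrow> x \<in> U \<Longrightarrow> f differentiable (at x)"
  using differentiable_on_openD smooth_on_Ck[of U f "Suc 0"] by auto

lemma smooth_on_has_derivative:
  "smooth_on U f \<Longrightarrow> open U \<Longrightarrow> x \<in> U \<Longrightarrow> (f has_derivative frechet_derivative f (at x)) (at x)"
  using differentiable_at_has_derivative smooth_on_differentiable by blast

lemma smooth_on_continuous_on: "smooth_on U f \<Longrightarrow> continuous_on U f"
  using smooth_on_Ck[of U f 0] by simp

lemma smooth_on_isCont: "smooth_on U f \<Longrightarrow> open U \<Longrightarrow> x \<in> U \<Longrightarrow> isCont f x"
  using smooth_on_continuous_on continuous_on_eq_continuous_at by blast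

lemma smooth_on_const: "smooth_on U (\<lambda>x. c)"
  by (simp add: smooth_on_def Ck_on_const)

lemma smooth_on_bounded_linear: "bounded_linear L \<Longrightarrow> open U \<Longrightarrow> smooth_on U f \<Longrightarrow> smooth_on U (\<lambda>x. L (f x))"
  by (simp add: smooth_on_def Ck_on_bounded_linear)

lemma smooth_on_id: "open U \<Longrightarrow> smooth_on U (\<lambda>x. x)"
  unfolding smooth_on_def
proof
  fix k assume U: "open U"
  show "Ck_on k U (\<lambda>x. x)"
    by (cases k) (auto simp: dd_eqI[OF has_derivative_ident] Ck_on_const)
qed

lemma smooth_on_add: "open U \<Longrightarrow> smooth_on U f \<Longrightarrow> smooth_on U g \<Longrightarrow> smooth_on U (\<lambda>x. f x + g x)"
  by (simp add: smooth_on_def Ck_on_add)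

lemma smooth_on_uminus: "open U \<Longrightarrow> smooth_on U f \<Longrightarrow> smooth_on U (\<lambda>x. - f x)"
  by (simp add: smooth_on_def Ck_on_uminus)

lemma smooth_on_diff: "open U \<Longrightarrow> smooth_on U f \<Longrightarrow> smooth_on U g \<Longrightarrow> smooth_on U (\<lambda>x. f x - g x)"
  using smooth_on_add[of U f "\<lambda>x. - g x"] smooth_on_uminus by auto

lemma smooth_on_bilinear:
  "bounded_bilinear B \<Longrightarrow> open U \<Longrightarrow> smooth_on U f \<Longrightarrow> smooth_on U g \<Longrightarrow> smooth_on U (\<lambda>x. B (f x) (g x))"
  by (simp add: smooth_on_def Ck_on_bilinear)

lemma smooth_on_compose:
  fixes f :: "'b::euclidean_space \<Rightarrow> 'c::real_normed_vector" and g :: "'a::euclidean_space \<Rightarrow> 'b"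
  shows "open U \<Longrightarrow> open V \<Longrightarrow> g ` U \<subseteq> V \<Longrightarrow> smooth_on V f \<Longrightarrow> smooth_on U g \<Longrightarrow> smooth_on U (\<lambda>x. f (g x))"
  unfolding smooth_on_def using Ck_on_compose by blast

lemma smooth_on_inverse_family:
  fixes A :: "'a::euclidean_space \<Rightarrow> 'b::euclidean_space \<Rightarrow> 'c::euclidean_space"
  assumes U: "open U" and A: "\<And>v. smooth_on U (\<lambda>x. A x v)"
    and "\<And>x. x \<in> U \<Longrightarrow> linear (A x)" "\<And>x. x \<in> U \<Longrightarrow> linear (B x)"
    and "\<And>x v. x \<in> U \<Longrightarrow> B x (A x v) = v" "\<And>x w. x \<in> U \<Longrightarrow> A x (B x w) = w"
  shows "smooth_on U (\<lambda>x. B x w)"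
  unfolding smooth_on_def
proof
  fix k
  have "(\<lambda>x. A x v) differentiable_on U" for v
    using A[THEN smooth_on_Ck, of "Suc 0"] by simp
  then show "Ck_on k U (\<lambda>x. B x w)"
    using assms A[THEN smooth_on_Ck] by (intro Ck_on_inverse_family[OF U, of k A B]) auto
qed

text \<open>A reciprocal is the inverse of a family of multiplications on the real line.\<close>

lemma smooth_on_inverse:
  fixes f :: "'a::euclidean_space \<Rightarrow> real"
  assumes "open U" "smooth_on U f" "\<And>x. x \<in> U \<Longrightarrow> f x \<noteq> 0"
  shows "smooth_on U (\<lambda>x. 1 / f x)"
proof -
  have "smooth_on U (\<lambda>x. inverse (f x) * 1)"
  proof (rule smooth_on_inverse_family[OF assms(1), where A = "\<lambda>x v. f x * v" and B = "\<lambda>x v. inverse (f x) * v"])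
    show "smooth_on U (\<lambda>x. f x * v)" for v
      by (rule smooth_on_bounded_linear[OF bounded_linear_mult_left assms(1,2)])
    show "linear ((*) c)" for c :: real using linear_times by auto
    then show "linear ((*) (inverse (f x)))" for x by blast
  qed (use assms(3) in auto)
  then show ?thesis by (simp add: divide_inverse)
qed

lemma dd_compose:
  assumes "g differentiable (at x)" "f differentiable (at (g x))"
  shows "dd (\<lambda>x. f (g x)) v x = dd f (dd g v x) (g x)"
  using frechet_derivative_compose[OF assms] by (simp add: o_def)

lemma dd_transform:
  assumes "f differentiable (at x)" "open U" "x \<in> U" "\<And>y. y \<in> U \<Longrightarrow> f y = g y"
  shows "dd f v x = dd g v x"
  using frechet_derivative_transform_within_open[OF assms] by simp

lemma dd_bilinear:
  assumes "bounded_bilinear B" "f differentiable (at x)" "g differentiable (at x)"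
  shows "dd (\<lambda>x. B (f x) (g x)) v x = B (f x) (dd g v x) + B (dd f v x) (g x)"
  by (rule dd_eqI[OF bounded_bilinear.FDERIV[OF assms(1) assms(2,3)[THEN differentiable_at_has_derivative]]])

lemma dd_bounded_linear:
  assumes "bounded_linear L" "f differentiable (at x)"
  shows "dd (\<lambda>x. L (f x)) v x = L (dd f v x)"
  by (rule dd_eqI[OF bounded_linear.has_derivative[OF assms(1) differentiable_at_has_derivative[OF assms(2)]]])

lemma dd_add:
  assumes "f differentiable (at x)" "g differentiable (at x)"
  shows "dd (\<lambda>x. f x + g x) v x = dd f v x + dd g v x"
  using assms by (intro dd_eqI has_derivative_add differentiable_at_has_derivative)

lemma dd_diff:
  assumes "f differentiable (at x)" "g differentiable (at x)"
  shows "dd (\<lambda>x. f x - g x) v x = dd f v x - dd g v x"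
  using assms by (intro dd_eqI has_derivative_diff differentiable_at_has_derivative)

text \<open>Two applications of the mean value theorem, along \<open>u\<close> to a difference in
  direction \<open>v\<close> and then along \<open>v\<close>. The second difference itself is
  symmetric in \<open>u\<close> and \<open>v\<close>, although the right-hand side does not look
  so.\<close>

lemma second_difference_mvt:
  fixes f :: "'a::euclidean_space \<Rightarrow> real"
  assumes f: "smooth_on U f" and U: "open U" and t: "t > 0"
    and sub: "\<And>a b. 0 \<le> a \<Longrightarrow> a \<le> t \<Longrightarrow> 0 \<le> b \<Longrightarrow> b \<le> t \<Longrightarrow> x + a *\<^sub>R u + b *\<^sub>R v \<in> U"
  obtains a b where "0 \<le> a" "a \<le> t" "0 \<le> b" "b \<le> t"
    "f (x + t *\<^sub>R u + t *\<^sub>R v) - f (x + t *\<^sub>R u) - f (x + t *\<^sub>R v) + f x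
      = t * t * dd (dd f u) v (x + a *\<^sub>R u + b *\<^sub>R v)"
proof -
  have D: "((\<lambda>a. h (c + a *\<^sub>R w)) has_real_derivative dd h w (c + a *\<^sub>R w)) (at a)"
    if "smooth_on U h" "c + a *\<^sub>R w \<in> U" for h :: "'a \<Rightarrow> real" and c w a
  proof -
    have lin: "((\<lambda>a. c + a *\<^sub>R w) has_derivative (\<lambda>s. s *\<^sub>R w)) (at a)"
      by (auto intro!: derivative_eq_intros)
    have h: "(h has_derivative frechet_derivative h (at (c + a *\<^sub>R w))) (at (c + a *\<^sub>R w))"
      using smooth_on_has_derivative[OF that(1) U that(2)] .
    have "((\<lambda>a. h (c + a *\<^sub>R w)) has_derivative (\<lambda>s. dd h (s *\<^sub>R w) (c + a *\<^sub>R w))) (at a)"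
      using diff_chain_at[OF lin h] by (simp add: o_def)
    then show ?thesis
      unfolding has_field_derivative_def
      using mult_commute_abs[of "dd h w (c + a *\<^sub>R w)"] by (simp add: linear_scale[OF has_derivative_linear[OF h]])
  qed
  define \<phi> where "\<phi> a = f ((x + t *\<^sub>R v) + a *\<^sub>R u) - f (x + a *\<^sub>R u)" for a
  have "(\<phi> has_real_derivative dd f u ((x + t *\<^sub>R v) + a *\<^sub>R u) - dd f u (x + a *\<^sub>R u)) (at a)"
    if "0 \<le> a" "a \<le> t" for a
  proof -
    have "(x + t *\<^sub>R v) + a *\<^sub>R u = x + a *\<^sub>R u + t *\<^sub>R v" by (simp add: add_ac)
    then have "(x + t *\<^sub>R v) + a *\<^sub>R u \<in> U" "x + a *\<^sub>R u \<in> U"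
      using sub[of a t] sub[of a 0] t that by (auto simp: add_ac)
    then show ?thesis unfolding \<phi>_def by (intro DERIV_diff D[OF f])
  qed
  from MVT2[where f = \<phi> and f' = "\<lambda>a. dd f u ((x + t *\<^sub>R v) + a *\<^sub>R u) - dd f u (x + a *\<^sub>R u)", OF t this]
  obtain a where a: "0 < a" "a < t"
    "\<phi> t - \<phi> 0 = (t - 0) * (dd f u ((x + t *\<^sub>R v) + a *\<^sub>R u) - dd f u (x + a *\<^sub>R u))"
    by blast
  have eq1: "f (x + t *\<^sub>R u + t *\<^sub>R v) - f (x + t *\<^sub>R u) - f (x + t *\<^sub>R v) + f x
     = t * (dd f u ((x + a *\<^sub>R u) + t *\<^sub>R v) - dd f u (x + a *\<^sub>R u))"
  proof -
    have "x + t *\<^sub>R v + t *\<^sub>R u = x + t *\<^sub>R u + t *\<^sub>R v" "x + t *\<^sub>R v + a *\<^sub>R u = x + a *\<^sub>R u + t *\<^sub>R v"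
      by (simp_all only: add_ac)
    with a(3) show ?thesis by (simp add: \<phi>_def)
  qed
  define \<psi> where "\<psi> b = dd f u ((x + a *\<^sub>R u) + b *\<^sub>R v)" for b
  have "(\<psi> has_real_derivative dd (dd f u) v ((x + a *\<^sub>R u) + b *\<^sub>R v)) (at b)"
    if "0 \<le> b" "b \<le> t" for b
    unfolding \<psi>_def using sub[of a b] a that by (intro D[OF smooth_on_dd[OF f]]) auto
  from MVT2[where f = \<psi> and f' = "\<lambda>b. dd (dd f u) v ((x + a *\<^sub>R u) + b *\<^sub>R v)", OF t this]
  obtain b where b: "0 < b" "b < t" and
    "\<psi> t - \<psi> 0 = (t - 0) * dd (dd f u) v ((x + a *\<^sub>R u) + b *\<^sub>R v)"
    by blast
  then have "dd f u ((x + a *\<^sub>R u) + t *\<^sub>R v) - dd f u (x + a *\<^sub>R u) = t * dd (dd f u) v ((x + a *\<^sub>R u) + b *\<^sub>R v)"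
    by (simp add: \<psi>_def)
  with eq1 have "f (x + t *\<^sub>R u + t *\<^sub>R v) - f (x + t *\<^sub>R u) - f (x + t *\<^sub>R v) + f x
     = t * t * dd (dd f u) v (x + a *\<^sub>R u + b *\<^sub>R v)" by (simp only: mult.assoc)
  then show thesis using a b by (intro that[of a b]) auto
qed

text \<open>Evaluating one second difference in both orders makes the two mixed derivatives agree at
  some pair of points arbitrarily close to \<open>x\<close>; continuity carries the equality to
  \<open>x\<close>.\<close>

lemma second_derivatives_commute_real:
  fixes f :: "'a::euclidean_space \<Rightarrow> real"
  assumes f: "smooth_on U f" and U: "open U" and x: "x \<in> U"
  shows "dd (dd f u) v x = dd (dd f v) u x"
proof -
  have close: "\<exists>y\<in>ball x d. \<exists>z\<in>ball x d. dd (dd f u) v y = dd (dd f v) u z" if d: "d > 0" for d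
  proof -
    obtain e where e: "e > 0" "ball x e \<subseteq> U" using U x open_contains_ball by blast
    define m where "m = min d e"
    \<comment> \<open>Small enough for the parallelogram with sides \<open>t *\<^sub>R u\<close> and
      \<open>t *\<^sub>R v\<close> to stay in the ball of radius \<open>m\<close>; the summand 1
      keeps the denominator positive when both vectors vanish.\<close>
    define t where "t = m / (2 * (norm u + norm v + 1))"
    have m: "m > 0" using d e by (simp add: m_def)
    have pos: "norm u + norm v + 1 > 0" using norm_ge_zero[of u] norm_ge_zero[of v] by linarith
    then have t: "t > 0" using m by (simp add: t_def)
    have small: "x + a *\<^sub>R u + b *\<^sub>R v \<in> ball x m"
      if "0 \<le> a" "a \<le> t" "0 \<le> b" "b \<le> t" for a b
    proof -
      have "norm (a *\<^sub>R u + b *\<^sub>R v) \<le> t * norm u + t * norm v"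
        using that by (intro norm_triangle_le add_mono) (auto intro!: mult_right_mono)
      also have "\<dots> = t * (norm u + norm v)" by (simp add: distrib_left)
      also have "\<dots> < t * (2 * (norm u + norm v + 1))"
        using t pos by (intro mult_strict_left_mono) auto
      also have "\<dots> = m" using pos by (simp add: t_def)
      finally show ?thesis by (simp add: dist_norm norm_minus_commute algebra_simps)
    qed
    have sub: "x + a *\<^sub>R u + b *\<^sub>R v \<in> U" if "0 \<le> a" "a \<le> t" "0 \<le> b" "b \<le> t" for a b
      using small[OF that] e by (auto simp: m_def)
    obtain a b where ab: "0 \<le> a" "a \<le> t" "0 \<le> b" "b \<le> t"
      "f (x + t *\<^sub>R u + t *\<^sub>R v) - f (x + t *\<^sub>R u) - f (x + t *\<^sub>R v) + f x
      = t * t * dd (dd f u) v (x + a *\<^sub>R u + b *\<^sub>R v)"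
      using second_difference_mvt[OF f U t sub] by blast
    have sub': "x + a *\<^sub>R v + b *\<^sub>R u \<in> U" if "0 \<le> a" "a \<le> t" "0 \<le> b" "b \<le> t" for a b
      using sub[of b a] that by (simp add: algebra_simps)
    obtain a' b' where ab': "0 \<le> a'" "a' \<le> t" "0 \<le> b'" "b' \<le> t"
      "f (x + t *\<^sub>R v + t *\<^sub>R u) - f (x + t *\<^sub>R v) - f (x + t *\<^sub>R u) + f x
      = t * t * dd (dd f v) u (x + a' *\<^sub>R v + b' *\<^sub>R u)"
      using second_difference_mvt[OF f U t sub'] by blast
    have "t * t * dd (dd f u) v (x + a *\<^sub>R u + b *\<^sub>R v) = t * t * dd (dd f v) u (x + a' *\<^sub>R v + b' *\<^sub>R u)"
      using ab(5) ab'(5) by (simp add: algebra_simps)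
    then have "dd (dd f u) v (x + a *\<^sub>R u + b *\<^sub>R v) = dd (dd f v) u (x + a' *\<^sub>R v + b' *\<^sub>R u)"
      using t by simp
    moreover have "x + a *\<^sub>R u + b *\<^sub>R v \<in> ball x d" using small[OF ab(1-4)] by (auto simp: m_def)
    moreover have "x + a' *\<^sub>R v + b' *\<^sub>R u \<in> ball x d"
      using small[OF ab'(3,4,1,2)] by (auto simp: m_def algebra_simps)
    ultimately show ?thesis by blast
  qed
  have c1: "isCont (dd (dd f u) v) x" and c2: "isCont (dd (dd f v) u) x"
    by (rule smooth_on_isCont[OF smooth_on_dd[OF smooth_on_dd[OF f]] U x])+
  show ?thesis
  proof (rule ccontr)
    assume ne: "dd (dd f u) v x \<noteq> dd (dd f v) u x"
    define e where "e = \<bar>dd (dd f u) v x - dd (dd f v) u x\<bar> / 2"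
    have e: "e > 0" using ne by (simp add: e_def)
    obtain d1 where d1: "d1 > 0" "\<forall>y. dist y x < d1 \<longrightarrow> dist (dd (dd f u) v y) (dd (dd f u) v x) < e"
      using c1 e unfolding continuous_at_eps_delta by blast
    obtain d2 where d2: "d2 > 0" "\<forall>y. dist y x < d2 \<longrightarrow> dist (dd (dd f v) u y) (dd (dd f v) u x) < e"
      using c2 e unfolding continuous_at_eps_delta by blast
    obtain y z where yz: "y \<in> ball x (min d1 d2)" "z \<in> ball x (min d1 d2)" "dd (dd f u) v y = dd (dd f v) u z"
      using close[of "min d1 d2"] d1 d2 by auto
    have "\<bar>dd (dd f u) v y - dd (dd f u) v x\<bar> < e" "\<bar>dd (dd f v) u z - dd (dd f v) u x\<bar> < e"
      using yz(1,2) d1(2)[rule_format, of y] d2(2)[rule_format, of z]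
      by (simp_all add: dist_real_def dist_commute)
    then show False using yz(3) unfolding e_def by (simp add: abs_if field_simps split: if_splits)
  qed
qed

lemma second_derivatives_commute:
  fixes f :: "'a::euclidean_space \<Rightarrow> 'b::euclidean_space"
  assumes f: "smooth_on U f" and U: "open U" and x: "x \<in> U"
  shows "dd (dd f u) v x = dd (dd f v) u x"
proof (rule euclidean_eqI)
  fix b :: 'b
  have comp: "dd (\<lambda>y. g y \<bullet> b) w y = dd g w y \<bullet> b" if "smooth_on U g" "y \<in> U" for g :: "'a \<Rightarrow> 'b" and w y
    by (rule dd_bounded_linear[OF bounded_linear_inner_left smooth_on_differentiable[OF that(1) U that(2)]])
  have fb: "smooth_on U (\<lambda>y. f y \<bullet> b)"
    by (rule smooth_on_bounded_linear[OF bounded_linear_inner_left U f])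
  have "dd (dd (\<lambda>y. f y \<bullet> b) u) v x = dd (dd f u) v x \<bullet> b" for u v
  proof -
    have "dd (dd (\<lambda>y. f y \<bullet> b) u) v x = dd (\<lambda>y. dd f u y \<bullet> b) v x"
      by (rule dd_transform[OF smooth_on_differentiable[OF smooth_on_dd[OF fb] U x] U x]) (rule comp[OF f])
    then show ?thesis using comp[OF smooth_on_dd[OF f] x] by simp
  qed
  then show "dd (dd f u) v x \<bullet> b = dd (dd f v) u x \<bullet> b"
    using second_derivatives_commute_real[OF fb U x] by metis
qed

section \<open>Local sections of submersions, and the curvature in coordinates\<close>

lemma differentiable_bounded_linear:
  "bounded_linear L \<Longrightarrow> f differentiable F \<Longrightarrow> (\<lambda>x. L (f x)) differentiable F"
  unfolding differentiable_def using bounded_linear.has_derivative by blast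

text \<open>The inverse function theorem is applied to \<open>F\<close> on the affine slice
  \<open>z0 + L y\<close>, where its derivative at 0 is the identity. The point is that the
  derivative of the section can be prescribed: any linear right inverse \<open>L\<close> occurs, in
  particular a horizontal one.\<close>

lemma smooth_local_section:
  fixes F :: "'a::euclidean_space \<Rightarrow> 'b::euclidean_space"
  assumes U: "open U" and F: "smooth_on U F" and z0: "z0 \<in> U"
    and L: "linear L" and FL: "\<And>v. dd F (L v) z0 = v"
  obtains V \<tau> where "open V" "F z0 \<in> V" "smooth_on V \<tau>" "\<tau> ` V \<subseteq> U"
    "\<And>x. x \<in> V \<Longrightarrow> F (\<tau> x) = x" "\<tau> (F z0) = z0" "\<And>v. dd \<tau> v (F z0) = L v"
proof -
  have blL: "bounded_linear L" using L linear_conv_bounded_linear by blast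
  have L0: "L 0 = 0" using L linear_0 by blast
  define aff where "aff y = z0 + L y" for y
  have aff: "smooth_on S aff" if "open S" for S
    unfolding aff_def by (intro smooth_on_add smooth_on_const smooth_on_bounded_linear[OF blL] smooth_on_id that)
  define U0 where "U0 = aff -` U"
  have U0: "open U0"
    unfolding U0_def using smooth_on_continuous_on[OF aff[OF open_UNIV]] by (rule open_vimage[OF U])
  have z0': "0 \<in> U0" using z0 L0 by (simp add: U0_def aff_def)
  define f where "f y = F (aff y)" for y
  have f: "smooth_on U0 f"
    unfolding f_def by (rule smooth_on_compose[OF U0 U _ F aff[OF U0]]) (auto simp: U0_def)
  have df: "(f has_derivative frechet_derivative f (at y)) (at y)" if "y \<in> U0" for y
    using smooth_on_has_derivative[OF f U0 that] .
  have df0: "dd f v 0 = v" for v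
  proof -
    have "(aff has_derivative L) (at 0)"
      unfolding aff_def using bounded_linear.has_derivative[OF blL has_derivative_ident]
      by (auto intro!: derivative_eq_intros)
    moreover have "(F has_derivative frechet_derivative F (at (aff 0))) (at (aff 0))"
      using smooth_on_has_derivative[OF F U] z0' by (simp add: U0_def)
    ultimately have "(f has_derivative (frechet_derivative F (at (aff 0)) o L)) (at 0)"
      using diff_chain_at unfolding f_def o_def by blast
    then show ?thesis using dd_eqI FL L0 by (fastforce simp: aff_def)
  qed
  define f' where "f' y = Blinfun (frechet_derivative f (at y))" for y
  have f': "blinfun_apply (f' y) = frechet_derivative f (at y)" if "y \<in> U0" for y
    unfolding f'_def by (rule bounded_linear_Blinfun_apply[OF has_derivative_bounded_linear[OF df[OF that]]])
  have "continuous_on U0 f'"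
  proof (rule continuous_on_blinfun_componentwise)
    fix i :: 'b
    show "continuous_on U0 (\<lambda>y. blinfun_apply (f' y) i)"
      using smooth_on_continuous_on[OF smooth_on_dd[OF f, of i]] f' by (simp cong: continuous_on_cong)
  qed
  moreover have "id_blinfun o\<^sub>L f' 0 = id_blinfun"
    by (rule blinfun_eqI) (simp add: f' z0' df0)
  moreover have "(f has_derivative blinfun_apply (f' y)) (at y)" if "y \<in> U0" for y
    using df that f' by simp
  ultimately obtain U' V g g' where U': "open U'" "U' \<subseteq> U0" "0 \<in> U'" and V: "open V" "f 0 \<in> V"
    and hom: "homeomorphism U' V f g"
    and g: "\<And>y. y \<in> V \<Longrightarrow> (g has_derivative (g' y)) (at y)"
    and g': "\<And>y. y \<in> V \<Longrightarrow> g' y = inv (blinfun_apply (f'(g y)))"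
    and bij: "\<And>y. y \<in> V \<Longrightarrow> bij (blinfun_apply (f'(g y)))"
    using inverse_function_theorem[of U0 f f' 0 id_blinfun] U0 z0' by metis
  have gU: "g y \<in> U0" "f (g y) = y" if "y \<in> V" for y
    using hom U' that by (auto simp: homeomorphism_def)
  have g0: "g (f 0) = 0" using hom U' by (auto simp: homeomorphism_def)
  define A where "A y = frechet_derivative f (at (g y))" for y
  have A: "g' y = inv (A y)" "bij (A y)" "linear (A y)" if "y \<in> V" for y
    using g' bij f' gU that has_derivative_linear[OF df[OF gU(1)[OF that]]] by (auto simp: A_def)
  have dg: "dd g v y = g' y v" if "y \<in> V" for v y by (rule dd_eqI[OF g[OF that]])
  have gdiff: "g differentiable (at y)" if "y \<in> V" for y
    using g[OF that] by (auto simp: differentiable_def)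
  \<comment> \<open>The inverse function theorem supplies only one derivative. As it is the inverse
    of the derivative of \<open>f\<close> at \<open>g y\<close>, regularity of \<open>g\<close>
    raises itself by one order.\<close>
  have "Ck_on k V g" for k
  proof (induction k)
    case 0
    then show ?case using hom by (simp add: homeomorphism_def)
  next
    case (Suc k)
    have "Ck_on k V (\<lambda>y. g' y v)" for v
    proof (rule Ck_on_inverse_family[OF V(1), where A = A and B = g'])
      show "Ck_on k V (\<lambda>x. A x v)" for v
        unfolding A_def
        by (rule Ck_on_compose[OF V(1) U0 _ smooth_on_Ck[OF smooth_on_dd[OF f]] Suc.IH]) (use gU in auto)
      show "(\<lambda>x. A x v) differentiable_on V" for v
        unfolding A_def differentiable_on_eq_differentiable_at[OF V(1)]
      proof
        fix y assume y: "y \<in> V"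
        show "(\<lambda>x. dd f v (g x)) differentiable at y"
          using differentiable_chain_at[OF gdiff[OF y] smooth_on_differentiable[OF smooth_on_dd[OF f, of v] U0 gU(1)[OF y]]]
          by (simp add: o_def)
      qed
      show "linear (A y)" if "y \<in> V" for y by (rule A(3)[OF that])
      show "linear (g' y)" if "y \<in> V" for y using has_derivative_linear[OF g[OF that]] .
      show "g' y (A y v) = v" if "y \<in> V" for y v
        using A[OF that] by (simp add: bij_is_inj)
      show "A y (g' y v) = v" if "y \<in> V" for y v
        using A[OF that] by (simp add: bij_is_surj surj_f_inv_f)
    qed
    then have "Ck_on k V (dd g v)" for v
      by (rule Ck_on_transform[OF V(1)]) (simp add: dg)
    then show ?case by (simp add: differentiable_on_eq_differentiable_at[OF V(1)] gdiff)
  qed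
  then have gs: "smooth_on V g" by (simp add: smooth_on_def)
  have f0: "f 0 = F z0" by (simp add: f_def aff_def L0)
  have affg: "smooth_on V (\<lambda>y. aff (g y))"
    by (rule smooth_on_compose[OF V(1) open_UNIV _ aff[OF open_UNIV] gs]) auto
  have "dd (\<lambda>y. aff (g y)) v (F z0) = L v" for v
  proof -
    have "g' (f 0) v = v"
    proof -
      have "A (f 0) = id" by (auto simp: A_def g0 df0)
      then show ?thesis using A(1)[OF V(2)] by simp
    qed
    moreover have "((\<lambda>y. aff (g y)) has_derivative (\<lambda>v. L (g' (f 0) v))) (at (f 0))"
      unfolding aff_def using bounded_linear.has_derivative[OF blL g[OF V(2)]]
      by (auto intro!: derivative_eq_intros)
    ultimately show ?thesis using dd_eqI f0 by fastforce
  qed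
  moreover have "(\<lambda>y. aff (g y)) ` V \<subseteq> U" using gU by (auto simp: U0_def)
  ultimately show thesis
    using that[of V "\<lambda>y. aff (g y)"] V affg gU g0 f0 by (auto simp: f_def aff_def L0)
qed

lemma smooth_on_apply_family:
  fixes A :: "'a::euclidean_space \<Rightarrow> 'b::euclidean_space \<Rightarrow> 'c::real_normed_vector"
  assumes "open U" "\<And>v. smooth_on U (\<lambda>x. A x v)" "\<And>x. x \<in> U \<Longrightarrow> linear (A x)" "smooth_on U w"
  shows "smooth_on U (\<lambda>x. A x (w x))"
  using assms unfolding smooth_on_def by (auto intro: Ck_on_apply_family)

lemma smooth_on_sum:
  assumes "open U" "\<And>i. i \<in> I \<Longrightarrow> smooth_on U (f i)"
  shows "smooth_on U (\<lambda>x. \<Sum>i\<in>I. f i x)"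
  using assms unfolding smooth_on_def by (auto intro!: Ck_on_sum)

section \<open>The Levi-Civita connection of a metric in coordinates\<close>

locale riemannian_domain =
  fixes U :: "'a::euclidean_space set" and g :: "'a metric_field"
  assumes U: "open U" and g: "riemannian_metric_on U g"
begin

lemma linear_left: "y \<in> U \<Longrightarrow> linear (\<lambda>v. g y v w)"
  and linear_right: "y \<in> U \<Longrightarrow> linear (g y v)"
  and sym: "y \<in> U \<Longrightarrow> g y v w = g y w v"
  and pos: "y \<in> U \<Longrightarrow> v \<noteq> 0 \<Longrightarrow> g y v v > 0"
  and smooth: "smooth_on U (\<lambda>y. g y v w)"
  using g unfolding riemannian_metric_on_def bilinear_def by blast+

lemma diff: "y \<in> U \<Longrightarrow> (\<lambda>y. g y v w) differentiable (at y)"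
  by (rule smooth_on_differentiable[OF smooth U])

lemma eq_by_metric:
  assumes "y \<in> U" "\<And>w. g y z w = g y z' w" shows "z = z'"
proof (rule ccontr)
  assume "z \<noteq> z'"
  then have "g y (z - z') (z - z') > 0" using pos assms(1) by simp
  moreover have "g y (z - z') (z - z') = 0"
    using linear_diff[OF linear_left[OF assms(1)]] assms(2) by simp
  ultimately show False by simp
qed

definition koszul :: "'a \<Rightarrow> 'a \<Rightarrow> 'a \<Rightarrow> 'a \<Rightarrow> real" where
  "koszul y u v w = dd (\<lambda>y. g y v w) u y + dd (\<lambda>y. g y u w) v y - dd (\<lambda>y. g y u v) w y"

lemma linear_koszul: "y \<in> U \<Longrightarrow> linear (koszul y u v)"
  unfolding koszul_def
  by (intro linear_compose_add linear_compose_sub linear_dd_family[OF U] linear_frechet_derivative diff linear_right)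

lemma smooth_koszul: "smooth_on U (\<lambda>y. koszul y u v w)"
  unfolding koszul_def by (intro smooth_on_add smooth_on_diff smooth_on_dd smooth U)

text \<open>\<open>flat y\<close> is the index-lowering isomorphism, with covectors identified with vectors by the
  Euclidean inner product.\<close>

definition flat :: "'a \<Rightarrow> 'a \<Rightarrow> 'a" where
  "flat y z = (\<Sum>b\<in>Basis. g y z b *\<^sub>R b)"

lemma inner_flat: "y \<in> U \<Longrightarrow> flat y z \<bullet> w = g y z w"
  using linear_basis_expansion[OF linear_right, of y z w]
  by (simp add: flat_def inner_sum_left mult.commute inner_commute[of w])

lemma linear_flat: "y \<in> U \<Longrightarrow> linear (flat y)"
  unfolding flat_def
  by (intro linear_compose_sum ballI linear_compose[OF linear_left linear_scaleR_left, unfolded o_def])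

lemma bij_flat: "y \<in> U \<Longrightarrow> bij (flat y)"
proof -
  assume y: "y \<in> U"
  have "inj (flat y)"
    by (rule injI) (metis y eq_by_metric inner_flat)
  then show ?thesis using linear_inj_imp_surj[OF linear_flat[OF y]] by (simp add: bij_def)
qed

definition sharp :: "'a \<Rightarrow> 'a \<Rightarrow> 'a" where
  "sharp y = inv (flat y)"

lemma christoffel_unique:
  assumes y: "y \<in> U" and "\<And>w. 2 * g y z w = koszul y u v w"
  shows "christoffel g y u v = z"
  unfolding christoffel_def koszul_def[symmetric]
proof (rule the_equality)
  fix z' assume "\<forall>w. 2 * g y z' w = koszul y u v w"
  then have "g y z' w = g y z w" for w using assms(2)[of w] by (auto dest: spec[of _ w])
  then show "z' = z" using eq_by_metric[OF y] by blast
qed (use assms in auto)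

lemma christoffel_eq_sharp:
  assumes y: "y \<in> U"
  shows "christoffel g y u v = sharp y (\<Sum>b\<in>Basis. (koszul y u v b / 2) *\<^sub>R b)"
proof (rule christoffel_unique[OF y])
  fix w
  have "flat y (sharp y z) = z" for z
    using bij_flat[OF y] by (simp add: sharp_def bij_is_surj surj_f_inv_f)
  then have "2 * g y (sharp y (\<Sum>b\<in>Basis. (koszul y u v b / 2) *\<^sub>R b)) w
      = (\<Sum>b\<in>Basis. (w \<bullet> b) *\<^sub>R koszul y u v b)"
    by (simp add: inner_flat[OF y, symmetric] inner_sum_left sum_distrib_left mult.commute inner_commute[of w])
  also have "\<dots> = koszul y u v w"
    using linear_basis_expansion[OF linear_koszul[OF y], of u v w] by simp
  finally show "2 * g y (sharp y (\<Sum>b\<in>Basis. (koszul y u v b / 2) *\<^sub>R b)) w = koszul y u v w" .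
qed

lemma christoffel_koszul:
  assumes y: "y \<in> U" shows "2 * g y (christoffel g y u v) w = koszul y u v w"
proof -
  have "flat y (sharp y z) = z" for z
    using bij_flat[OF y] by (simp add: sharp_def bij_is_surj surj_f_inv_f)
  then have "2 * g y (christoffel g y u v) w = (\<Sum>b\<in>Basis. (w \<bullet> b) *\<^sub>R koszul y u v b)"
    unfolding christoffel_eq_sharp[OF y]
    by (simp add: inner_flat[OF y, symmetric] inner_sum_left sum_distrib_left mult.commute inner_commute[of w])
  then show ?thesis using linear_basis_expansion[OF linear_koszul[OF y], of u v w] by simp
qed

text \<open>The definite description hides how the symbols depend on the point. Written through
  \<open>sharp\<close>, they are an inverse family applied to derivatives of the metric.\<close>

lemma smooth_christoffel: "smooth_on U (\<lambda>y. christoffel g y u v)"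
proof (rule smooth_on_transform[OF U])
  have sharp: "smooth_on U (\<lambda>y. sharp y w)" for w
  proof (rule smooth_on_inverse_family[OF U, where A = flat and B = sharp])
    show "smooth_on U (\<lambda>y. flat y v)" for v unfolding flat_def
      by (intro smooth_on_sum smooth_on_bounded_linear[OF bounded_linear_scaleR_left] U smooth)
    show "linear (sharp y)" if "y \<in> U" for y
      using linear_flat[OF that] bij_flat[OF that] unfolding sharp_def bij_def
      by (metis inj_linear_imp_inv_linear)
    show "sharp y (flat y v) = v" if "y \<in> U" for y v
      using bij_flat[OF that] by (simp add: sharp_def bij_is_inj)
    show "flat y (sharp y v) = v" if "y \<in> U" for y v
      using bij_flat[OF that] by (simp add: sharp_def bij_is_surj surj_f_inv_f)
  qed (rule linear_flat)
  show "smooth_on U (\<lambda>y. sharp y (\<Sum>b\<in>Basis. (koszul y u v b / 2) *\<^sub>R b))"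
  proof (rule smooth_on_apply_family[OF U sharp])
    show "linear (sharp y)" if "y \<in> U" for y
      using linear_flat[OF that] bij_flat[OF that] unfolding sharp_def bij_def
      by (metis inj_linear_imp_inv_linear)
    show "smooth_on U (\<lambda>y. \<Sum>b\<in>Basis. (koszul y u v b / 2) *\<^sub>R b)"
      by (intro smooth_on_sum smooth_on_bounded_linear[OF bounded_linear_scaleR_left]
         smooth_on_bounded_linear[OF bounded_linear_divide] U smooth_koszul)
  qed
qed (use christoffel_eq_sharp in auto)

text \<open>Derivatives of the Christoffel symbols are eliminated:
  \<open>g y (christoffel g y a b) u\<close> is differentiated once by the product rule and once
  through the Koszul formula. What remains of the connection is its value at \<open>x\<close>, where
  a section horizontal there is easy to handle.\<close>

lemma curvature_second_derivatives:
  assumes x: "x \<in> U"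
  shows "g x (curvature g x u v v) u =
    - dd (dd (\<lambda>y. g y v v) u) u x / 2 - dd (dd (\<lambda>y. g y u u) v) v x / 2 + dd (dd (\<lambda>y. g y u v) v) u x
    + g x (christoffel g x u v) (christoffel g x u v) - g x (christoffel g x u u) (christoffel g x v v)"
proof -
  let ?\<Gamma> = "christoffel g"
  have csym: "?\<Gamma> y a b = ?\<Gamma> y b a" if "y \<in> U" for y a b
  proof (rule eq_by_metric[OF that])
    have "(\<lambda>y. g y a b) differentiable (at y)" by (rule diff[OF that])
    moreover have "dd (\<lambda>y. g y a b) w y = dd (\<lambda>y. g y b a) w y" for w
      by (rule dd_transform[OF diff[OF that] U that]) (rule sym)
    ultimately show "g y (?\<Gamma> y a b) w = g y (?\<Gamma> y b a) w" for w
      using christoffel_koszul[OF that, of a b w] christoffel_koszul[OF that, of b a w] by (simp add: koszul_def)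
  qed
  \<comment> \<open>Compatibility of the connection with the metric: in the sum of two Koszul
    formulas four of the six derivatives cancel.\<close>
  have compat: "dd (\<lambda>y. g y z w) a x = g x (?\<Gamma> x a z) w + g x z (?\<Gamma> x a w)" for z w a
  proof -
    have "dd (\<lambda>y. g y c b) e x = dd (\<lambda>y. g y b c) e x" for b c e
      by (rule dd_transform[OF diff[OF x] U x]) (rule sym)
    note this[of w z a] this[of a z w] this[of a w z]
    then show ?thesis
      using christoffel_koszul[OF x, of a z w] christoffel_koszul[OF x, of a w z] sym[OF x, of z "?\<Gamma> x a w"]
      unfolding koszul_def by linarith
  qed
  have diffg: "(\<lambda>y. ?\<Gamma> y a b) differentiable (at x)" for a b
    by (rule smooth_on_differentiable[OF smooth_christoffel U x])
  \<comment> \<open>Both the metric and its first argument vary; the expansion in the basis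
    separates the two dependences.\<close>
  have product: "dd (\<lambda>y. g y (?\<Gamma> y a b) w) c x = dd (\<lambda>y. g y (?\<Gamma> x a b) w) c x + g x (dd (\<lambda>y. ?\<Gamma> y a b) c x) w"
    for a b w c
  proof -
    have s: "(\<lambda>y. ?\<Gamma> y a b \<bullet> e) differentiable (at x)" for e
      using diffg[of a b] differentiable_bounded_linear[OF bounded_linear_inner_left] by blast
    have 1: "((\<lambda>y. \<Sum>e\<in>Basis. (?\<Gamma> y a b \<bullet> e) *\<^sub>R g y e w) has_derivative
      (\<lambda>h. \<Sum>e\<in>Basis. (?\<Gamma> x a b \<bullet> e) *\<^sub>R dd (\<lambda>y. g y e w) h x + dd (\<lambda>y. ?\<Gamma> y a b \<bullet> e) h x *\<^sub>R g x e w)) (at x)"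
      by (intro has_derivative_sum has_derivative_scaleR differentiable_at_has_derivative s diff[OF x])
    have "(\<Sum>e\<in>Basis. (?\<Gamma> y a b \<bullet> e) *\<^sub>R g y e w) = g y (?\<Gamma> y a b) w" if "y \<in> U" for y
      using linear_basis_expansion[OF linear_left[OF that], of "?\<Gamma> y a b" w] by simp
    then have "((\<lambda>y. g y (?\<Gamma> y a b) w) has_derivative
      (\<lambda>h. \<Sum>e\<in>Basis. (?\<Gamma> x a b \<bullet> e) *\<^sub>R dd (\<lambda>y. g y e w) h x + dd (\<lambda>y. ?\<Gamma> y a b \<bullet> e) h x *\<^sub>R g x e w)) (at x)"
      by (rule has_derivative_transform_within_open[OF 1 U x])
    note 2 = dd_eqI[OF this]
    have "dd (\<lambda>y. ?\<Gamma> y a b \<bullet> e) h x = dd (\<lambda>y. ?\<Gamma> y a b) h x \<bullet> e" for e h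
      by (rule dd_bounded_linear[OF bounded_linear_inner_left diffg])
    moreover have "(\<Sum>e\<in>Basis. (z \<bullet> e) *\<^sub>R g x e w) = g x z w" for z
      using linear_basis_expansion[OF linear_left[OF x], of z w] by simp
    moreover have "linear (\<lambda>z. dd (\<lambda>y. g y z w) c x)"
      by (rule linear_dd_family[OF U x diff[OF x] linear_left])
    from linear_basis_expansion[OF this, of "?\<Gamma> x a b"]
    have "(\<Sum>e\<in>Basis. (?\<Gamma> x a b \<bullet> e) *\<^sub>R dd (\<lambda>y. g y e w) c x) = dd (\<lambda>y. g y (?\<Gamma> x a b) w) c x" by simp
    ultimately show ?thesis unfolding 2 sum.distrib by simp
  qed
  have ds: "dd (\<lambda>y. g y a b) c differentiable (at x)" for a b c
    by (rule smooth_on_differentiable[OF smooth_on_dd[OF smooth] U x])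
  have gd: "(\<lambda>y. g y (?\<Gamma> y a b) w) differentiable (at x)" for a b w
  proof -
    have "smooth_on U (\<lambda>y. g y (?\<Gamma> y a b) w)"
      by (rule smooth_on_apply_family[OF U smooth linear_left smooth_christoffel])
    then show ?thesis using smooth_on_differentiable U x by blast
  qed
  have vv: "g y (?\<Gamma> y v v) u = dd (\<lambda>y. g y u v) v y - dd (\<lambda>y. g y v v) u y / 2" if "y \<in> U" for y
  proof -
    have "dd (\<lambda>y. g y u v) v y = dd (\<lambda>y. g y v u) v y"
      by (rule dd_transform[OF diff[OF that] U that]) (rule sym)
    then show ?thesis using christoffel_koszul[OF that, of v v u] by (simp add: koszul_def)
  qed
  have uv: "g y (?\<Gamma> y u v) u = dd (\<lambda>y. g y u u) v y / 2" if "y \<in> U" for y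
  proof -
    have "dd (\<lambda>y. g y u v) u y = dd (\<lambda>y. g y v u) u y"
      by (rule dd_transform[OF diff[OF that] U that]) (rule sym)
    then show ?thesis using christoffel_koszul[OF that, of u v u] by (simp add: koszul_def)
  qed
  have 1: "dd (\<lambda>y. g y (?\<Gamma> y v v) u) u x = dd (dd (\<lambda>y. g y u v) v) u x - dd (dd (\<lambda>y. g y v v) u) u x / 2"
  proof -
    have "dd (\<lambda>y. g y (?\<Gamma> y v v) u) u x = dd (\<lambda>y. dd (\<lambda>y. g y u v) v y - dd (\<lambda>y. g y v v) u y / 2) u x"
      by (rule dd_transform[OF gd U x vv])
    also have "\<dots> = dd (dd (\<lambda>y. g y u v) v) u x - dd (\<lambda>y. dd (\<lambda>y. g y v v) u y / 2) u x"
      using ds differentiable_bounded_linear[OF bounded_linear_divide ds] by (intro dd_diff)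
    also have "dd (\<lambda>y. dd (\<lambda>y. g y v v) u y / 2) u x = dd (dd (\<lambda>y. g y v v) u) u x / 2"
      by (rule dd_bounded_linear[OF bounded_linear_divide ds])
    finally show ?thesis .
  qed
  have 2: "dd (\<lambda>y. g y (?\<Gamma> y u v) u) v x = dd (dd (\<lambda>y. g y u u) v) v x / 2"
  proof -
    have "dd (\<lambda>y. g y (?\<Gamma> y u v) u) v x = dd (\<lambda>y. dd (\<lambda>y. g y u u) v y / 2) v x"
      by (rule dd_transform[OF gd U x uv])
    then show ?thesis using dd_bounded_linear[OF bounded_linear_divide ds] by simp
  qed
  have "g x (curvature g x u v v) u = g x (dd (\<lambda>y. ?\<Gamma> y v v) u x) u - g x (dd (\<lambda>y. ?\<Gamma> y u v) v x) u
    + g x (?\<Gamma> x u (?\<Gamma> x v v)) u - g x (?\<Gamma> x v (?\<Gamma> x u v)) u"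
    unfolding curvature_def by (simp add: linear_add[OF linear_left[OF x]] linear_diff[OF linear_left[OF x]])
  then show ?thesis
    using product[of v v u u] product[of u v u v] 1 2 compat[of "?\<Gamma> x v v" u u] compat[of "?\<Gamma> x u v" u v, unfolded csym[OF x, of v u]]
      sym[OF x, of "?\<Gamma> x v v" "?\<Gamma> x u u"] by linarith
qed

end

section \<open>Quaternionic linear algebra and the curvature inequality\<close>

fun rmul :: "quat3 \<Rightarrow> quat \<Rightarrow> quat3" where
  "rmul (u0, u1, u2) h = (u0 \<cdot>\<^sub>q h, u1 \<cdot>\<^sub>q h, u2 \<cdot>\<^sub>q h)"

text \<open>The Hermitian product, conjugate linear on the left. Its real part is the Euclidean
  inner product; its other components test orthogonality to \<open>rmul u h\<close> for imaginary
  \<open>h\<close>.\<close>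

fun hprod :: "quat3 \<Rightarrow> quat3 \<Rightarrow> quat" where
  "hprod (u0, u1, u2) (w0, w1, w2) = qcnj u0 \<cdot>\<^sub>q w0 + qcnj u1 \<cdot>\<^sub>q w1 + qcnj u2 \<cdot>\<^sub>q w2"

text \<open>The generator of the circle action, which is the matrix \<open>X\<close> of the overview
  for \<open>\<alpha> = q\<close> and \<open>\<beta> = p\<close>.\<close>

fun killing :: "real \<Rightarrow> real \<Rightarrow> quat3 \<Rightarrow> quat3" where
  "killing \<alpha> \<beta> (u0, u1, u2) = (\<alpha> *\<^sub>R (qj \<cdot>\<^sub>q u0), \<beta> *\<^sub>R (qj \<cdot>\<^sub>q u1), \<beta> *\<^sub>R (qj \<cdot>\<^sub>q u2))"

definition qone :: quat where "qone = (1, 0, 0, 0)"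

lemma bilinear_qmult: "bilinear (\<cdot>\<^sub>q)"
  unfolding bilinear_def
proof (intro conjI allI linearI)
  fix a b c :: quat and r :: real
  show "a \<cdot>\<^sub>q (b + c) = a \<cdot>\<^sub>q b + a \<cdot>\<^sub>q c" "(b + c) \<cdot>\<^sub>q a = b \<cdot>\<^sub>q a + c \<cdot>\<^sub>q a"
    "a \<cdot>\<^sub>q (r *\<^sub>R b) = r *\<^sub>R (a \<cdot>\<^sub>q b)" "(r *\<^sub>R b) \<cdot>\<^sub>q a = r *\<^sub>R (b \<cdot>\<^sub>q a)"
    by (cases a; cases b; cases c; simp add: algebra_simps)+
qed

lemmas bounded_bilinear_qmult = bilinear_qmult[unfolded bilinear_conv_bounded_bilinear]

interpretation qmult: bounded_bilinear "(\<cdot>\<^sub>q)" by (rule bounded_bilinear_qmult)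

lemma linear_qcnj: "linear qcnj"
proof (rule linearI)
  fix a b :: quat and r :: real
  show "qcnj (a + b) = qcnj a + qcnj b" "qcnj (r *\<^sub>R a) = r *\<^sub>R qcnj a"
    by (cases a; cases b; simp)+
qed

lemmas qcnj_linear_simps = linear_add[OF linear_qcnj] linear_scale[OF linear_qcnj] linear_0[OF linear_qcnj]
lemmas qmult_linear_simps =
  qmult.add_left qmult.add_right qmult.scaleR_left qmult.scaleR_right scaleR_add_right

lemma bilinear_rmul: "bilinear rmul"
  unfolding bilinear_def
proof (intro conjI allI linearI)
  fix u w :: quat3 and h k :: quat and r :: real
  show "rmul u (h + k) = rmul u h + rmul u k" "rmul (u + w) h = rmul u h + rmul w h"
    "rmul u (r *\<^sub>R h) = r *\<^sub>R rmul u h" "rmul (r *\<^sub>R u) h = r *\<^sub>R rmul u h"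
    by (cases u rule: prod_cases3; cases w rule: prod_cases3; simp add: qmult_linear_simps)+
qed

lemma bilinear_hprod: "bilinear hprod"
  unfolding bilinear_def
proof (intro conjI allI linearI)
  fix u v w :: quat3 and r :: real
  show "hprod u (v + w) = hprod u v + hprod u w" "hprod (v + w) u = hprod v u + hprod w u"
    "hprod u (r *\<^sub>R w) = r *\<^sub>R hprod u w" "hprod (r *\<^sub>R w) u = r *\<^sub>R hprod w u"
    by (cases u rule: prod_cases3; cases v rule: prod_cases3; cases w rule: prod_cases3; simp add: qmult_linear_simps qcnj_linear_simps)+
qed

lemma linear_killing: "linear (killing \<alpha> \<beta>)"
proof (rule linearI)
  fix u w :: quat3 and r :: real
  show "killing \<alpha> \<beta> (u + w) = killing \<alpha> \<beta> u + killing \<alpha> \<beta> w"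
    "killing \<alpha> \<beta> (r *\<^sub>R u) = r *\<^sub>R killing \<alpha> \<beta> u"
    by (cases u rule: prod_cases3; cases w rule: prod_cases3; simp add: qmult_linear_simps)+
qed

lemmas bounded_bilinear_rmul = bilinear_rmul[unfolded bilinear_conv_bounded_bilinear]
lemmas bounded_bilinear_hprod = bilinear_hprod[unfolded bilinear_conv_bounded_bilinear]
lemmas bounded_linear_killing = linear_killing[unfolded linear_conv_bounded_linear]

interpretation rmul: bounded_bilinear rmul by (rule bounded_bilinear_rmul)
interpretation hprod: bounded_bilinear hprod by (rule bounded_bilinear_hprod)

lemma qmult_assoc: "(a \<cdot>\<^sub>q b) \<cdot>\<^sub>q c = a \<cdot>\<^sub>q (b \<cdot>\<^sub>q c)"
  by (cases a; cases b; cases c; simp add: algebra_simps)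

lemma qmult_one [simp]: "a \<cdot>\<^sub>q qone = a" "qone \<cdot>\<^sub>q a = a"
  by (cases a; simp add: qone_def)+

lemma qcnj_qmult: "qcnj (a \<cdot>\<^sub>q b) = qcnj b \<cdot>\<^sub>q qcnj a"
  by (cases a; cases b; simp add: algebra_simps)

lemma inner_qmult_left: "(a \<cdot>\<^sub>q b) \<bullet> c = b \<bullet> (qcnj a \<cdot>\<^sub>q c)"
  by (cases a; cases b; cases c; simp add: algebra_simps)

lemma inner_qmult_right: "(a \<cdot>\<^sub>q b) \<bullet> c = a \<bullet> (c \<cdot>\<^sub>q qcnj b)"
  by (cases a; cases b; cases c; simp add: algebra_simps)

lemma qcnj_qmult_self: "qcnj a \<cdot>\<^sub>q a = (a \<bullet> a) *\<^sub>R qone" "a \<cdot>\<^sub>q qcnj a = (a \<bullet> a) *\<^sub>R qone"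
  by (cases a; simp add: algebra_simps qone_def)+

lemma qcnj_qcnj [simp]: "qcnj (qcnj a) = a"
  by (cases a; simp)

lemma inner_qcnj [simp]: "qcnj a \<bullet> qcnj b = a \<bullet> b"
  by (cases a; cases b; simp)

lemma inner_qmult_qmult: "(a \<cdot>\<^sub>q b) \<bullet> (a \<cdot>\<^sub>q c) = (a \<bullet> a) * (b \<bullet> c)"
  by (simp add: inner_qmult_left qmult_assoc[symmetric] qcnj_qmult_self qmult.scaleR_left)

lemma qcnj_qj: "qcnj qj = - qj" by (simp add: qj_def)

lemma qj_norm: "qj \<bullet> qj = 1" by (simp add: qj_def)

text \<open>\<open>rmul u\<close> and \<open>hprod u\<close> are adjoint, so
  \<open>hprod u w\<close> carries exactly the projection of \<open>w\<close> to the quaternionic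
  line of \<open>u\<close>.\<close>

lemma inner_rmul: "rmul u h \<bullet> w = h \<bullet> hprod u w"
  by (cases u rule: prod_cases3; cases w rule: prod_cases3; simp add: inner_qmult_left inner_add_right)

lemma hprod_rmul: "hprod u (rmul w h) = hprod u w \<cdot>\<^sub>q h"
  by (cases u rule: prod_cases3; cases w rule: prod_cases3; simp add: qmult_assoc qmult.add_left)

lemma hprod_commute: "hprod w u = qcnj (hprod u w)"
  by (cases u rule: prod_cases3; cases w rule: prod_cases3; simp add: qcnj_linear_simps qcnj_qmult)

lemma hprod_rmul_left: "hprod (rmul u h) w = qcnj h \<cdot>\<^sub>q hprod u w"
  by (metis hprod_commute hprod_rmul qcnj_qmult)

lemma hprod_self: "hprod u u = (u \<bullet> u) *\<^sub>R qone"
  by (cases u rule: prod_cases3; simp add: qcnj_linear_simps qcnj_qmult_self scaleR_add_left)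

lemma rmul_rmul: "rmul (rmul u h) k = rmul u (h \<cdot>\<^sub>q k)"
  by (cases u rule: prod_cases3; simp add: qmult_assoc)

lemma rmul_qone [simp]: "rmul u qone = u"
  by (cases u rule: prod_cases3; simp)

lemma killing_rmul: "killing \<alpha> \<beta> (rmul u h) = rmul (killing \<alpha> \<beta> u) h"
  by (cases u rule: prod_cases3; simp add: qmult_assoc qmult.scaleR_left)

lemma hprod_killing: "hprod (killing \<alpha> \<beta> u) w = - hprod u (killing \<alpha> \<beta> w)"
  by (cases u rule: prod_cases3; cases w rule: prod_cases3; simp add: qcnj_linear_simps qcnj_qmult qcnj_qj qmult_assoc qmult.scaleR_left qmult.scaleR_right
      qmult.minus_left qmult.minus_right)

text \<open>The adjoint of \<open>killing\<close> composed with it is diagonal with entries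
  \<open>\<alpha>\<^sup>2\<close>, \<open>\<beta>\<^sup>2\<close>, \<open>\<beta>\<^sup>2\<close>.
  As two weights coincide, this is a multiple of the identity plus a correction in the first
  coordinate, and later estimates see the vectors only through that coordinate.\<close>

lemma hprod_killing_killing:
  "hprod (killing \<alpha> \<beta> u) (killing \<alpha> \<beta> w)
    = \<beta>\<^sup>2 *\<^sub>R hprod u w + (\<alpha>\<^sup>2 - \<beta>\<^sup>2) *\<^sub>R (qcnj (fst u) \<cdot>\<^sub>q fst w)"
proof -
  have "(qcnj a \<cdot>\<^sub>q qcnj qj) \<cdot>\<^sub>q (qj \<cdot>\<^sub>q b) = qcnj a \<cdot>\<^sub>q b" for a b
    by (simp add: qmult_assoc) (simp add: qmult_assoc[symmetric] qcnj_qmult_self qj_norm)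
  then show ?thesis
    by (cases u rule: prod_cases3; cases w rule: prod_cases3; simp add: qcnj_linear_simps qcnj_qmult qmult.scaleR_left qmult.scaleR_right power2_eq_square
        algebra_simps)
qed

lemma fst_hprod: "fst (hprod u w) = u \<bullet> w"
proof -
  have "fst h = qone \<bullet> h" for h :: quat by (cases h; simp add: qone_def)
  then show ?thesis using inner_rmul[of u qone w] by simp
qed

lemma hprod_killing_imaginary: "fst (hprod u (killing \<alpha> \<beta> u)) = 0"
proof -
  have "hprod u (killing \<alpha> \<beta> u) = - qcnj (hprod u (killing \<alpha> \<beta> u))"
    using hprod_killing[of \<alpha> \<beta> u u] hprod_commute[of "killing \<alpha> \<beta> u" u] by simp
  then show ?thesis by (cases "hprod u (killing \<alpha> \<beta> u)"; simp)
qed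

lemma inner_rmul_rmul: "rmul u h \<bullet> rmul u k = (u \<bullet> u) * (h \<bullet> k)"
  by (simp add: inner_rmul hprod_rmul hprod_self qmult.scaleR_left)

text \<open>Orthogonality makes the map from three quaternionic coefficients injective, and the real
  dimension 12 on both sides makes it onto.\<close>

lemma hprod_expansion:
  assumes nz: "s \<noteq> 0" "t \<noteq> 0" "a \<noteq> 0" and orth: "hprod s t = 0" "hprod s a = 0" "hprod t a = 0"
  shows "w = rmul s (hprod s w /\<^sub>R (s \<bullet> s)) + rmul t (hprod t w /\<^sub>R (t \<bullet> t)) + rmul a (hprod a w /\<^sub>R (a \<bullet> a))"
proof -
  define \<Phi> where "\<Phi> x = rmul s (fst x) + rmul t (fst (snd x)) + rmul a (snd (snd x))" for x
  have orth': "hprod t s = 0" "hprod a s = 0" "hprod a t = 0"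
    using orth hprod_commute[of t s] hprod_commute[of a s] hprod_commute[of a t] qcnj_linear_simps by auto
  have c: "hprod s (\<Phi> (h, k, l)) = (s \<bullet> s) *\<^sub>R h" "hprod t (\<Phi> (h, k, l)) = (t \<bullet> t) *\<^sub>R k"
    "hprod a (\<Phi> (h, k, l)) = (a \<bullet> a) *\<^sub>R l" for h k l
    by (simp_all add: \<Phi>_def hprod.add_right hprod_rmul orth orth' qmult.zero_left hprod_self qmult.scaleR_left)
  have lin: "linear \<Phi>"
    by (rule linearI) (simp_all add: \<Phi>_def rmul.add_right rmul.scaleR_right scaleR_add_right)
  have "inj \<Phi>"
  proof (subst linear_injective_0[OF lin], intro allI impI)
    fix x :: quat3 assume "\<Phi> x = 0"
    obtain h k l where x: "x = (h, k, l)" by (cases x rule: prod_cases3)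
    have "(s \<bullet> s) *\<^sub>R h = 0" "(t \<bullet> t) *\<^sub>R k = 0" "(a \<bullet> a) *\<^sub>R l = 0"
      using c[of h k l] \<open>\<Phi> x = 0\<close> x by (simp_all add: hprod.zero_right)
    then have "h = 0" "k = 0" "l = 0" using nz by simp_all
    then show "x = 0" by (simp add: x zero_prod_def)
  qed
  then have "surj \<Phi>" using linear_inj_imp_surj[OF lin] by blast
  then obtain h k l where w: "w = \<Phi> (h, k, l)" by (metis surj_def prod_cases3)
  then have hkl: "hprod s w /\<^sub>R (s \<bullet> s) = h" "hprod t w /\<^sub>R (t \<bullet> t) = k" "hprod a w /\<^sub>R (a \<bullet> a) = l"
    using nz by (simp_all add: c)
  show ?thesis unfolding hkl unfolding w by (simp add: \<Phi>_def)
qed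

lemma hprod_parseval:
  assumes "s \<noteq> 0" "t \<noteq> 0" "a \<noteq> 0" "hprod s t = 0" "hprod s a = 0" "hprod t a = 0"
  shows "w \<bullet> w' = (hprod s w \<bullet> hprod s w') / (s \<bullet> s) + (hprod t w \<bullet> hprod t w') / (t \<bullet> t)
    + (hprod a w \<bullet> hprod a w') / (a \<bullet> a)"
  by (subst hprod_expansion[OF assms, of w])
    (simp add: inner_add_left inner_rmul divide_inverse mult.commute)

lemma killing_nonzero:
  assumes "\<alpha> > 0" "\<beta> > 0" "u \<noteq> 0"
  shows "killing \<alpha> \<beta> u \<noteq> 0"
proof
  assume X: "killing \<alpha> \<beta> u = 0"
  obtain a b c where u: "u = (a, b, c)" by (cases u rule: prod_cases3)
  have "h = 0" if "qj \<cdot>\<^sub>q h = 0" for h using inner_qmult_qmult[of qj h h] qj_norm that by simp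
  moreover have "qj \<cdot>\<^sub>q a = 0" "qj \<cdot>\<^sub>q b = 0" "qj \<cdot>\<^sub>q c = 0"
    using arg_cong[OF X, of fst] arg_cong[OF X, of "\<lambda>z. fst (snd z)"] arg_cong[OF X, of "\<lambda>z. snd (snd z)"]
      assms by (simp_all add: u)
  ultimately have "a = 0" "b = 0" "c = 0" by blast+
  then show False using assms(3) by (simp add: u zero_prod_def)
qed

text \<open>The two equations \<open>hor\<close> combine tangency and horizontality. In
  \<open>hprod s a\<close> the real part is tangency to the sphere and the imaginary part
  orthogonality to the unit quaternion orbit. In \<open>hprod (killing \<alpha> \<beta> s) a\<close>
  the imaginary part is tangency to the zero set of the moment map and the real part orthogonality
  to the circle.\<close>

locale horizontal_vector =
  fixes \<alpha> \<beta> :: real and s a :: quat3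
  assumes pos: "\<alpha> > 0" "\<beta> > 0"
    and pinch: "\<beta>\<^sup>2 < sqrt 2 * \<alpha>\<^sup>2" "sqrt 2 * \<alpha>\<^sup>2 < 2 * sqrt 2 * \<beta>\<^sup>2"
    and s: "s \<bullet> s = 1" and moment: "hprod s (killing \<alpha> \<beta> s) = 0"
    and a: "a \<noteq> 0" and hor: "hprod s a = 0" "hprod (killing \<alpha> \<beta> s) a = 0"
begin

abbreviation X where "X \<equiv> killing \<alpha> \<beta>"

definition r2 where "r2 = X s \<bullet> X s"

lemma r2_eq: "r2 = \<beta>\<^sup>2 + (\<alpha>\<^sup>2 - \<beta>\<^sup>2) * (fst s \<bullet> fst s)"
  using arg_cong[OF hprod_killing_killing[of \<alpha> \<beta> s s], of fst] s
  by (simp add: fst_hprod r2_def qcnj_qmult_self qone_def)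

text \<open>Each summand \<open>qcnj h \<cdot>\<^sub>q (qj \<cdot>\<^sub>q h)\<close> of the moment
  map has norm \<open>h \<bullet> h\<close>, so the vanishing of the moment is a triangle inequality
  between the weighted coordinates.\<close>

lemma fst_s_bound: "\<alpha> * (fst s \<bullet> fst s) \<le> \<beta> * (1 - fst s \<bullet> fst s)"
proof -
  obtain s0 s1 s2 where s012: "s = (s0, s1, s2)" by (cases s rule: prod_cases3)
  have n: "norm (qcnj h \<cdot>\<^sub>q (qj \<cdot>\<^sub>q h)) = h \<bullet> h" for h
    by (simp add: norm_eq_sqrt_inner inner_qmult_qmult qj_norm inner_qmult_right qmult_assoc qcnj_qmult_self qmult.scaleR_right)
  have "\<alpha> *\<^sub>R (qcnj s0 \<cdot>\<^sub>q (qj \<cdot>\<^sub>q s0)) = - (\<beta> *\<^sub>R (qcnj s1 \<cdot>\<^sub>q (qj \<cdot>\<^sub>q s1)) + \<beta> *\<^sub>R (qcnj s2 \<cdot>\<^sub>q (qj \<cdot>\<^sub>q s2)))"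
    by (rule eq_neg_iff_add_eq_0[THEN iffD2]) (use moment in \<open>simp add: s012 qmult.scaleR_right add.assoc\<close>)
  then have "norm (\<alpha> *\<^sub>R (qcnj s0 \<cdot>\<^sub>q (qj \<cdot>\<^sub>q s0)))
     \<le> norm (\<beta> *\<^sub>R (qcnj s1 \<cdot>\<^sub>q (qj \<cdot>\<^sub>q s1))) + norm (\<beta> *\<^sub>R (qcnj s2 \<cdot>\<^sub>q (qj \<cdot>\<^sub>q s2)))"
    by (simp only: norm_minus_cancel norm_triangle_ineq)
  then have "\<alpha> * (s0 \<bullet> s0) \<le> \<beta> * (s1 \<bullet> s1) + \<beta> * (s2 \<bullet> s2)"
    using pos by (simp add: n)
  moreover have "s1 \<bullet> s1 + s2 \<bullet> s2 = 1 - s0 \<bullet> s0" using s by (simp add: s012 inner_prod_def)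
  ultimately show ?thesis by (simp add: s012 distrib_left[symmetric])
qed

text \<open>For \<open>\<alpha> < \<beta>\<close> the value \<open>r2\<close> decreases in
  \<open>S = fst s \<bullet> fst s\<close>, and the largest admissible \<open>S\<close>, namely
  \<open>\<beta> / (\<alpha> + \<beta>)\<close>, gives \<open>\<alpha> * \<beta>\<close>.\<close>

lemma r2_lower: "\<beta>\<^sup>2 \<le> r2 \<or> \<alpha> * \<beta> \<le> r2"
proof (cases "\<beta> \<le> \<alpha>")
  case True
  then have "\<beta>\<^sup>2 \<le> \<alpha>\<^sup>2" using pos by (simp add: power_mono)
  then show ?thesis by (simp add: r2_eq)
next
  case False
  define S where "S = fst s \<bullet> fst s"
  have "S * (\<alpha> + \<beta>) \<le> \<beta>" using fst_s_bound by (simp add: S_def algebra_simps)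
  then have "(\<beta> - \<alpha>) * (S * (\<alpha> + \<beta>)) \<le> (\<beta> - \<alpha>) * \<beta>" using False by (intro mult_left_mono) auto
  then have "\<alpha> * \<beta> \<le> r2" by (simp add: r2_eq S_def[symmetric] power2_eq_square algebra_simps)
  then show ?thesis ..
qed

lemma r2_pos: "r2 > 0"
  using r2_lower pos by (meson less_le_trans mult_pos_pos zero_less_power)

text \<open>The bound \<open>\<beta>\<^sup>2\<close> for \<open>r2\<close> leads to
  \<open>\<alpha>\<^sup>2 < 2 * \<beta>\<^sup>2\<close>, which is the second pinching inequality;
  the bound \<open>\<alpha> * \<beta>\<close> leads to \<open>\<beta> < 2 * \<alpha>\<close>, which
  follows from the first one.\<close>

lemma r2_pinching: "\<beta>^4 * \<alpha>\<^sup>2 < 2 * r2 ^ 3"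
  using r2_lower
proof
  assume "\<beta>\<^sup>2 \<le> r2"
  then have "(\<beta>\<^sup>2)^3 \<le> r2 ^ 3" by (intro power_mono) auto
  moreover have "sqrt 2 * \<alpha>\<^sup>2 < sqrt 2 * (2 * \<beta>\<^sup>2)" using pinch(2) by simp
  then have "\<alpha>\<^sup>2 < 2 * \<beta>\<^sup>2" by simp
  then have "\<beta>^4 * \<alpha>\<^sup>2 < \<beta>^4 * (2 * \<beta>\<^sup>2)" using pos by (intro mult_strict_left_mono) auto
  ultimately show ?thesis by (simp add: power_mult[symmetric] power_add[symmetric] algebra_simps)
next
  assume "\<alpha> * \<beta> \<le> r2"
  then have "(\<alpha> * \<beta>)^3 \<le> r2 ^ 3" using pos by (intro power_mono) auto
  moreover have "\<beta> < 2 * \<alpha>"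
  proof -
    have "sqrt 2 * \<alpha>\<^sup>2 \<le> (2 * \<alpha>)\<^sup>2" using sqrt2_less_2 by (simp add: power2_eq_square mult_right_mono)
    then have "\<beta>\<^sup>2 < (2 * \<alpha>)\<^sup>2" using pinch(1) by linarith
    then show ?thesis using pos power2_less_imp_less[of \<beta> "2 * \<alpha>"] by simp
  qed
  then have "(\<beta>^3 * \<alpha>\<^sup>2) * \<beta> < (\<beta>^3 * \<alpha>\<^sup>2) * (2 * \<alpha>)" using pos by (intro mult_strict_left_mono) auto
  then have "\<beta>^4 * \<alpha>\<^sup>2 < 2 * (\<alpha> * \<beta>)^3"
    by (simp add: power_mult_distrib algebra_simps eval_nat_numeral)
  ultimately show ?thesis by linarith
qed

lemma s_nonzero: "s \<noteq> 0" "X s \<noteq> 0"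
  using s r2_pos by (auto simp: r2_def)

lemmas expansion = hprod_expansion[OF s_nonzero a moment hor]
lemmas parseval = hprod_parseval[OF s_nonzero a moment hor]

text \<open>The \<open>\<nu>\<close> of the overview, for \<open>a\<close> of arbitrary
  length.\<close>

definition M where "M = hprod a (X a)"

text \<open>In the quaternionic orthonormal frame \<open>s\<close>, \<open>X s / |X s|\<close>, \<open>a / |a|\<close> the operator \<open>X\<close> is a
  skew-Hermitian matrix whose (Dieudonne) determinant is \<open>\<beta>\<^sup>2 \<alpha>\<close>, and which this identity computes
  in terms of the entries.\<close>

lemma M_norm: "(M \<bullet> M) * r2\<^sup>2 = \<beta>^4 * \<alpha>\<^sup>2 * (a \<bullet> a)\<^sup>2"
proof -
  define S where "S = fst s \<bullet> fst s"
  define m where "m = fst a \<bullet> fst a"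
  define d where "d = \<alpha>\<^sup>2 - \<beta>\<^sup>2"
  define A2 where "A2 = a \<bullet> a"
  have A2: "A2 > 0" using a by (simp add: A2_def)
  have r2d: "r2 = \<beta>\<^sup>2 + d * S" by (simp add: r2_eq S_def d_def)
  have "(X s \<bullet> X s) = r2" by (simp add: r2_def)
  have "hprod s (X a) = 0" using hprod_killing[of \<alpha> \<beta> s a] hor by simp
  moreover have "hprod (X s) (X a) = d *\<^sub>R (qcnj (fst s) \<cdot>\<^sub>q fst a)"
    by (simp add: hprod_killing_killing hor d_def)
  moreover have "X a \<bullet> X a = \<beta>\<^sup>2 * A2 + d * m"
    using arg_cong[OF hprod_killing_killing[of \<alpha> \<beta> a a], of fst]
    by (simp add: fst_hprod A2_def m_def d_def qcnj_qmult_self qone_def)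
  \<comment> \<open>Parseval for \<open>X a\<close> in the frame: the component along
    \<open>s\<close> vanishes because \<open>X\<close> is skew, and the one along \<open>a\<close>
    is \<open>M\<close>.\<close>
  ultimately have e1: "\<beta>\<^sup>2 * A2 + d * m = d\<^sup>2 * (S * m) / r2 + (M \<bullet> M) / A2"
    using parseval[of "X a" "X a"] s
    by (simp add: M_def[symmetric] r2_def[symmetric] A2_def[symmetric] inner_qmult_qmult S_def m_def power2_eq_square mult.assoc)
  \<comment> \<open>Parseval for the first standard vector, whose products with the frame are the
    conjugated first coordinates. This second equation expresses \<open>m\<close> by
    \<open>S\<close>, after which \<open>m\<close> is eliminated from the first.\<close>
  have "hprod w (qone, 0, 0) = qcnj (fst w)" for w
    by (cases w rule: prod_cases3) (simp add: qmult.zero_right)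
  moreover have "fst (X s) \<bullet> fst (X s) = \<alpha>\<^sup>2 * S"
    by (cases s rule: prod_cases3; simp add: inner_qmult_qmult qj_norm S_def power2_eq_square)
  ultimately have e2: "1 = S + \<alpha>\<^sup>2 * S / r2 + m / A2"
    using parseval[of "(qone, 0, 0)" "(qone, 0, 0)"] s
    by (simp add: r2_def[symmetric] A2_def[symmetric] S_def[symmetric] m_def[symmetric] qone_def)
  have r: "r2 > 0" by (rule r2_pos)
  have m: "m * r2 = A2 * (r2 - S * r2 - \<alpha>\<^sup>2 * S)"
    using e2 r A2 by (simp add: field_simps)
  have "(M \<bullet> M) * r2 = A2 * (r2 * (\<beta>\<^sup>2 * A2 + d * m) - d\<^sup>2 * (S * m))"
    using e1 r A2 by (simp add: field_simps)
  then have "(M \<bullet> M) * r2\<^sup>2 = A2 * (r2 * (\<beta>\<^sup>2 * A2 + d * m) - d\<^sup>2 * (S * m)) * r2"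
    by (simp add: power2_eq_square)
  also have "\<dots> = A2 * (r2\<^sup>2 * \<beta>\<^sup>2 * A2 + (m * r2) * (d * r2 - d\<^sup>2 * S))"
    by (simp add: power2_eq_square algebra_simps)
  also have "\<dots> = \<beta>^4 * \<alpha>\<^sup>2 * A2\<^sup>2"
    unfolding m unfolding r2d d_def by (simp add: power2_eq_square power4_eq_xxxx algebra_simps)
  finally show ?thesis by (simp add: A2_def)
qed

lemma M_bound: "M \<bullet> M < 2 * r2 * (a \<bullet> a)\<^sup>2"
proof -
  have "(M \<bullet> M) * r2\<^sup>2 < 2 * r2 ^ 3 * (a \<bullet> a)\<^sup>2"
    unfolding M_norm using r2_pinching a by (intro mult_strict_right_mono) auto
  also have "\<dots> = (2 * r2 * (a \<bullet> a)\<^sup>2) * r2\<^sup>2" by (simp add: eval_nat_numeral)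
  finally show ?thesis using r2_pos by simp
qed

text \<open>By the expansion \<open>b\<close> is \<open>rmul a c\<close>. The real part of
  \<open>c\<close> drops out, as it adds a multiple of \<open>a\<close> to \<open>b\<close>, and the
  expression becomes \<open>4 * A2\<^sup>2 * C + (6 * I\<^sup>2 - 2 * C * (M \<bullet> M)) /
  r2\<close>, with \<open>C\<close> the squared norm of the imaginary part of \<open>c\<close> and
  \<open>I\<close> its product with \<open>M\<close>. Now \<open>M_bound\<close> applies.\<close>

lemma curvature_numerator_pos:
  assumes hb: "hprod s b = 0" "hprod (X s) b = 0" and ind: "\<And>t. b \<noteq> t *\<^sub>R a"
  shows "0 < (a \<bullet> a) * (b \<bullet> b) + 3 * (hprod a b \<bullet> hprod a b) - 4 * (a \<bullet> b)\<^sup>2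
    + (hprod (X a) a \<bullet> hprod (X b) b - hprod (X a) b \<bullet> hprod (X a) b + 4 * (X a \<bullet> b)\<^sup>2) / r2"
proof -
  define c where "c = hprod a b /\<^sub>R (a \<bullet> a)"
  define A2 where "A2 = a \<bullet> a"
  have A2: "A2 > 0" using a by (simp add: A2_def)
  have b: "b = rmul a c"
    using expansion[of b] hb by (simp add: c_def rmul.zero_right)
  obtain c0 c1 c2 c3 where c: "c = (c0, c1, c2, c3)" by (cases c)
  obtain m0 m1 m2 m3 where m: "M = (m0, m1, m2, m3)" by (cases M)
  have m0: "m0 = 0" using hprod_killing_imaginary[of a \<alpha> \<beta>] m by (simp add: M_def)
  define C where "C = c1\<^sup>2 + c2\<^sup>2 + c3\<^sup>2"
  define I where "I = m1 * c1 + m2 * c2 + m3 * c3"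
  have C: "C > 0"
  proof (rule ccontr)
    assume "\<not> C > 0"
    then have "c1\<^sup>2 + c2\<^sup>2 + c3\<^sup>2 \<le> 0" by (simp add: C_def)
    then have "c1\<^sup>2 = 0" "c2\<^sup>2 = 0" "c3\<^sup>2 = 0"
      using zero_le_power2[of c1] zero_le_power2[of c2] zero_le_power2[of c3] by linarith+
    then have "b = c0 *\<^sub>R a" using rmul.scaleR_right[of a c0 qone] rmul_qone[of a] by (simp add: b c qone_def)
    with ind show False by blast
  qed
  have hab: "hprod a b = A2 *\<^sub>R c" by (simp add: b hprod_rmul hprod_self qmult.scaleR_left A2_def)
  have ab: "a \<bullet> b = A2 * c0" using fst_hprod[of a b] by (simp add: hab c)
  have bb: "b \<bullet> b = A2 * (c \<bullet> c)" by (simp add: b inner_rmul_rmul A2_def)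
  have Xaa: "hprod (X a) a = - M" by (simp add: hprod_killing M_def)
  have Xbb: "hprod (X b) b = - (qcnj c \<cdot>\<^sub>q (M \<cdot>\<^sub>q c))"
    by (simp add: b hprod_killing killing_rmul hprod_rmul hprod_rmul_left M_def qmult_assoc
        qmult.minus_left qmult.minus_right)
  have Xab: "hprod (X a) b = - (M \<cdot>\<^sub>q c)" by (simp add: b hprod_rmul Xaa qmult.minus_left)
  have Xab': "X a \<bullet> b = I" using fst_hprod[of "X a" b] by (simp add: Xab c m m0 I_def)
  have bracket: "hprod (X a) a \<bullet> hprod (X b) b - hprod (X a) b \<bullet> hprod (X a) b + 4 * (X a \<bullet> b)\<^sup>2
     = 6 * I\<^sup>2 - 2 * C * (M \<bullet> M)"
    unfolding Xaa Xbb Xab Xab' by (simp add: c m m0 I_def C_def power2_eq_square algebra_simps)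
  have first: "(a \<bullet> a) * (b \<bullet> b) + 3 * (hprod a b \<bullet> hprod a b) - 4 * (a \<bullet> b)\<^sup>2 = 4 * A2\<^sup>2 * C"
    unfolding hab ab bb A2_def[symmetric] by (simp add: c C_def power2_eq_square algebra_simps)
  have "0 < (2 * C * (2 * r2 * A2\<^sup>2 - M \<bullet> M) + 6 * I\<^sup>2) / r2"
    using M_bound C r2_pos by (intro divide_pos_pos add_pos_nonneg mult_pos_pos) (auto simp: A2_def)
  also have "\<dots> = 4 * A2\<^sup>2 * C + (6 * I\<^sup>2 - 2 * C * (M \<bullet> M)) / r2"
    using r2_pos by (simp add: field_simps)
  finally show ?thesis unfolding bracket first .
qed

end

section \<open>Curvature along a horizontal section\<close>

lemma dd2_transform:
  assumes "smooth_on U f" "open U" "x \<in> U" "\<And>y. y \<in> U \<Longrightarrow> f y = h y"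
  shows "dd (dd f a) b x = dd (dd h a) b x"
proof (rule dd_transform[OF smooth_on_differentiable[OF smooth_on_dd[OF assms(1)] assms(2,3)] assms(2,3)])
  fix y assume "y \<in> U"
  then show "dd f a y = dd h a y"
    using dd_transform[OF smooth_on_differentiable[OF assms(1,2)] assms(2)] assms(4) by blast
qed

lemma dd2_diff:
  assumes "smooth_on U f" "smooth_on U h" "open U" "x \<in> U"
  shows "dd (dd (\<lambda>y. f y - h y) a) b x = dd (dd f a) b x - dd (dd h a) b x"
proof -
  have "dd (dd (\<lambda>y. f y - h y) a) b x = dd (\<lambda>y. dd f a y - dd h a y) b x"
  proof (rule dd_transform[OF smooth_on_differentiable[OF smooth_on_dd[OF smooth_on_diff]]])
    show "dd (\<lambda>y. f y - h y) a y = dd f a y - dd h a y" if "y \<in> U" for y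
      using assms that by (intro dd_diff smooth_on_differentiable)
  qed (use assms in auto)
  also have "\<dots> = dd (dd f a) b x - dd (dd h a) b x"
    using assms by (intro dd_diff smooth_on_differentiable smooth_on_dd)
  finally show ?thesis .
qed

lemma dd2_bilinear:
  assumes B: "bounded_bilinear B" and f: "smooth_on U f" and h: "smooth_on U h" and U: "open U" "x \<in> U"
  shows "dd (dd (\<lambda>y. B (f y) (h y)) a) b x
    = B (dd (dd f a) b x) (h x) + B (dd f a x) (dd h b x) + B (dd f b x) (dd h a x) + B (f x) (dd (dd h a) b x)"
proof -
  note d = smooth_on_differentiable[OF _ U(1)]
  have "dd (dd (\<lambda>y. B (f y) (h y)) a) b x = dd (\<lambda>y. B (f y) (dd h a y) + B (dd f a y) (h y)) b x"
  proof (rule dd_transform[OF _ U])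
    show "dd (\<lambda>y. B (f y) (h y)) a y = B (f y) (dd h a y) + B (dd f a y) (h y)" if "y \<in> U" for y
      by (rule dd_bilinear[OF B d[OF f that] d[OF h that]])
    show "dd (\<lambda>y. B (f y) (h y)) a differentiable at x"
      by (rule d[OF smooth_on_dd[OF smooth_on_bilinear[OF B U(1) f h]] U(2)])
  qed
  also have "\<dots> = dd (\<lambda>y. B (f y) (dd h a y)) b x + dd (\<lambda>y. B (dd f a y) (h y)) b x"
    by (rule dd_add) (rule d[OF smooth_on_bilinear[OF B U(1)] U(2)]; simp add: f h smooth_on_dd)+
  also have "dd (\<lambda>y. B (f y) (dd h a y)) b x = B (f x) (dd (dd h a) b x) + B (dd f b x) (dd h a x)"
    by (rule dd_bilinear[OF B d[OF f U(2)] d[OF smooth_on_dd[OF h] U(2)]])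
  also have "dd (\<lambda>y. B (dd f a y) (h y)) b x = B (dd f a x) (dd h b x) + B (dd (dd f a) b x) (h x)"
    by (rule dd_bilinear[OF B d[OF smooth_on_dd[OF f] U(2)] d[OF h U(2)]])
  finally show ?thesis by (simp add: add_ac)
qed

lemmas dd_inner = dd_bilinear[OF bounded_bilinear_inner]
lemmas dd2_inner = dd2_bilinear[OF bounded_bilinear_inner]

lemma third_derivatives_commute:
  fixes f :: "'a::euclidean_space \<Rightarrow> 'b::euclidean_space"
  assumes f: "smooth_on U f" and U: "open U" "x \<in> U"
  shows "dd (dd (dd f u) v) w x = dd (dd (dd f v) u) w x"
proof (rule dd_transform[OF smooth_on_differentiable[OF smooth_on_dd[OF smooth_on_dd[OF f]] U] U])
  show "dd (dd f u) v y = dd (dd f v) u y" if "y \<in> U" for y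
    by (rule second_derivatives_commute[OF f U(1) that])
qed

text \<open>In the next two identities \<open>T\<^sub>u\<^sub>v\<close> is the derivative in direction \<open>u\<close> of the vertical component of
  \<open>ds v\<close>; its skew part is O'Neill's tensor, and \<open>T\<^sub>u\<^sub>v - h\<close> (respectively \<open>T\<^sub>u\<^sub>v - k\<close>) is the vertical
  component of the second derivative of \<open>s\<close>.\<close>

lemma oneill_sphere_fibres:
  fixes Tuu Tuv Tvu Tvv h :: quat
  assumes "fst Tuu = 0" "fst Tvv = 0" "fst Tuv = 0" "fst Tvu = 0" "Tuv - h = Tvu - qcnj h"
  shows "(Tuu - A2 *\<^sub>R qone) \<bullet> (Tvv - B2 *\<^sub>R qone) - (Tuv - h) \<bullet> (Tuv - h)
    + (Tuv \<bullet> Tuv + Tvu \<bullet> Tvu - Tvu \<bullet> Tuv - Tuu \<bullet> Tvv) = A2 * B2 + 3 * (h \<bullet> h) - 4 * (fst h)\<^sup>2"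
proof -
  have *: "Tvu = Tuv - h + qcnj h" using assms(5) by (simp add: algebra_simps)
  obtain h0 h1 h2 h3 where h: "h = (h0, h1, h2, h3)" by (cases h)
  obtain x0 x1 x2 x3 where x: "Tuv = (x0, x1, x2, x3)" by (cases Tuv)
  obtain y0 y1 y2 y3 where y: "Tuu = (y0, y1, y2, y3)" by (cases Tuu)
  obtain z0 z1 z2 z3 where z: "Tvv = (z0, z1, z2, z3)" by (cases Tvv)
  have "x0 = 0" "y0 = 0" "z0 = 0" using assms x y z by auto
  then show ?thesis unfolding * x y z h by (simp add: qone_def power2_eq_square algebra_simps)
qed

lemma oneill_circle_fibres:
  fixes Tuu Tuv Tvu Tvv Ku Kv k :: quat
  assumes "snd Tuu = 0" "snd Tvv = 0" "snd Tuv = 0" "snd Tvu = 0" "Tuv - k = Tvu + qcnj k"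
    "fst Ku = 0" "fst Kv = 0"
  shows "(Tuu - Ku) \<bullet> (Tvv - Kv) - (Tuv - k) \<bullet> (Tuv - k)
    + (Tuv \<bullet> Tuv + Tvu \<bullet> Tvu - Tvu \<bullet> Tuv - Tuu \<bullet> Tvv) = Ku \<bullet> Kv - k \<bullet> k + 4 * (fst k)\<^sup>2"
proof -
  have *: "Tvu = Tuv - k - qcnj k" using assms(5) by (simp add: algebra_simps)
  obtain h0 h1 h2 h3 where h: "k = (h0, h1, h2, h3)" by (cases k)
  obtain x0 x1 x2 x3 where x: "Tuv = (x0, x1, x2, x3)" by (cases Tuv)
  obtain y0 y1 y2 y3 where y: "Tuu = (y0, y1, y2, y3)" by (cases Tuu)
  obtain z0 z1 z2 z3 where z: "Tvv = (z0, z1, z2, z3)" by (cases Tvv)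
  obtain a0 a1 a2 a3 where a: "Ku = (a0, a1, a2, a3)" by (cases Ku)
  obtain b0 b1 b2 b3 where b: "Kv = (b0, b1, b2, b3)" by (cases Kv)
  have "x1 = 0" "x2 = 0" "x3 = 0" "y1 = 0" "y2 = 0" "y3 = 0" "z1 = 0" "z2 = 0" "z3 = 0" "a0 = 0" "b0 = 0"
    using assms x y z a b by (auto simp: zero_prod_def)
  then show ?thesis unfolding * x y z h a b by (simp add: power2_eq_square algebra_simps)
qed

lemma sphere_tangent:
  fixes s :: "'a::euclidean_space \<Rightarrow> quat3"
  assumes U: "open U" and s: "smooth_on U s" and y: "y \<in> U" and sphere: "\<And>x. x \<in> U \<Longrightarrow> s x \<bullet> s x = 1"
  shows "s y \<bullet> dd s v y = 0"
proof -
  have "dd (\<lambda>y. s y \<bullet> s y) v y = dd (\<lambda>y. 1) v y"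
    by (rule dd_transform[OF smooth_on_differentiable[OF smooth_on_bilinear[OF bounded_bilinear_inner U s s] U y] U y sphere])
  then show ?thesis
    using dd_inner[OF smooth_on_differentiable[OF s U y] smooth_on_differentiable[OF s U y], of v]
    by (simp add: inner_commute)
qed

text \<open>Differentiating the moment equation and moving \<open>killing\<close> across by skewness
  shows that the product equals its own conjugate; \<open>snd\<close> extracts the imaginary
  part.\<close>

lemma moment_tangent:
  fixes s :: "'a::euclidean_space \<Rightarrow> quat3"
  assumes U: "open U" and s: "smooth_on U s" and y: "y \<in> U"
    and moment: "\<And>x. x \<in> U \<Longrightarrow> hprod (s x) (killing \<alpha> \<beta> (s x)) = 0"
  shows "snd (hprod (killing \<alpha> \<beta> (s y)) (dd s v y)) = 0"
proof -
  let ?X = "killing \<alpha> \<beta>"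
  note d = smooth_on_differentiable[OF _ U y]
  have Xs: "smooth_on U (\<lambda>y. ?X (s y))"
    by (rule smooth_on_bounded_linear[OF bounded_linear_killing U s])
  have "dd (\<lambda>y. hprod (s y) (?X (s y))) v y = dd (\<lambda>y. 0) v y"
    by (rule dd_transform[OF d[OF smooth_on_bilinear[OF bounded_bilinear_hprod U s Xs]] U y moment])
  then have "hprod (s y) (?X (dd s v y)) + hprod (dd s v y) (?X (s y)) = 0"
    using dd_bilinear[OF bounded_bilinear_hprod d[OF s] d[OF Xs], of v]
      dd_bounded_linear[OF bounded_linear_killing d[OF s], of \<alpha> \<beta> v] by simp
  then have "qcnj (hprod (?X (s y)) (dd s v y)) = hprod (?X (s y)) (dd s v y)"
    using hprod_killing[of \<alpha> \<beta> "s y" "dd s v y"] hprod_commute[of "dd s v y" "?X (s y)"]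
    by (simp add: add_eq_0_iff)
  then show ?thesis by (cases "hprod (?X (s y)) (dd s v y)") (simp add: zero_prod_def)
qed

text \<open>\<open>s\<close> is a local section, horizontal at \<open>x0\<close>, of the Riemannian submersion onto the orbifold chart
  from the zero set of the moment map in the sphere. The fibres are tangent to \<open>rmul s h\<close>, \<open>h\<close> imaginary,
  and \<open>killing \<alpha> \<beta> s\<close>; the assumption on the metric may use all
  components of \<open>hprod\<close>, as the additional ones vanish on vectors tangent to that zero set.\<close>

locale horizontal_section = riemannian_domain U g for U :: "'a::euclidean_space set" and g +
  fixes \<alpha> \<beta> :: real and s :: "'a \<Rightarrow> quat3" and x0 :: 'a
  assumes dim: "DIM('a) = 4"
    and weights: "\<alpha> > 0" "\<beta> > 0"
    and pinch: "\<beta>\<^sup>2 < sqrt 2 * \<alpha>\<^sup>2" "sqrt 2 * \<alpha>\<^sup>2 < 2 * sqrt 2 * \<beta>\<^sup>2"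
    and x0: "x0 \<in> U" and s: "smooth_on U s"
    and sphere: "\<And>x. x \<in> U \<Longrightarrow> s x \<bullet> s x = 1"
    and moment: "\<And>x. x \<in> U \<Longrightarrow> hprod (s x) (killing \<alpha> \<beta> (s x)) = 0"
    and metric: "\<And>x v w. x \<in> U \<Longrightarrow> g x v w = dd s v x \<bullet> dd s w x
      - hprod (s x) (dd s v x) \<bullet> hprod (s x) (dd s w x)
      - (1 / (killing \<alpha> \<beta> (s x) \<bullet> killing \<alpha> \<beta> (s x))) *
        (hprod (killing \<alpha> \<beta> (s x)) (dd s v x) \<bullet> hprod (killing \<alpha> \<beta> (s x)) (dd s w x))"
    and hor0: "\<And>v. hprod (s x0) (dd s v x0) = 0" "\<And>v. hprod (killing \<alpha> \<beta> (s x0)) (dd s v x0) = 0"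
begin

abbreviation X where "X \<equiv> killing \<alpha> \<beta>"

text \<open>\<open>\<theta>\<close> and \<open>\<eta>\<close> are the components of the derivative
  of \<open>s\<close> along the quaternionic lines of \<open>s\<close> and \<open>X s\<close>. The
  second is left unnormalized, with \<open>\<zeta>\<close> making up for the length.\<close>

definition \<theta> where "\<theta> v y = hprod (s y) (dd s v y)"
definition \<eta> where "\<eta> v y = hprod (X (s y)) (dd s v y)"
definition \<zeta> where "\<zeta> y = 1 / (X (s y) \<bullet> X (s y))"
definition D2 where "D2 a v = dd (dd s v) a x0"

lemma smooth_Xs: "smooth_on U (\<lambda>y. X (s y))"
  by (rule smooth_on_bounded_linear[OF bounded_linear_killing U s])

lemma smooth_\<theta>: "smooth_on U (\<theta> v)"
  unfolding \<theta>_def[abs_def] by (rule smooth_on_bilinear[OF bounded_bilinear_hprod U s smooth_on_dd[OF s]])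

lemma smooth_\<eta>: "smooth_on U (\<eta> v)"
  unfolding \<eta>_def[abs_def] by (rule smooth_on_bilinear[OF bounded_bilinear_hprod U smooth_Xs smooth_on_dd[OF s]])

lemma Xs_nonzero: "x \<in> U \<Longrightarrow> X (s x) \<bullet> X (s x) \<noteq> 0"
  using killing_nonzero[OF weights, of "s x"] sphere[of x] by (cases "s x = 0") auto

lemma smooth_\<zeta>: "smooth_on U \<zeta>"
  unfolding \<zeta>_def[abs_def]
  by (intro smooth_on_inverse smooth_on_bilinear[OF bounded_bilinear_inner] U smooth_Xs Xs_nonzero)

lemmas diffU = smooth_on_differentiable[OF _ U]

lemma D2_commute: "D2 a v = D2 v a"
  unfolding D2_def by (rule second_derivatives_commute[OF s U x0])

lemma vertical0: "\<theta> v x0 = 0" "\<eta> v x0 = 0"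
  by (simp_all add: \<theta>_def \<eta>_def hor0)

lemma dd_\<theta>: "dd (\<theta> v) a x0 = hprod (s x0) (D2 a v) + hprod (dd s a x0) (dd s v x0)"
  unfolding \<theta>_def[abs_def] D2_def
  by (rule dd_bilinear[OF bounded_bilinear_hprod diffU[OF s x0] diffU[OF smooth_on_dd[OF s] x0]])

lemma dd_\<eta>: "dd (\<eta> v) a x0 = hprod (X (s x0)) (D2 a v) + hprod (X (dd s a x0)) (dd s v x0)"
  using dd_bilinear[OF bounded_bilinear_hprod diffU[OF smooth_Xs x0] diffU[OF smooth_on_dd[OF s] x0], of v a]
    dd_bounded_linear[OF bounded_linear_killing diffU[OF s x0], of \<alpha> \<beta> a]
  unfolding \<eta>_def[abs_def] D2_def by simp

lemma fst_dd_\<theta>: "fst (dd (\<theta> v) a x0) = 0"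
proof -
  have "fst (\<theta> v y) = 0" if y: "y \<in> U" for y
    using sphere_tangent[OF U s y sphere] by (simp add: \<theta>_def fst_hprod)
  then have "dd (\<lambda>y. fst (\<theta> v y)) a x0 = dd (\<lambda>y. 0) a x0"
    by (intro dd_transform[OF diffU[OF smooth_on_bounded_linear[OF bounded_linear_fst U smooth_\<theta>] x0] U x0])
  then show ?thesis using dd_bounded_linear[OF bounded_linear_fst diffU[OF smooth_\<theta> x0]] by simp
qed

lemma snd_dd_\<eta>: "snd (dd (\<eta> v) a x0) = 0"
proof -
  have "snd (\<eta> v y) = 0" if y: "y \<in> U" for y
    using moment_tangent[OF U s y moment] by (simp add: \<eta>_def)
  then have "dd (\<lambda>y. snd (\<eta> v y)) a x0 = dd (\<lambda>y. 0) a x0"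
    by (intro dd_transform[OF diffU[OF smooth_on_bounded_linear[OF bounded_linear_snd U smooth_\<eta>] x0] U x0])
  then show ?thesis using dd_bounded_linear[OF bounded_linear_snd diffU[OF smooth_\<eta> x0]] by simp
qed

lemma metric': "y \<in> U \<Longrightarrow>
    (dd s v y \<bullet> dd s w y - \<theta> v y \<bullet> \<theta> w y) - \<zeta> y * (\<eta> v y \<bullet> \<eta> w y) = g y v w"
  by (simp add: metric \<theta>_def \<eta>_def \<zeta>_def)

lemma metric_x0: "g x0 v w = dd s v x0 \<bullet> dd s w x0"
  using metric'[OF x0, of v w] vertical0 by simp

lemma smooth_parts:
  "smooth_on U (\<lambda>y. dd s v y \<bullet> dd s w y)" "smooth_on U (\<lambda>y. \<theta> v y \<bullet> \<theta> w y)"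
  "smooth_on U (\<lambda>y. \<eta> v y \<bullet> \<eta> w y)" "smooth_on U (\<lambda>y. \<zeta> y * (\<eta> v y \<bullet> \<eta> w y))"
  "smooth_on U (\<lambda>y. dd s v y \<bullet> dd s w y - \<theta> v y \<bullet> \<theta> w y)"
proof -
  show 1: "smooth_on U (\<lambda>y. dd s v y \<bullet> dd s w y)" "smooth_on U (\<lambda>y. \<theta> v y \<bullet> \<theta> w y)"
    and 2: "smooth_on U (\<lambda>y. \<eta> v y \<bullet> \<eta> w y)"
    by (intro smooth_on_bilinear[OF bounded_bilinear_inner U] smooth_on_dd[OF s] smooth_\<theta> smooth_\<eta>)+
  show "smooth_on U (\<lambda>y. \<zeta> y * (\<eta> v y \<bullet> \<eta> w y))"
    by (rule smooth_on_bilinear[OF bounded_bilinear_mult U smooth_\<zeta> 2])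
  show "smooth_on U (\<lambda>y. dd s v y \<bullet> dd s w y - \<theta> v y \<bullet> \<theta> w y)"
    by (rule smooth_on_diff[OF U 1])
qed

text \<open>The vertical terms of the metric are quadratic in quantities vanishing at
  \<open>x0\<close>, so to first order only the induced metric is left.\<close>

lemma dd_metric: "dd (\<lambda>y. g y v w) a x0 = D2 a v \<bullet> dd s w x0 + dd s v x0 \<bullet> D2 a w"
proof -
  have "dd (\<lambda>y. g y v w) a x0 = dd (\<lambda>y. (dd s v y \<bullet> dd s w y - \<theta> v y \<bullet> \<theta> w y) - \<zeta> y * (\<eta> v y \<bullet> \<eta> w y)) a x0"
    by (rule dd_transform[OF diff[OF x0] U x0]) (rule metric'[symmetric])
  also have "\<dots> = dd (\<lambda>y. dd s v y \<bullet> dd s w y) a x0 - dd (\<lambda>y. \<theta> v y \<bullet> \<theta> w y) a x0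
      - dd (\<lambda>y. \<zeta> y * (\<eta> v y \<bullet> \<eta> w y)) a x0"
    using smooth_parts[THEN diffU, OF x0] by (simp add: dd_diff)
  also have "dd (\<lambda>y. \<theta> v y \<bullet> \<theta> w y) a x0 = 0"
    using dd_inner[OF diffU[OF smooth_\<theta> x0] diffU[OF smooth_\<theta> x0]] by (simp add: vertical0)
  also have "dd (\<lambda>y. \<zeta> y * (\<eta> v y \<bullet> \<eta> w y)) a x0 = 0"
    using dd_bilinear[OF bounded_bilinear_mult diffU[OF smooth_\<zeta> x0] diffU[OF smooth_parts(3) x0]]
      dd_inner[OF diffU[OF smooth_\<eta> x0] diffU[OF smooth_\<eta> x0]] by (simp add: vertical0)
  also have "dd (\<lambda>y. dd s v y \<bullet> dd s w y) a x0 = dd s v x0 \<bullet> D2 a w + D2 a v \<bullet> dd s w x0"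
    unfolding D2_def
    by (rule dd_inner[OF diffU[OF smooth_on_dd[OF s] x0] diffU[OF smooth_on_dd[OF s] x0]])
  finally show ?thesis by simp
qed

text \<open>For the same reason each vertical factor must be differentiated exactly once, and
  \<open>\<zeta>\<close> contributes only its value.\<close>

lemma dd2_metric:
  "dd (dd (\<lambda>y. g y v w) a) b x0 =
     dd (dd (dd s v) a) b x0 \<bullet> dd s w x0 + D2 a v \<bullet> D2 b w + D2 b v \<bullet> D2 a w
       + dd s v x0 \<bullet> dd (dd (dd s w) a) b x0
     - (dd (\<theta> v) a x0 \<bullet> dd (\<theta> w) b x0 + dd (\<theta> v) b x0 \<bullet> dd (\<theta> w) a x0)
     - \<zeta> x0 * (dd (\<eta> v) a x0 \<bullet> dd (\<eta> w) b x0 + dd (\<eta> v) b x0 \<bullet> dd (\<eta> w) a x0)"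
proof -
  have "dd (dd (\<lambda>y. g y v w) a) b x0
      = dd (dd (\<lambda>y. (dd s v y \<bullet> dd s w y - \<theta> v y \<bullet> \<theta> w y) - \<zeta> y * (\<eta> v y \<bullet> \<eta> w y)) a) b x0"
    by (rule dd2_transform[OF smooth U x0]) (rule metric'[symmetric])
  also have "\<dots> = dd (dd (\<lambda>y. dd s v y \<bullet> dd s w y) a) b x0 - dd (dd (\<lambda>y. \<theta> v y \<bullet> \<theta> w y) a) b x0
      - dd (dd (\<lambda>y. \<zeta> y * (\<eta> v y \<bullet> \<eta> w y)) a) b x0"
    using dd2_diff[OF smooth_parts(5,4) U x0, of v w v w a b] dd2_diff[OF smooth_parts(1,2) U x0, of v w v w a b] by simp
  also have "dd (dd (\<lambda>y. \<theta> v y \<bullet> \<theta> w y) a) b x0 = dd (\<theta> v) a x0 \<bullet> dd (\<theta> w) b x0 + dd (\<theta> v) b x0 \<bullet> dd (\<theta> w) a x0"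
    using dd2_inner[OF smooth_\<theta> smooth_\<theta> U x0] by (simp add: vertical0)
  also have "dd (dd (\<lambda>y. \<zeta> y * (\<eta> v y \<bullet> \<eta> w y)) a) b x0
      = \<zeta> x0 * (dd (\<eta> v) a x0 \<bullet> dd (\<eta> w) b x0 + dd (\<eta> v) b x0 \<bullet> dd (\<eta> w) a x0)"
    using dd2_bilinear[OF bounded_bilinear_mult smooth_\<zeta> smooth_parts(3) U x0, of v w a b]
      dd2_inner[OF smooth_\<eta> smooth_\<eta> U x0, of v w a b]
      dd_inner[OF diffU[OF smooth_\<eta> x0] diffU[OF smooth_\<eta> x0]] by (simp add: vertical0)
  also have "dd (dd (\<lambda>y. dd s v y \<bullet> dd s w y) a) b x0 =
      dd (dd (dd s v) a) b x0 \<bullet> dd s w x0 + D2 a v \<bullet> D2 b w + D2 b v \<bullet> D2 a w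
       + dd s v x0 \<bullet> dd (dd (dd s w) a) b x0"
    unfolding D2_def by (rule dd2_inner[OF smooth_on_dd[OF s] smooth_on_dd[OF s] U x0])
  finally show ?thesis .
qed

text \<open>As for a submanifold of flat space, the connection is the tangential part of the second
  derivative; agreement of the metrics to first order is enough.\<close>

lemma christoffel_x0: "g x0 (christoffel g x0 u v) w = D2 u v \<bullet> dd s w x0"
  using christoffel_koszul[OF x0, of u v w] D2_commute[of w u] D2_commute[of w v] D2_commute[of v u]
  by (simp add: koszul_def dd_metric inner_commute)

lemma linear_ds: "linear (\<lambda>v. dd s v x0)"
  by (rule linear_frechet_derivative[OF diffU[OF s x0]])

lemma ds_nonzero: "v \<noteq> 0 \<Longrightarrow> dd s v x0 \<noteq> 0"
  using pos[OF x0, of v] by (auto simp: metric_x0)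

lemma frame: "u \<noteq> 0 \<Longrightarrow> horizontal_vector \<alpha> \<beta> (s x0) (dd s u x0)"
  by unfold_locales (use weights pinch sphere[OF x0] moment[OF x0] hor0 ds_nonzero in auto)

text \<open>The derivative of \<open>s\<close> at \<open>x0\<close> has rank 4 and takes values in
  one quaternionic line, hence fills it. The tangential part of \<open>D2 a b\<close> is thus its
  whole component in that line, not just some real components of it.\<close>

lemma hprod_D2:
  assumes u: "u \<noteq> 0"
  shows "hprod (dd s u x0) (D2 a b) = hprod (dd s u x0) (dd s (christoffel g x0 a b) x0)"
proof -
  interpret F: horizontal_vector \<alpha> \<beta> "s x0" "dd s u x0" by (rule frame[OF u])
  let ?A = "dd s u x0"
  let ?f = "\<lambda>w. hprod ?A (dd s w x0)"
  have lin: "linear ?f"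
    by (rule linearI) (simp_all add: linear_add[OF linear_ds] linear_scale[OF linear_ds] hprod.add_right hprod.scaleR_right)
  have "inj ?f"
  proof (subst linear_injective_0[OF lin], intro allI impI)
    fix w assume "?f w = 0"
    then have "dd s w x0 = 0" using F.expansion[of "dd s w x0"] hor0 by (simp add: rmul.zero_right)
    then show "w = 0" using ds_nonzero by blast
  qed
  then have "surj ?f" using linear_injective_imp_surjective[OF lin] dim by simp
  define z where "z = D2 a b - dd s (christoffel g x0 a b) x0"
  have "h \<bullet> hprod ?A z = 0" for h
  proof -
    obtain w where w: "(?A \<bullet> ?A) *\<^sub>R h = ?f w" using \<open>surj ?f\<close> by (meson surjD)
    have "dd s w x0 = rmul ?A h"
      using F.expansion[of "dd s w x0"] hor0 F.a by (simp add: rmul.zero_right w[symmetric])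
    then have "h \<bullet> hprod ?A z = dd s w x0 \<bullet> z" by (simp add: inner_rmul)
    also have "\<dots> = 0"
      using christoffel_x0[of a b w] metric_x0 by (simp add: z_def inner_diff_right inner_commute)
    finally show ?thesis .
  qed
  then have "hprod ?A z = 0" by (metis inner_eq_zero_iff)
  then show ?thesis by (simp add: z_def hprod.diff_right)
qed

text \<open>After the third derivatives of \<open>s\<close> cancel, everything splits into
  components along \<open>s\<close> and along \<open>X s\<close>. The two O'Neill identities reduce
  these to expressions in the first derivatives, which are the terms of the estimate for
  \<open>horizontal_vector\<close>.\<close>

lemma curvature_numerator_pos:
  assumes u: "u \<noteq> 0" and ind: "\<And>t. v \<noteq> t *\<^sub>R u"
  shows "g x0 (curvature g x0 u v v) u > 0"
proof -
  interpret F: horizontal_vector \<alpha> \<beta> "s x0" "dd s u x0" by (rule frame[OF u])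
  define A where "A = dd s u x0"
  define B where "B = dd s v x0"
  let ?T = "\<lambda>a b. dd (\<theta> b) a x0" and ?E = "\<lambda>a b. dd (\<eta> b) a x0"
  let ?\<Gamma> = "christoffel g x0"
  have r2: "\<zeta> x0 = 1 / F.r2" by (simp add: \<zeta>_def F.r2_def)
  \<comment> \<open>With this symmetry the third derivatives in the three second derivatives of the
    metric cancel.\<close>
  have d3: "dd (dd (dd s u) v) u x0 = dd (dd (dd s v) u) u x0"
    "dd (dd (dd s u) v) v x0 = dd (dd (dd s v) v) u x0"
    using third_derivatives_commute[OF s U x0] second_derivatives_commute[OF smooth_on_dd[OF s] U x0] by auto
  \<comment> \<open>Gauss equation: by Parseval the components in the tangential line cancel,
    leaving those along \<open>s\<close> and \<open>X s\<close>.\<close>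
  have gauss: "D2 a b \<bullet> D2 c d - g x0 (?\<Gamma> a b) (?\<Gamma> c d)
     = hprod (s x0) (D2 a b) \<bullet> hprod (s x0) (D2 c d) + (hprod (X (s x0)) (D2 a b) \<bullet> hprod (X (s x0)) (D2 c d)) / F.r2"
    for a b c d
    using F.parseval[of "D2 a b" "D2 c d"] F.parseval[of "dd s (?\<Gamma> a b) x0" "dd s (?\<Gamma> c d) x0"]
    by (simp add: metric_x0 hprod_D2[OF u] hor0 F.s F.r2_def)
  have "g x0 (curvature g x0 u v v) u =
     (D2 u u \<bullet> D2 v v - g x0 (?\<Gamma> u u) (?\<Gamma> v v)) - (D2 u v \<bullet> D2 u v - g x0 (?\<Gamma> u v) (?\<Gamma> u v))
     + (?T u v \<bullet> ?T u v + ?T v u \<bullet> ?T v u - ?T v u \<bullet> ?T u v - ?T u u \<bullet> ?T v v)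
     + \<zeta> x0 * (?E u v \<bullet> ?E u v + ?E v u \<bullet> ?E v u - ?E v u \<bullet> ?E u v - ?E u u \<bullet> ?E v v)"
    unfolding curvature_second_derivatives[OF x0] dd2_metric d3 D2_commute[of v u]
    by (simp add: field_simps inner_commute)
  also have "\<dots> = (hprod (s x0) (D2 u u) \<bullet> hprod (s x0) (D2 v v) - hprod (s x0) (D2 u v) \<bullet> hprod (s x0) (D2 u v)
     + (?T u v \<bullet> ?T u v + ?T v u \<bullet> ?T v u - ?T v u \<bullet> ?T u v - ?T u u \<bullet> ?T v v))
     + (hprod (X (s x0)) (D2 u u) \<bullet> hprod (X (s x0)) (D2 v v) - hprod (X (s x0)) (D2 u v) \<bullet> hprod (X (s x0)) (D2 u v)
     + (?E u v \<bullet> ?E u v + ?E v u \<bullet> ?E v u - ?E v u \<bullet> ?E u v - ?E u u \<bullet> ?E v v)) / F.r2"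
    unfolding gauss r2 by (simp add: add_divide_distrib diff_divide_distrib)
  also have "hprod (s x0) (D2 u u) \<bullet> hprod (s x0) (D2 v v) - hprod (s x0) (D2 u v) \<bullet> hprod (s x0) (D2 u v)
     + (?T u v \<bullet> ?T u v + ?T v u \<bullet> ?T v u - ?T v u \<bullet> ?T u v - ?T u u \<bullet> ?T v v)
     = (A \<bullet> A) * (B \<bullet> B) + 3 * (hprod A B \<bullet> hprod A B) - 4 * (A \<bullet> B)\<^sup>2"
  proof -
    have "hprod (s x0) (D2 u u) = ?T u u - (A \<bullet> A) *\<^sub>R qone" "hprod (s x0) (D2 v v) = ?T v v - (B \<bullet> B) *\<^sub>R qone"
      "hprod (s x0) (D2 u v) = ?T u v - hprod A B"
      by (simp_all add: dd_\<theta> A_def B_def hprod_self)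
    moreover have "?T u v - hprod A B = ?T v u - qcnj (hprod A B)"
      unfolding hprod_commute[of B A, symmetric] by (simp add: dd_\<theta> A_def B_def D2_commute[of v u])
    ultimately show ?thesis
      using oneill_sphere_fibres[of "?T u u" "?T v v" "?T u v" "?T v u" "hprod A B" "A \<bullet> A" "B \<bullet> B"]
      by (simp add: fst_dd_\<theta> fst_hprod)
  qed
  also have "hprod (X (s x0)) (D2 u u) \<bullet> hprod (X (s x0)) (D2 v v) - hprod (X (s x0)) (D2 u v) \<bullet> hprod (X (s x0)) (D2 u v)
     + (?E u v \<bullet> ?E u v + ?E v u \<bullet> ?E v u - ?E v u \<bullet> ?E u v - ?E u u \<bullet> ?E v v)
     = hprod (X A) A \<bullet> hprod (X B) B - hprod (X A) B \<bullet> hprod (X A) B + 4 * (X A \<bullet> B)\<^sup>2"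
  proof -
    have "hprod (X (s x0)) (D2 u u) = ?E u u - hprod (X A) A" "hprod (X (s x0)) (D2 v v) = ?E v v - hprod (X B) B"
      "hprod (X (s x0)) (D2 u v) = ?E u v - hprod (X A) B"
      by (simp_all add: dd_\<eta> A_def B_def)
    moreover have "?E u v - hprod (X A) B = ?E v u + qcnj (hprod (X A) B)"
      using hprod_killing[of \<alpha> \<beta> B A]
      unfolding hprod_commute[of B "X A", symmetric] by (simp add: dd_\<eta> A_def B_def D2_commute[of v u])
    moreover have "fst (hprod (X C) C) = 0" for C
      using hprod_killing_imaginary[of C \<alpha> \<beta>] hprod_killing[of \<alpha> \<beta> C C] by simp
    ultimately show ?thesis
      using oneill_circle_fibres[of "?E u u" "?E v v" "?E u v" "?E v u" "hprod (X A) B" "hprod (X A) A" "hprod (X B) B"]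
      by (simp add: snd_dd_\<eta> fst_hprod)
  qed
  also have "(A \<bullet> A) * (B \<bullet> B) + 3 * (hprod A B \<bullet> hprod A B) - 4 * (A \<bullet> B)\<^sup>2
    + (hprod (X A) A \<bullet> hprod (X B) B - hprod (X A) B \<bullet> hprod (X A) B + 4 * (X A \<bullet> B)\<^sup>2) / F.r2 > 0"
    unfolding A_def
  proof (rule F.curvature_numerator_pos)
    show "hprod (s x0) B = 0" "hprod (X (s x0)) B = 0" by (simp_all add: B_def hor0)
    show "B \<noteq> t *\<^sub>R dd s u x0" for t
    proof
      assume "B = t *\<^sub>R dd s u x0"
      then have "dd s (v - t *\<^sub>R u) x0 = 0"
        by (simp add: B_def linear_diff[OF linear_ds] linear_scale[OF linear_ds])
      then show False using ds_nonzero ind[of t] by force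
    qed
  qed
  finally show ?thesis .
qed

lemma sectional_curvature_pos:
  assumes "u \<noteq> v" "independent {u, v}"
  shows "sectional_curvature g x0 u v > 0"
proof -
  have u: "u \<noteq> 0" using assms dependent_zero by blast
  have ind: "v \<noteq> t *\<^sub>R u" for t
    using assms by (metis dependent_def insertCI singletonD span_base span_scale
        Diff_insert_absorb insert_commute)
  \<comment> \<open>A multiple of the component of \<open>v\<close> orthogonal to \<open>u\<close>;
    its squared length is \<open>g x0 u u\<close> times the Gram determinant.\<close>
  define w where "w = g x0 u u *\<^sub>R v - g x0 u v *\<^sub>R u"
  have guu: "g x0 u u > 0" using pos[OF x0 u] .
  have "w \<noteq> 0"
  proof
    assume "w = 0"
    then have "g x0 u u *\<^sub>R v = g x0 u v *\<^sub>R u" by (simp add: w_def)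
    then have "v = (g x0 u v / g x0 u u) *\<^sub>R u" using guu
      by (metis divide_inverse_commute less_irrefl scaleR_one scaleR_scaleR left_inverse)
    then show False using ind by blast
  qed
  then have "g x0 w w > 0" using pos[OF x0] by blast
  also have "g x0 w w = g x0 u u * (g x0 u u * g x0 v v - (g x0 u v)\<^sup>2)"
    unfolding w_def
    by (simp add: linear_diff[OF linear_left[OF x0]] linear_diff[OF linear_right[OF x0]]
        linear_scale[OF linear_left[OF x0]] linear_scale[OF linear_right[OF x0]] sym[OF x0, of v u]
        power2_eq_square algebra_simps)
  finally have "g x0 u u * g x0 v v - (g x0 u v)\<^sup>2 > 0" using guu zero_less_mult_pos by blast
  then show ?thesis
    unfolding sectional_curvature_def using curvature_numerator_pos[OF u ind] by simp
qed

end

section \<open>Tangent vectors of orbits\<close>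

fun circle :: "real \<Rightarrow> real \<Rightarrow> real \<Rightarrow> quat3 \<Rightarrow> quat3" where
  "circle \<alpha> \<beta> t (u0, u1, u2) = (qexp_j (\<alpha> * t) \<cdot>\<^sub>q u0, qexp_j (\<beta> * t) \<cdot>\<^sub>q u1, qexp_j (\<beta> * t) \<cdot>\<^sub>q u2)"

lemma qexp_j_alt: "qexp_j t = cos t *\<^sub>R qone + sin t *\<^sub>R qj"
  by (simp add: qexp_j_def qone_def qj_def)

lemma qexp_j_add: "qexp_j (s + t) = qexp_j s \<cdot>\<^sub>q qexp_j t"
  by (simp add: qexp_j_def cos_add sin_add algebra_simps)

lemma qexp_j_periodic: "qexp_j (t + 2 * pi * of_int k) = qexp_j t"
  by (simp add: qexp_j_def cos_add sin_add)

lemma circle_add: "circle \<alpha> \<beta> (s + t) u = circle \<alpha> \<beta> s (circle \<alpha> \<beta> t u)"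
  by (cases u rule: prod_cases3) (simp add: distrib_left qexp_j_add qmult_assoc)

lemma circle_rmul: "circle \<alpha> \<beta> t (rmul u h) = rmul (circle \<alpha> \<beta> t u) h"
  by (cases u rule: prod_cases3) (simp add: qmult_assoc)

lemma circle_0 [simp]: "circle \<alpha> \<beta> 0 u = u"
  by (cases u rule: prod_cases3) (simp add: qexp_j_alt)

text \<open>Integer weights make the lifted action periodic, which confines orbit parameters to a
  compact interval.\<close>

lemma circle_periodic: "circle (real m) (real n) (t + 2 * pi * of_int k) u = circle (real m) (real n) t u"
proof -
  have "qexp_j (real l * (t + 2 * pi * of_int k)) = qexp_j (real l * t)" for l
    using qexp_j_periodic[of "real l * t" "int l * k"] by (simp add: algebra_simps)
  then show ?thesis by (cases u rule: prod_cases3) simp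
qed

lemma circle_has_vector_derivative:
  "((\<lambda>t. circle \<alpha> \<beta> t u) has_vector_derivative killing \<alpha> \<beta> (circle \<alpha> \<beta> t u)) (at t)"
proof -
  have q: "((\<lambda>t. qexp_j (c * t) \<cdot>\<^sub>q h) has_vector_derivative c *\<^sub>R (qj \<cdot>\<^sub>q (qexp_j (c * t) \<cdot>\<^sub>q h))) (at t)" for c h
  proof -
    have jj: "qj \<cdot>\<^sub>q (qj \<cdot>\<^sub>q h) = - h" by (cases h) (simp add: qj_def)
    have "((\<lambda>t. cos (c * t) *\<^sub>R h + sin (c * t) *\<^sub>R (qj \<cdot>\<^sub>q h)) has_vector_derivative
      c *\<^sub>R (qj \<cdot>\<^sub>q (qexp_j (c * t) \<cdot>\<^sub>q h))) (at t)"
      by (auto intro!: derivative_eq_intros simp: qexp_j_alt qmult_linear_simps jj algebra_simps)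
    then show ?thesis by (simp add: qexp_j_alt qmult_linear_simps)
  qed
  obtain u0 u1 u2 where u: "u = (u0, u1, u2)" by (cases u rule: prod_cases3)
  show ?thesis unfolding u circle.simps killing.simps
    by (intro has_vector_derivative_Pair q)
qed

lemma inner_rmul_adjoint: "rmul e k \<bullet> w = e \<bullet> rmul w (qcnj k)"
proof -
  have "rmul w (qcnj k) \<bullet> e = k \<bullet> hprod e w"
    using inner_rmul[of w "qcnj k" e] hprod_commute[of w e] by simp
  then show ?thesis unfolding inner_rmul[of e k w] inner_commute[of e] by simp
qed

lemma rmul_qcnj_cancel: "h \<bullet> h = 1 \<Longrightarrow> rmul (rmul u h) (qcnj h) = u" "h \<bullet> h = 1 \<Longrightarrow> rmul (rmul u (qcnj h)) h = u"
  by (simp_all add: rmul_rmul qcnj_qmult_self)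

text \<open>The difference quotient with its limit filled in can be evaluated along null sequences
  that take the value 0.\<close>

lemma has_vector_derivative_quotient:
  fixes f :: "real \<Rightarrow> 'b::real_normed_vector"
  assumes "(f has_vector_derivative f') (at x)"
  shows "isCont (\<lambda>d. if d = 0 then f' else (f (x + d) - f x) /\<^sub>R d) 0"
proof -
  have "(\<lambda>d. norm ((f (x + d) - f x - d *\<^sub>R f') /\<^sub>R norm d)) \<midarrow>0\<rightarrow> 0"
    using assms unfolding has_vector_derivative_def has_derivative_at by (simp add: divide_inverse mult.commute)
  moreover have "\<forall>\<^sub>F d in at 0. norm ((f (x + d) - f x - d *\<^sub>R f') /\<^sub>R norm d) = norm ((f (x + d) - f x) /\<^sub>R d - f')"
  proof -
    have "norm ((f (x + d) - f x - d *\<^sub>R f') /\<^sub>R norm d) = norm ((f (x + d) - f x) /\<^sub>R d - f')" if "d \<noteq> 0" for d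
    proof -
      have "(f (x + d) - f x) /\<^sub>R d - f' = (f (x + d) - f x - d *\<^sub>R f') /\<^sub>R d"
        using that by (simp add: scaleR_diff_right)
      then show ?thesis by simp
    qed
    then show ?thesis by (simp add: eventually_at_filter)
  qed
  ultimately have "(\<lambda>d. norm ((f (x + d) - f x) /\<^sub>R d - f')) \<midarrow>0\<rightarrow> 0"
    by (rule Lim_transform_eventually)
  then have "(\<lambda>d. (f (x + d) - f x) /\<^sub>R d) \<midarrow>0\<rightarrow> f'"
    by (simp only: tendsto_norm_zero_iff LIM_zero_iff)
  then have "(\<lambda>d. if d = 0 then f' else (f (x + d) - f x) /\<^sub>R d) \<midarrow>0\<rightarrow> f'"
    by (rule Lim_transform_eventually) (auto simp: eventually_at_filter)
  then show ?thesis by (simp add: isCont_def)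
qed

text \<open>The orbit parameters along a curve in an orbit of the compact group of all \<open>(a, h)\<close> need not be
  continuous, but along a sequence they converge, after division by the limit, to the identity.\<close>

lemma orbit_parameters:
  assumes c: "isCont c 0" "c 0 = u" and ev: "eventually P (at (0::real))"
    and P: "\<And>t. P t \<Longrightarrow> \<exists>a h. h \<bullet> h = 1 \<and> c t = rmul (circle (real m) (real n) a u) h"
  obtains t \<delta> k where "\<And>i. t i \<noteq> (0::real)" "t \<longlonglongrightarrow> 0" "\<delta> \<longlonglongrightarrow> (0::real)" "k \<longlonglongrightarrow> qone"
    "\<And>i::nat. c (t i) = rmul (circle (real m) (real n) (\<delta> i) u) (k i)"
proof -
  let ?E = "circle (real m) (real n)"
  obtain d where d: "d > 0" "\<And>t. t \<noteq> 0 \<Longrightarrow> \<bar>t\<bar> < d \<Longrightarrow> P t"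
    using ev by (auto simp: eventually_at dist_real_def)
  define t where "t i = d / real (i + 2)" for i
  have t: "t i \<noteq> 0" "\<bar>t i\<bar> < d" for i using d(1) by (auto simp: t_def field_simps add_pos_nonneg)
  have t0: "t \<longlonglongrightarrow> 0" unfolding t_def by (rule LIMSEQ_ignore_initial_segment[OF lim_const_over_n])
  have "\<exists>a h. a \<in> {0..2 * pi} \<and> h \<in> sphere 0 1 \<and> c (t i) = rmul (?E a u) h" for i
  proof -
    obtain a h where ah: "h \<bullet> h = 1" "c (t i) = rmul (?E a u) h" using P d(2) t by blast
    define a' where "a' = a + 2 * pi * of_int (- \<lfloor>a / (2 * pi)\<rfloor>)"
    have "0 \<le> a / (2 * pi) - of_int \<lfloor>a / (2 * pi)\<rfloor>" "a / (2 * pi) - of_int \<lfloor>a / (2 * pi)\<rfloor> \<le> 1"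
      by linarith+
    moreover have "a' = (2 * pi) * (a / (2 * pi) - of_int \<lfloor>a / (2 * pi)\<rfloor>)"
      by (simp add: a'_def right_diff_distrib)
    ultimately have "a' \<in> {0..2 * pi}"
      using mult_left_mono[of "a / (2 * pi) - of_int \<lfloor>a / (2 * pi)\<rfloor>" 1 "2 * pi"] by simp
    moreover have "?E a' u = ?E a u" unfolding a'_def by (rule circle_periodic)
    ultimately show ?thesis using ah by (intro exI[of _ a'] exI[of _ h]) (auto simp: norm_eq_sqrt_inner)
  qed
  then obtain a h where ah: "\<And>i. a i \<in> {0..2 * pi}" "\<And>i. h i \<in> sphere 0 1" "\<And>i. c (t i) = rmul (?E (a i) u) (h i)"
    by metis
  have mem: "\<forall>i. (a i, h i) \<in> {0..2 * pi} \<times> sphere 0 1" using ah(1,2) by blast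
  have "compact ({0..2 * pi} \<times> sphere (0::quat) 1)" by (intro compact_Times compact_Icc compact_sphere)
  then have "seq_compact ({0..2 * pi} \<times> sphere (0::quat) 1)" using compact_imp_seq_compact by blast
  then obtain l r where l: "l \<in> {0..2 * pi} \<times> sphere (0::quat) 1" and r: "strict_mono r"
    "(\<lambda>i. (a (r i), h (r i))) \<longlonglongrightarrow> l"
    using seq_compactE[of _ "\<lambda>i. (a i, h i)", OF _ mem] unfolding o_def by blast
  obtain a0 h0 where l0: "l = (a0, h0)" by (cases l)
  have lim: "(\<lambda>i. a (r i)) \<longlonglongrightarrow> a0" "(\<lambda>i. h (r i)) \<longlonglongrightarrow> h0"
    using tendsto_fst[OF r(2)] tendsto_snd[OF r(2)] by (simp_all add: l0)
  have h0: "h0 \<bullet> h0 = 1" using l by (simp add: l0 norm_eq_sqrt_inner)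
  have tr: "(\<lambda>i. t (r i)) \<longlonglongrightarrow> 0" using LIMSEQ_subseq_LIMSEQ[OF t0 r(1)] by (simp add: o_def)
  have "isCont (\<lambda>a. ?E a u) x" for x
    using circle_has_vector_derivative[of "real m" "real n" u x]
    by (rule has_vector_derivative_continuous)
  then have "(\<lambda>i. rmul (?E (a (r i)) u) (h (r i))) \<longlonglongrightarrow> rmul (?E a0 u) h0"
    by (intro rmul.tendsto lim isCont_tendsto_compose[OF _ lim(1)])
  moreover have "(\<lambda>i. c (t (r i))) \<longlonglongrightarrow> u" using isCont_tendsto_compose[OF c(1) tr] c(2) by simp
  ultimately have "rmul (?E a0 u) h0 = u" using ah(3) LIMSEQ_unique by fastforce
  \<comment> \<open>The limit \<open>(a0, h0)\<close> fixes \<open>u\<close> but need not be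
    trivial, because of isotropy. Dividing by it leaves parameters tending to the identity.\<close>
  then have E0: "?E a0 u = rmul u (qcnj h0)" using rmul_qcnj_cancel(1)[OF h0, of "?E a0 u"] by simp
  show thesis
  proof (rule that)
    show "t (r i) \<noteq> 0" for i by (rule t)
    show "(\<lambda>i. a (r i) - a0) \<longlonglongrightarrow> 0" using lim(1) by (simp add: LIM_zero)
    have "(\<lambda>i. qcnj h0 \<cdot>\<^sub>q h (r i)) \<longlonglongrightarrow> qcnj h0 \<cdot>\<^sub>q h0" by (intro qmult.tendsto tendsto_const lim)
    then show "(\<lambda>i. qcnj h0 \<cdot>\<^sub>q h (r i)) \<longlonglongrightarrow> qone" by (simp add: qcnj_qmult_self h0)
    show "c (t (r i)) = rmul (?E (a (r i) - a0) u) (qcnj h0 \<cdot>\<^sub>q h (r i))" for i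
    proof -
      have "?E (a (r i)) u = ?E (a (r i) - a0) (?E a0 u)" by (simp add: circle_add[symmetric])
      then show ?thesis by (simp add: ah(3) E0 circle_rmul rmul_rmul qmult_assoc)
    qed
  qed (rule tr)
qed

text \<open>Only ratios are controlled. Pairing the curve with \<open>X u\<close> forces
  \<open>\<delta> i / t i\<close> to converge; pairing it with \<open>N\<close> then gives that
  limit times \<open>N \<bullet> X u\<close>, which is 0. The quaternions \<open>k i\<close> need no
  rate of convergence, since both test vectors are quaternionically orthogonal to
  \<open>u\<close>.\<close>

lemma orbit_tangent_normal:
  fixes u :: quat3 and m n :: nat
  defines "X \<equiv> killing (real m) (real n)"
  assumes Xu: "X u \<noteq> 0" and moment: "hprod u (X u) = 0"
    and c: "(c has_vector_derivative \<xi>) (at 0)" "c 0 = u" and ev: "eventually P (at (0::real))"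
    and P: "\<And>t. P t \<Longrightarrow> \<exists>a h. h \<bullet> h = 1 \<and> c t = rmul (circle (real m) (real n) a u) h"
    and N: "hprod u N = 0" "hprod (X u) N = 0"
  shows "N \<bullet> \<xi> = 0"
proof -
  let ?E = "circle (real m) (real n)"
  obtain t \<delta> k where t: "\<And>i. t i \<noteq> 0" "t \<longlonglongrightarrow> 0" and \<delta>: "\<delta> \<longlonglongrightarrow> 0" and k: "k \<longlonglongrightarrow> qone"
    and ct: "\<And>i. c (t i) = rmul (?E (\<delta> i) u) (k i)"
    using orbit_parameters[OF has_vector_derivative_continuous[OF c(1)] c(2) ev P] by blast
  define D where "D d = (if d = 0 then X (?E 0 u) else (?E (0 + d) u - ?E 0 u) /\<^sub>R d)" for d
  have "isCont D 0"
    unfolding D_def[abs_def] X_def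
    by (rule has_vector_derivative_quotient[OF circle_has_vector_derivative[of "real m" "real n" u 0]])
  then have D: "(\<lambda>i. D (\<delta> i)) \<longlonglongrightarrow> X u"
    using isCont_tendsto_compose[OF _ \<delta>] by (fastforce simp: D_def)
  have ED: "?E d u = u + d *\<^sub>R D d" for d by (simp add: D_def)
  have "qcnj qone = qone" by (simp add: qone_def)
  moreover have "(\<lambda>i. qcnj (k i)) \<longlonglongrightarrow> qcnj qone"
    using bounded_linear.tendsto[OF linear_qcnj[unfolded linear_conv_bounded_linear] k] .
  ultimately have k': "(\<lambda>i. qcnj (k i)) \<longlonglongrightarrow> qone" by simp
  have lim: "(\<lambda>i. rmul w (qcnj (k i)) \<bullet> D (\<delta> i)) \<longlonglongrightarrow> w \<bullet> X u" for w
  proof -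
    have "(\<lambda>i. rmul w (qcnj (k i)) \<bullet> D (\<delta> i)) \<longlonglongrightarrow> rmul w qone \<bullet> X u"
      by (intro tendsto_inner rmul.tendsto tendsto_const k' D)
    then show ?thesis by simp
  qed
  have quot: "(\<lambda>i. (c (t i) - u) /\<^sub>R t i) \<longlonglongrightarrow> \<xi>"
  proof -
    have "(\<lambda>i. if t i = 0 then \<xi> else (c (0 + t i) - c 0) /\<^sub>R t i) \<longlonglongrightarrow> (if 0 = (0::real) then \<xi> else (c (0 + 0) - c 0) /\<^sub>R 0)"
      by (rule isCont_tendsto_compose[OF has_vector_derivative_quotient[OF c(1)] t(2)])
    then show ?thesis using t(1) by (simp add: c(2))
  qed
  \<comment> \<open>The factor \<open>k i\<close> is moved to the test vector by adjointness, where
    it does not disturb orthogonality to \<open>u\<close>; only the circle increment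
    survives.\<close>
  have key: "(\<lambda>i. (\<delta> i / t i) * (rmul w (qcnj (k i)) \<bullet> D (\<delta> i))) \<longlonglongrightarrow> w \<bullet> \<xi>" if w: "hprod w u = 0" for w
  proof -
    have "w \<bullet> c (t i) = \<delta> i * (rmul w (qcnj (k i)) \<bullet> D (\<delta> i))" for i
    proof -
      have "w \<bullet> c (t i) = rmul w (qcnj (k i)) \<bullet> ?E (\<delta> i) u"
        using inner_rmul_adjoint[of "?E (\<delta> i) u" "k i" w] by (simp add: ct inner_commute)
      moreover have "rmul w (qcnj (k i)) \<bullet> u = 0" by (simp add: inner_rmul w)
      ultimately show ?thesis by (simp add: ED inner_add_right)
    qed
    moreover have "w \<bullet> u = 0" using fst_hprod[of w u] w by simp
    ultimately have "w \<bullet> ((c (t i) - u) /\<^sub>R t i) = (\<delta> i / t i) * (rmul w (qcnj (k i)) \<bullet> D (\<delta> i))" for i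
      by (simp add: inner_diff_right divide_inverse mult.commute)
    then show ?thesis using tendsto_inner[OF tendsto_const[of w] quot] by simp
  qed
  have Xuu: "hprod (X u) u = 0" using hprod_killing[of "real m" "real n" u u] moment by (simp add: X_def)
  \<comment> \<open>The choice \<open>w = X u\<close> has a nonzero limit in the second factor, so
    the ratio can be solved for.\<close>
  have "(\<lambda>i. ((\<delta> i / t i) * (rmul (X u) (qcnj (k i)) \<bullet> D (\<delta> i))) / (rmul (X u) (qcnj (k i)) \<bullet> D (\<delta> i)))
      \<longlonglongrightarrow> (X u \<bullet> \<xi>) / (X u \<bullet> X u)"
    using Xu by (intro tendsto_divide key[OF Xuu] lim) simp
  moreover have "\<forall>\<^sub>F i in sequentially. rmul (X u) (qcnj (k i)) \<bullet> D (\<delta> i) > 0"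
    using Xu by (intro order_tendstoD(1)[OF lim]) simp
  then have "\<forall>\<^sub>F i in sequentially. ((\<delta> i / t i) * (rmul (X u) (qcnj (k i)) \<bullet> D (\<delta> i))) / (rmul (X u) (qcnj (k i)) \<bullet> D (\<delta> i)) = \<delta> i / t i"
    by eventually_elim simp
  ultimately have "(\<lambda>i. \<delta> i / t i) \<longlonglongrightarrow> (X u \<bullet> \<xi>) / (X u \<bullet> X u)"
    by (rule Lim_transform_eventually)
  then have "(\<lambda>i. (\<delta> i / t i) * (rmul N (qcnj (k i)) \<bullet> D (\<delta> i))) \<longlonglongrightarrow> (X u \<bullet> \<xi>) / (X u \<bullet> X u) * (N \<bullet> X u)"
    by (intro tendsto_mult lim)
  moreover have "N \<bullet> X u = 0" using fst_hprod[of "X u" N] N by (simp add: inner_commute)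
  moreover have "hprod N u = 0" using hprod_commute[of N u] N by (simp add: qcnj_linear_simps)
  ultimately show ?thesis using key[of N] LIMSEQ_unique by fastforce
qed

text \<open>The remainder \<open>N\<close> of \<open>\<xi>\<close> after both projections is
  orthogonal to \<open>\<xi>\<close> by the preceding lemma and to the projections by construction,
  hence to itself. The condition on \<open>snd\<close> makes the second projection a real multiple
  of \<open>X u\<close>.\<close>

lemma orbit_tangent:
  fixes u :: quat3 and m n :: nat
  defines "X \<equiv> killing (real m) (real n)"
  assumes u: "u \<bullet> u = 1" and Xu: "X u \<noteq> 0" and moment: "hprod u (X u) = 0"
    and c: "(c has_vector_derivative \<xi>) (at 0)" "c 0 = u" and ev: "eventually P (at (0::real))"
    and P: "\<And>t. P t \<Longrightarrow> \<exists>a h. h \<bullet> h = 1 \<and> c t = rmul (circle (real m) (real n) a u) h"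
    and \<xi>: "snd (hprod (X u) \<xi>) = 0"
  shows "\<xi> = rmul u (hprod u \<xi>) + ((X u \<bullet> \<xi>) / (X u \<bullet> X u)) *\<^sub>R X u"
proof -
  have "hprod (X u) \<xi> = (X u \<bullet> \<xi>) *\<^sub>R qone"
    using \<xi> fst_hprod[of "X u" \<xi>] by (cases "hprod (X u) \<xi>") (simp add: qone_def zero_prod_def)
  then have Xr: "rmul (X u) (hprod (X u) \<xi>) = (X u \<bullet> \<xi>) *\<^sub>R X u" by (simp add: rmul.scaleR_right)
  define N where "N = \<xi> - rmul u (hprod u \<xi>) - rmul (X u) (hprod (X u) \<xi> /\<^sub>R (X u \<bullet> X u))"
  have m': "hprod (X u) u = 0" using hprod_killing[of "real m" "real n" u u] moment by (simp add: X_def)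
  have N: "hprod u N = 0" "hprod (X u) N = 0"
    using Xu u by (simp_all add: N_def hprod.diff_right hprod_rmul hprod_self moment m' qmult.zero_left qmult.scaleR_left)
  have "N \<bullet> \<xi> = 0"
    using orbit_tangent_normal[of m n u c \<xi> P N] Xu moment c ev P N unfolding X_def by blast
  moreover have "N \<bullet> rmul w h = h \<bullet> hprod w N" for w h by (simp add: inner_commute[of N] inner_rmul)
  ultimately have "N \<bullet> N = 0"
    by (subst (2) N_def) (simp add: inner_diff_right N)
  then have "\<xi> = rmul u (hprod u \<xi>) + rmul (X u) (hprod (X u) \<xi> /\<^sub>R (X u \<bullet> X u))"
    unfolding inner_eq_zero_iff N_def diff_diff_eq right_minus_eq .
  then show ?thesis by (simp only: rmul.scaleR_right Xr scaleR_scaleR divide_inverse_commute)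
qed

section \<open>Charts of the sphere\<close>

lemma hp_class_eq: "hp_class u = {rmul u h | h. h \<bullet> h = 1}"
  by (cases u rule: prod_cases3) (simp add: hp_class_def norm_eq_sqrt_inner)

lemma mem_hp_class: "u \<in> hp_class u"
proof -
  have "qone \<bullet> qone = 1" by (simp add: qone_def)
  then show ?thesis unfolding hp_class_eq using rmul_qone[of u] by (metis (mono_tags, lifting) mem_Collect_eq)
qed

lemma hp_class_rmul:
  assumes k: "k \<bullet> k = 1" shows "hp_class (rmul u k) = hp_class u"
proof
  have unit: "(a \<cdot>\<^sub>q b) \<bullet> (a \<cdot>\<^sub>q b) = 1" if "a \<bullet> a = 1" "b \<bullet> b = 1" for a b :: quat
    using inner_qmult_qmult[of a b b] that by simp
  show "hp_class (rmul u k) \<subseteq> hp_class u"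
  proof
    fix w assume "w \<in> hp_class (rmul u k)"
    then obtain h where h: "h \<bullet> h = 1" "w = rmul u (k \<cdot>\<^sub>q h)" unfolding hp_class_eq rmul_rmul by blast
    then show "w \<in> hp_class u" unfolding hp_class_eq using unit[OF k h(1)] by blast
  qed
  show "hp_class u \<subseteq> hp_class (rmul u k)"
  proof
    fix w assume "w \<in> hp_class u"
    then obtain h where h: "h \<bullet> h = 1" "w = rmul u h" unfolding hp_class_eq by blast
    have "w = rmul (rmul u k) (qcnj k \<cdot>\<^sub>q h)"
      by (simp add: h rmul_rmul qmult_assoc[symmetric] qcnj_qmult_self k)
    moreover have "(qcnj k \<cdot>\<^sub>q h) \<bullet> (qcnj k \<cdot>\<^sub>q h) = 1" by (rule unit) (simp_all add: k h)
    ultimately show "w \<in> hp_class (rmul u k)" unfolding hp_class_eq by blast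
  qed
qed

lemma hp_class_eqD: "hp_class u = hp_class w \<Longrightarrow> \<exists>h. h \<bullet> h = 1 \<and> u = rmul w h"
  using mem_hp_class[of u] unfolding hp_class_eq[of w] by auto

lemma S11_chartD:
  assumes "(U, \<phi>, h) \<in> S11"
  shows "open U" "smooth_on U \<phi>" "\<And>y. y \<in> U \<Longrightarrow> inj (frechet_derivative \<phi> (at y))"
    "\<And>y v w. y \<in> U \<Longrightarrow> h y v w = dd \<phi> v y \<bullet> dd \<phi> w y" "\<And>y. y \<in> U \<Longrightarrow> \<phi> y \<bullet> \<phi> y = 1"
proof -
  have *: "open U" "\<phi> ` U \<subseteq> sphere 0 1" "riemannian_immersion_on U h \<phi> (\<lambda>x. inner)"
    using assms unfolding S11_def submanifold_atlas_def euclidean_atlas_def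
    by (auto simp: o_def)
  then show "open U" "smooth_on U \<phi>" "\<And>y. y \<in> U \<Longrightarrow> inj (frechet_derivative \<phi> (at y))"
    "\<And>y v w. y \<in> U \<Longrightarrow> h y v w = dd \<phi> v y \<bullet> dd \<phi> w y"
    unfolding riemannian_immersion_on_def by blast+
  show "\<phi> y \<bullet> \<phi> y = 1" if "y \<in> U" for y
  proof -
    have "norm (\<phi> y) = 1" using *(2) that by auto
    then show ?thesis by (simp add: norm_eq_sqrt_inner)
  qed
qed

lemma curve_compose:
  assumes "(c has_vector_derivative v) (at t)" "G differentiable (at (c t))"
  shows "((\<lambda>t. G (c t)) has_vector_derivative dd G v (c t)) (at t)"
proof -
  note G = differentiable_at_has_derivative[OF assms(2)]
  have "((\<lambda>t. G (c t)) has_derivative (\<lambda>s. dd G (s *\<^sub>R v) (c t))) (at t)"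
    using diff_chain_at[OF assms(1)[unfolded has_vector_derivative_def] G] by (simp add: o_def)
  then show ?thesis
    unfolding has_vector_derivative_def by (simp add: linear_scale[OF has_derivative_linear[OF G]])
qed

text \<open>\<open>(z, r) \<mapsto> (1 + r) \<phi> z\<close> extends the chart to a local diffeomorphism of the ambient space, so the chart
  has a smooth local inverse.\<close>

lemma sphere_chart_inverse:
  fixes \<phi> :: "real^11 \<Rightarrow> quat3"
  assumes U: "open U" and \<phi>: "smooth_on U \<phi>" and z: "z \<in> U" and inj: "inj (frechet_derivative \<phi> (at z))"
    and sphere: "\<And>y. y \<in> U \<Longrightarrow> \<phi> y \<bullet> \<phi> y = 1"
  obtains V P where "open V" "\<phi> z \<in> V" "smooth_on V P" "P ` V \<subseteq> U" "P (\<phi> z) = z"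
    "\<And>w. w \<in> V \<Longrightarrow> w \<bullet> w = 1 \<Longrightarrow> \<phi> (P w) = w"
proof -
  \<comment> \<open>The factor \<open>1 + r\<close> stays positive here, so a point of unit length
    can only have \<open>r = 0\<close>.\<close>
  define \<Omega> :: "((real^11) \<times> real) set" where "\<Omega> = U \<times> {-1<..}"
  define \<Psi> where "\<Psi> x = (1 + snd x) *\<^sub>R \<phi> (fst x)" for x :: "(real^11) \<times> real"
  have \<Omega>: "open \<Omega>" unfolding \<Omega>_def by (intro open_Times U) simp
  have fst: "smooth_on \<Omega> fst" using smooth_on_bounded_linear[OF bounded_linear_fst \<Omega> smooth_on_id[OF \<Omega>]] .
  have snd: "smooth_on \<Omega> snd" using smooth_on_bounded_linear[OF bounded_linear_snd \<Omega> smooth_on_id[OF \<Omega>]] .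
  have \<phi>fst: "smooth_on \<Omega> (\<lambda>x. \<phi> (fst x))"
    by (rule smooth_on_compose[OF \<Omega> U _ \<phi> fst]) (auto simp: \<Omega>_def)
  have \<Psi>: "smooth_on \<Omega> \<Psi>" unfolding \<Psi>_def[abs_def]
    by (intro smooth_on_bilinear[OF bounded_bilinear_scaleR \<Omega>] smooth_on_add \<Omega> smooth_on_const snd \<phi>fst)
  have z0: "(z, 0) \<in> \<Omega>" using z by (simp add: \<Omega>_def)
  have d\<phi>: "(\<phi> has_derivative frechet_derivative \<phi> (at z)) (at z)"
    by (rule smooth_on_has_derivative[OF \<phi> U z])
  have "((\<lambda>x. \<phi> (fst x)) has_derivative (\<lambda>v. dd \<phi> (fst v) z)) (at (z, 0 :: real))"
    using diff_chain_at[OF has_derivative_fst[OF has_derivative_ident], of \<phi> _ "(z, 0)"] d\<phi> by (simp add: o_def)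
  then have "(\<Psi> has_derivative (\<lambda>v. (1 + snd (z, 0::real)) *\<^sub>R dd \<phi> (fst v) z + snd v *\<^sub>R \<phi> (fst (z, 0 :: real)))) (at (z, 0))"
    unfolding \<Psi>_def[abs_def]
    by (intro has_derivative_scaleR) (auto intro!: derivative_eq_intros)
  then have d\<Psi>: "dd \<Psi> v (z, 0) = dd \<phi> (fst v) z + snd v *\<^sub>R \<phi> z" for v
    by (subst dd_eqI) auto
  have lin: "linear (frechet_derivative \<Psi> (at (z, 0)))"
    by (rule linear_frechet_derivative[OF smooth_on_differentiable[OF \<Psi> \<Omega> z0]])
  have "inj (frechet_derivative \<Psi> (at (z, 0)))"
  proof (subst linear_injective_0[OF lin], intro allI impI)
    fix v assume "dd \<Psi> v (z, 0) = 0"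
    then have e: "dd \<phi> (fst v) z + snd v *\<^sub>R \<phi> z = 0" by (simp add: d\<Psi>)
    then have "\<phi> z \<bullet> (dd \<phi> (fst v) z + snd v *\<^sub>R \<phi> z) = 0" by simp
    then have "snd v = 0"
      using sphere_tangent[OF U \<phi> z sphere] sphere[OF z] by (simp add: inner_add_right)
    moreover from this e have "fst v = 0"
      using linear_injective_0[OF has_derivative_linear[OF d\<phi>]] inj by auto
    ultimately show "v = 0" by (simp add: prod_eq_iff)
  qed
  then obtain L where L: "linear L" "\<And>v. dd \<Psi> (L v) (z, 0) = v"
    using linear_injective_isomorphism[OF lin] by auto
  obtain V \<tau> where V: "open V" "\<Psi> (z, 0) \<in> V" "smooth_on V \<tau>" "\<tau> ` V \<subseteq> \<Omega>"
    and \<tau>: "\<And>x. x \<in> V \<Longrightarrow> \<Psi> (\<tau> x) = x" "\<tau> (\<Psi> (z, 0)) = (z, 0)"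
    using smooth_local_section[OF \<Omega> \<Psi> z0 L] by metis
  have \<Psi>z: "\<Psi> (z, 0) = \<phi> z" by (simp add: \<Psi>_def)
  show thesis
  proof (rule that[of V "\<lambda>w. fst (\<tau> w)"])
    show "smooth_on V (\<lambda>w. fst (\<tau> w))" by (rule smooth_on_bounded_linear[OF bounded_linear_fst V(1,3)])
    show "(\<lambda>w. fst (\<tau> w)) ` V \<subseteq> U" using V(4) by (auto simp: \<Omega>_def)
    show "\<phi> (fst (\<tau> w)) = w" if w: "w \<in> V" "w \<bullet> w = 1" for w
    proof -
      define r where "r = 1 + snd (\<tau> w)"
      have r: "r > 0" and fU: "fst (\<tau> w) \<in> U" using V(4) w(1) by (auto simp: \<Omega>_def r_def)
      have e: "r *\<^sub>R \<phi> (fst (\<tau> w)) = w" using \<tau>(1)[OF w(1)] by (simp add: \<Psi>_def r_def)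
      have "(r *\<^sub>R \<phi> (fst (\<tau> w))) \<bullet> (r *\<^sub>R \<phi> (fst (\<tau> w))) = 1" unfolding e by (rule w(2))
      then have "r * r = 1" by (simp add: sphere[OF fU])
      then have "r = 1" using r by (simp add: square_eq_1_iff)
      then show ?thesis using e by simp
    qed
  qed (use V \<tau> \<Psi>z in auto)
qed

text \<open>\<open>K h\<close> is the coordinate vector of the fibre direction
  \<open>rmul (\<phi> z) h\<close>, obtained by pulling a curve in the fibre back through the local
  inverse of the chart. A map constant on fibres is constant along that curve, so its derivative
  kills \<open>K h\<close>.\<close>

lemma vertical_lift:
  fixes \<phi> :: "real^11 \<Rightarrow> quat3"
  assumes U: "open U" and \<phi>: "smooth_on U \<phi>" and z: "z \<in> U" and inj: "inj (frechet_derivative \<phi> (at z))"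
    and sphere: "\<And>y. y \<in> U \<Longrightarrow> \<phi> y \<bullet> \<phi> y = 1"
  obtains K where "linear K" "\<And>h. fst h = 0 \<Longrightarrow> dd \<phi> (K h) z = rmul (\<phi> z) h"
    "\<And>(F :: real^11 \<Rightarrow> 'b::real_normed_vector) h. fst h = 0 \<Longrightarrow> F differentiable (at z) \<Longrightarrow>
      (\<And>y. y \<in> U \<Longrightarrow> hp_class (\<phi> y) = hp_class (\<phi> z) \<Longrightarrow> F y = F z) \<Longrightarrow> dd F (K h) z = 0"
proof -
  obtain V P where V: "open V" "\<phi> z \<in> V" "smooth_on V P" "P ` V \<subseteq> U" "P (\<phi> z) = z"
    and P: "\<And>w. w \<in> V \<Longrightarrow> w \<bullet> w = 1 \<Longrightarrow> \<phi> (P w) = w"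
    using sphere_chart_inverse[OF U \<phi> z inj sphere] by blast
  define K where "K h = dd P (rmul (\<phi> z) h) (\<phi> z)" for h
  have Pdiff: "P differentiable (at (\<phi> z))" by (rule smooth_on_differentiable[OF V(3,1,2)])
  have K: "linear K"
    unfolding K_def[abs_def]
    by (rule linear_compose[OF bounded_linear.linear[OF rmul.bounded_linear_right] linear_frechet_derivative[OF Pdiff], unfolded o_def])
  have unit: "dd \<phi> (K h) z = rmul (\<phi> z) h \<and> (\<forall>F :: real^11 \<Rightarrow> 'b. F differentiable (at z) \<longrightarrow>
      (\<forall>y\<in>U. hp_class (\<phi> y) = hp_class (\<phi> z) \<longrightarrow> F y = F z) \<longrightarrow> dd F (K h) z = 0)"
    if h: "fst h = 0" "h \<bullet> h = 1" for h
  proof -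
    \<comment> \<open>For unit imaginary \<open>h\<close> this is a curve of unit quaternions with
      velocity \<open>h\<close> at 0; general \<open>h\<close> follow by scaling.\<close>
    define k where "k t = cos t *\<^sub>R qone + sin t *\<^sub>R h" for t
    have k1: "k t \<bullet> k t = 1" for t
    proof -
      have "qone \<bullet> h = 0" "qone \<bullet> qone = 1" using h(1) by (cases h; simp add: qone_def)+
      then have "k t \<bullet> k t = (cos t)\<^sup>2 + (sin t)\<^sup>2"
        by (simp add: k_def inner_add_left inner_add_right h(2) inner_commute[of h qone] power2_eq_square)
      then show ?thesis by simp
    qed
    define \<gamma> where "\<gamma> t = rmul (\<phi> z) (k t)" for t
    have "(k has_vector_derivative h) (at 0)"
      unfolding k_def[abs_def] by (auto intro!: derivative_eq_intros)
    then have d\<gamma>: "(\<gamma> has_vector_derivative rmul (\<phi> z) h) (at 0)"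
      unfolding \<gamma>_def[abs_def] by (rule bounded_linear.has_vector_derivative[OF rmul.bounded_linear_right])
    have \<gamma>0: "\<gamma> 0 = \<phi> z" by (simp add: \<gamma>_def k_def)
    have \<gamma>1: "\<gamma> t \<bullet> \<gamma> t = 1" for t by (simp add: \<gamma>_def inner_rmul_rmul k1 sphere[OF z])
    have "\<forall>\<^sub>F t in nhds 0. \<gamma> t \<in> V"
      using topological_tendstoD[OF has_vector_derivative_continuous[OF d\<gamma>, unfolded isCont_def tendsto_at_iff_tendsto_nhds] V(1)]
        V(2) \<gamma>0 by simp
    then obtain T where T: "open T" "0 \<in> T" "\<And>t. t \<in> T \<Longrightarrow> \<gamma> t \<in> V" unfolding eventually_nhds by blast
    have c: "((\<lambda>t. P (\<gamma> t)) has_vector_derivative K h) (at 0)"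
      using curve_compose[OF d\<gamma>, of P] Pdiff by (simp add: \<gamma>0 K_def)
    have c0: "P (\<gamma> 0) = z" by (simp add: \<gamma>0 V)
    have "((\<lambda>t. \<phi> (P (\<gamma> t))) has_vector_derivative dd \<phi> (K h) z) (at 0)"
      using curve_compose[OF c, of \<phi>] smooth_on_differentiable[OF \<phi> U z] by (simp add: c0)
    then have "(\<gamma> has_vector_derivative dd \<phi> (K h) z) (at 0)"
      by (rule has_vector_derivative_transform_within_open[OF _ T(1,2)]) (simp add: P T \<gamma>1)
    then have 1: "dd \<phi> (K h) z = rmul (\<phi> z) h"
      using d\<gamma> vector_derivative_unique_at by blast
    have "dd F (K h) z = 0" if F: "F differentiable (at z)"
      and const: "\<forall>y\<in>U. hp_class (\<phi> y) = hp_class (\<phi> z) \<longrightarrow> F y = F z" for F :: "real^11 \<Rightarrow> 'b"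
    proof -
      have "((\<lambda>t. F (P (\<gamma> t))) has_vector_derivative dd F (K h) z) (at 0)"
        using curve_compose[OF c, of F] F by (simp add: c0)
      then have "((\<lambda>t. F z) has_vector_derivative dd F (K h) z) (at 0)"
      proof (rule has_vector_derivative_transform_within_open[OF _ T(1,2)])
        fix t assume t: "t \<in> T"
        then have "\<phi> (P (\<gamma> t)) = \<gamma> t" "P (\<gamma> t) \<in> U" using P T(3) \<gamma>1 V(4) by auto
        then show "F (P (\<gamma> t)) = F z"
          using const by (simp add: \<gamma>_def hp_class_rmul k1)
      qed
      then show ?thesis using vector_derivative_unique_at has_vector_derivative_const by blast
    qed
    with 1 show ?thesis by blast
  qed
  have gen: "\<exists>r h1. h = r *\<^sub>R h1 \<and> fst h1 = 0 \<and> h1 \<bullet> h1 = 1" if "fst h = 0" for h :: quat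
  proof (cases "h = 0")
    case True
    show ?thesis by (rule exI[of _ 0], rule exI[of _ "(0, 1, 0, 0)"]) (simp add: True zero_prod_def)
  next
    case False
    then show ?thesis using that
      by (intro exI[of _ "norm h"] exI[of _ "h /\<^sub>R norm h"])
        (simp add: power2_norm_eq_inner[symmetric] power2_eq_square)
  qed
  show thesis
  proof (rule that[OF K])
    fix h :: quat assume h: "fst h = 0"
    obtain r h1 where h1: "h = r *\<^sub>R h1" "fst h1 = 0" "h1 \<bullet> h1 = 1" using gen[OF h] by blast
    show "dd \<phi> (K h) z = rmul (\<phi> z) h"
      using unit[OF h1(2,3)] linear_scale[OF linear_frechet_derivative[OF smooth_on_differentiable[OF \<phi> U z]]]
      by (simp add: h1(1) linear_scale[OF K] rmul.scaleR_right)
    show "dd F (K h) z = 0" if F: "F differentiable (at z)"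
      and const: "\<And>y. y \<in> U \<Longrightarrow> hp_class (\<phi> y) = hp_class (\<phi> z) \<Longrightarrow> F y = F z" for F :: "real^11 \<Rightarrow> 'b"
      using unit[OF h1(2,3)] F const linear_scale[OF linear_frechet_derivative[OF F]]
      by (simp add: h1(1) linear_scale[OF K])
  qed
qed

text \<open>Dimension count 11 = 8 + 3: a right inverse of \<open>D\<close> and the lifts of
  imaginary quaternions, injective because \<open>E\<close> maps them to \<open>rmul u h\<close>,
  fill the coordinate space.\<close>

lemma vertical_lift_onto:
  fixes D :: "real^11 \<Rightarrow> real^8" and E :: "real^11 \<Rightarrow> quat3"
  assumes D: "linear D" "surj D" and E: "linear E" and K: "linear K" and u: "u \<bullet> u = 1"
    and EK: "\<And>h. fst h = 0 \<Longrightarrow> E (K h) = rmul u h" and DK: "\<And>h. fst h = 0 \<Longrightarrow> D (K h) = 0"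
    and w: "D w = 0"
  shows "\<exists>h. fst h = 0 \<and> w = K h"
proof -
  obtain R where R: "linear R" "\<And>y. D (R y) = y"
    using linear_surjective_right_inverse[OF D] by (auto simp: o_def id_def fun_eq_iff)
  define \<Theta> where "\<Theta> x = R (fst x) + K (0, snd x)" for x :: "(real^8) \<times> (real \<times> real \<times> real)"
  have lin: "linear \<Theta>"
  proof (rule linearI)
    fix x y :: "(real^8) \<times> (real \<times> real \<times> real)" and c :: real
    have "((0::real), snd x + snd y) = (0, snd x) + (0, snd y)" "((0::real), c *\<^sub>R snd x) = c *\<^sub>R (0, snd x)" by simp_all
    then show "\<Theta> (x + y) = \<Theta> x + \<Theta> y" "\<Theta> (c *\<^sub>R x) = c *\<^sub>R \<Theta> x"
      unfolding \<Theta>_def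
      by (simp_all add: linear_add[OF R(1)] linear_scale[OF R(1)] linear_add[OF K] linear_scale[OF K] scaleR_add_right
          del: add_Pair scaleR_Pair)
  qed
  have D\<Theta>: "D (\<Theta> x) = fst x" for x by (simp add: \<Theta>_def linear_add[OF D(1)] R DK)
  have "inj \<Theta>"
  proof (subst linear_injective_0[OF lin], intro allI impI)
    fix x assume 0: "\<Theta> x = 0"
    then have f: "fst x = 0" using D\<Theta>[of x] linear_0[OF D(1)] by simp
    then have "K (0, snd x) = 0" using 0 linear_0[OF R(1)] by (simp add: \<Theta>_def)
    then have "rmul u (0, snd x) = 0" using EK[of "(0, snd x)"] linear_0[OF E] by simp
    then have "(0, snd x) = (0 :: quat)"
      using inner_rmul_rmul[of u "(0, snd x)" "(0, snd x)"] u inner_eq_zero_iff[of "(0 :: real, snd x)"] by simp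
    then show "x = 0" using f by (simp add: prod_eq_iff)
  qed
  then have "surj \<Theta>" using linear_injective_imp_surjective[OF lin] by simp
  then obtain x where x: "w = \<Theta> x" by blast
  then have "fst x = 0" using D\<Theta>[of x] w by simp
  then have "w = K (0, snd x)" using linear_0[OF R(1)] by (simp add: x \<Theta>_def)
  then show ?thesis by (metis fst_conv)
qed

section \<open>From the atlases to a horizontal section\<close>

lemma inner_minus_vertical:
  assumes "u \<bullet> u = 1"
  shows "(a - rmul u (hprod u a)) \<bullet> (b - rmul u (hprod u b)) = a \<bullet> b - hprod u a \<bullet> hprod u b"
proof -
  have "rmul u h \<bullet> (b - rmul u (hprod u b)) = 0" for h
    using assms by (simp add: inner_rmul hprod.diff_right hprod_rmul hprod_self)
  moreover have "a \<bullet> rmul u (hprod u b) = hprod u a \<bullet> hprod u b" by (metis inner_rmul inner_commute)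
  ultimately show ?thesis by (simp add: inner_diff_left[of a] inner_diff_right[of a])
qed

text \<open>A local section of the Hopf fibration over an arbitrary chart, horizontal at
  \<open>y0\<close>. The charts prescribe the metric on horizontal vectors only, so the formula for
  all vectors requires subtracting vertical parts, and these are exactly the lifts of imaginary
  quaternions.\<close>

lemma HP2_lift:
  assumes chart: "(U, \<phi>, g) \<in> HP2" and y0: "y0 \<in> U"
  obtains V S where "open V" "y0 \<in> V" "V \<subseteq> U" "smooth_on V S"
    "\<And>y. y \<in> V \<Longrightarrow> S y \<bullet> S y = 1" "\<And>y. y \<in> V \<Longrightarrow> hp_class (S y) = \<phi> y"
    "\<And>y v w. y \<in> V \<Longrightarrow> g y v w = dd S v y \<bullet> dd S w y - hprod (S y) (dd S v y) \<bullet> hprod (S y) (dd S w y)"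
    "\<And>v. hprod (S y0) (dd S v y0) = 0"
proof -
  have \<phi>: "inj_on \<phi> U" "\<phi> ` U \<subseteq> hp_class ` points S11"
    and sub: "\<And>W \<psi> h. (W, \<psi>, h) \<in> S11 \<Longrightarrow>
      riemannian_submersion_on {x \<in> W. hp_class (\<psi> x) \<in> \<phi> ` U} h (inv_into U \<phi> \<circ> hp_class \<circ> \<psi>) g"
    using chart unfolding HP2_def quotient_atlas_def by blast+
  obtain u where u: "u \<in> points S11" "\<phi> y0 = hp_class u" using \<phi>(2) y0 by blast
  then obtain W \<psi> h z0 where W: "(W, \<psi>, h) \<in> S11" and z0W: "z0 \<in> W" and u0: "u = \<psi> z0"
    unfolding points_def by blast
  note \<psi> = S11_chartD[OF W]
  define D where "D = {x \<in> W. hp_class (\<psi> x) \<in> \<phi> ` U}"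
  define F where "F = inv_into U \<phi> \<circ> hp_class \<circ> \<psi>"
  have D: "open D" and F: "smooth_on D F" and surjF: "\<And>z. z \<in> D \<Longrightarrow> surj (frechet_derivative F (at z))"
    and iso: "\<And>z v w. z \<in> D \<Longrightarrow> v \<in> horizontal h F z \<Longrightarrow> w \<in> horizontal h F z \<Longrightarrow>
      g (F z) (dd F v z) (dd F w z) = h z v w"
    using sub[OF W] unfolding riemannian_submersion_on_def D_def[symmetric] F_def[symmetric] by blast+
  have DW: "z \<in> W" if "z \<in> D" for z using that by (simp add: D_def)
  have FU: "F z \<in> U" "\<phi> (F z) = hp_class (\<psi> z)" if "z \<in> D" for z
    using that unfolding D_def F_def by (auto simp: inv_into_into f_inv_into_f)
  have z0: "z0 \<in> D" and Fz0: "F z0 = y0"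
    using z0W u0 u(2)[symmetric] y0 \<phi>(1) by (auto simp: D_def F_def)
  have Fdiff: "F differentiable (at z)" if "z \<in> D" for z using smooth_on_differentiable[OF F D that] .
  have \<psi>diff: "\<psi> differentiable (at z)" if "z \<in> D" for z using smooth_on_differentiable[OF \<psi>(2,1) DW[OF that]] .
  note linF = linear_frechet_derivative[OF Fdiff] and lin\<psi> = linear_frechet_derivative[OF \<psi>diff]
  have imag: "fst (hprod (\<psi> z) (dd \<psi> v z)) = 0" if "z \<in> D" for z v
    using sphere_tangent[OF \<psi>(1,2) DW[OF that] \<psi>(5)] by (simp add: fst_hprod)
  have vertical: "\<exists>K. linear K \<and> (\<forall>k. fst k = 0 \<longrightarrow> dd \<psi> (K k) z = rmul (\<psi> z) k \<and> dd F (K k) z = 0)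
      \<and> (\<forall>v. dd F v z = 0 \<longrightarrow> (\<exists>k. fst k = 0 \<and> v = K k))" if z: "z \<in> D" for z
  proof -
    obtain K where K: "linear K" "\<And>k. fst k = 0 \<Longrightarrow> dd \<psi> (K k) z = rmul (\<psi> z) k"
      and KF: "\<And>(G :: real^11 \<Rightarrow> real^8) k. fst k = 0 \<Longrightarrow> G differentiable (at z) \<Longrightarrow>
        (\<And>y. y \<in> W \<Longrightarrow> hp_class (\<psi> y) = hp_class (\<psi> z) \<Longrightarrow> G y = G z) \<Longrightarrow> dd G (K k) z = 0"
      using vertical_lift[OF \<psi>(1,2) DW[OF z] \<psi>(3)[OF DW[OF z]] \<psi>(5), where 'b = "real^8"] by blast
    have FK: "dd F (K k) z = 0" if "fst k = 0" for k
      by (rule KF[OF that Fdiff[OF z]]) (simp add: F_def)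
    have "\<exists>k. fst k = 0 \<and> v = K k" if "dd F v z = 0" for v
      by (rule vertical_lift_onto[OF linF[OF z] surjF[OF z] lin\<psi>[OF z] K(1) \<psi>(5)[OF DW[OF z]] K(2) FK that])
    then show ?thesis using K FK by blast
  qed
  have metric: "g (F z) (dd F v z) (dd F w z) = dd \<psi> v z \<bullet> dd \<psi> w z - hprod (\<psi> z) (dd \<psi> v z) \<bullet> hprod (\<psi> z) (dd \<psi> w z)"
    if z: "z \<in> D" for z v w
  proof -
    obtain K where K: "linear K" "\<And>k. fst k = 0 \<Longrightarrow> dd \<psi> (K k) z = rmul (\<psi> z) k"
      "\<And>k. fst k = 0 \<Longrightarrow> dd F (K k) z = 0" "\<And>v. dd F v z = 0 \<Longrightarrow> \<exists>k. fst k = 0 \<and> v = K k"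
      using vertical[OF z] by blast
    \<comment> \<open>The horizontal part of \<open>v\<close>: the coefficient is imaginary by
      tangency to the sphere, hence in the range of the vertical lift.\<close>
    define H where "H v = v - K (hprod (\<psi> z) (dd \<psi> v z))" for v
    have H\<psi>: "dd \<psi> (H v) z = dd \<psi> v z - rmul (\<psi> z) (hprod (\<psi> z) (dd \<psi> v z))" for v
      by (simp add: H_def linear_diff[OF lin\<psi>[OF z]] K(2)[OF imag[OF z]])
    have HF: "dd F (H v) z = dd F v z" for v
      by (simp add: H_def linear_diff[OF linF[OF z]] K(3)[OF imag[OF z]])
    have u1: "\<psi> z \<bullet> \<psi> z = 1" by (rule \<psi>(5)[OF DW[OF z]])
    have "H v \<in> horizontal h F z" for v
      unfolding horizontal_def
    proof (intro CollectI allI impI)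
      fix w assume "dd F w z = 0"
      then obtain k where k: "fst k = 0" "w = K k" using K(4) by blast
      show "h z (H v) w = 0"
        unfolding \<psi>(4)[OF DW[OF z]] H\<psi> k(2) K(2)[OF k(1)]
        by (simp add: inner_commute[of _ "rmul (\<psi> z) k"] inner_rmul hprod.diff_right hprod_rmul hprod_self u1)
    qed
    then have "g (F z) (dd F v z) (dd F w z) = h z (H v) (H w)"
      using iso[OF z, of "H v" "H w"] by (simp add: HF)
    also have "\<dots> = dd \<psi> v z \<bullet> dd \<psi> w z - hprod (\<psi> z) (dd \<psi> v z) \<bullet> hprod (\<psi> z) (dd \<psi> w z)"
      unfolding \<psi>(4)[OF DW[OF z]] H\<psi> by (rule inner_minus_vertical[OF u1])
    finally show ?thesis .
  qed
  obtain K where K: "linear K" "\<And>k. fst k = 0 \<Longrightarrow> dd \<psi> (K k) z0 = rmul (\<psi> z0) k"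
    "\<And>k. fst k = 0 \<Longrightarrow> dd F (K k) z0 = 0"
    using vertical[OF z0] by blast
  obtain R where R: "linear R" "\<And>y. dd F (R y) z0 = y"
    using linear_surjective_right_inverse[OF linF[OF z0] surjF[OF z0]] by (auto simp: o_def id_def fun_eq_iff)
  \<comment> \<open>A right inverse of the derivative, corrected by vertical vectors to be
    horizontal; it becomes the derivative of the section at the base point.\<close>
  define L where "L v = R v - K (hprod (\<psi> z0) (dd \<psi> (R v) z0))" for v
  have "linear (\<lambda>v. hprod (\<psi> z0) (dd \<psi> (R v) z0))"
    by (rule linearI) (simp_all add: linear_add[OF R(1)] linear_scale[OF R(1)] linear_add[OF lin\<psi>[OF z0]]
        linear_scale[OF lin\<psi>[OF z0]] hprod.add_right hprod.scaleR_right)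
  then have L: "linear L"
    unfolding L_def[abs_def] by (intro linear_compose_sub R(1) linear_compose[OF _ K(1), unfolded o_def])
  have FL: "dd F (L v) z0 = v" for v
    by (simp add: L_def linear_diff[OF linF[OF z0]] R(2) K(3)[OF imag[OF z0]])
  obtain V \<tau> where V: "open V" "F z0 \<in> V" "smooth_on V \<tau>" "\<tau> ` V \<subseteq> D"
    and \<tau>: "\<And>x. x \<in> V \<Longrightarrow> F (\<tau> x) = x" "\<tau> (F z0) = z0" "\<And>v. dd \<tau> v (F z0) = L v"
    using smooth_local_section[OF D F z0 L FL] by metis
  have \<tau>D: "\<tau> y \<in> D" if "y \<in> V" for y using V(4) that by blast
  have \<tau>diff: "\<tau> differentiable (at y)" if "y \<in> V" for y using smooth_on_differentiable[OF V(3,1) that] .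
  define S where "S y = \<psi> (\<tau> y)" for y
  have dS: "dd S v y = dd \<psi> (dd \<tau> v y) (\<tau> y)" if "y \<in> V" for v y
    unfolding S_def[abs_def] by (rule dd_compose[OF \<tau>diff[OF that] \<psi>diff[OF \<tau>D[OF that]]])
  have dF\<tau>: "dd F (dd \<tau> v y) (\<tau> y) = v" if y: "y \<in> V" for v y
  proof -
    have "(\<lambda>y. F (\<tau> y)) differentiable (at y)"
      using differentiable_chain_at[OF \<tau>diff[OF y] Fdiff[OF \<tau>D[OF y]]] by (simp add: o_def)
    then have "dd (\<lambda>y. F (\<tau> y)) v y = dd (\<lambda>y. y) v y" by (rule dd_transform[OF _ V(1) y \<tau>(1)])
    then show ?thesis
      using dd_compose[OF \<tau>diff[OF y] Fdiff[OF \<tau>D[OF y]], of v] dd_eqI[OF has_derivative_ident, of v y] by simp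
  qed
  show thesis
  proof (rule that[of V S])
    show "open V" "y0 \<in> V" using V Fz0 by auto
    show "V \<subseteq> U"
    proof
      fix y assume "y \<in> V" then show "y \<in> U" using FU(1)[OF \<tau>D] \<tau>(1)[of y] by force
    qed
    show "smooth_on V S"
      unfolding S_def[abs_def] by (rule smooth_on_compose[OF V(1) \<psi>(1) _ \<psi>(2) V(3)]) (use \<tau>D DW in blast)
    fix y v w assume y: "y \<in> V"
    show "S y \<bullet> S y = 1" unfolding S_def by (rule \<psi>(5)[OF DW[OF \<tau>D[OF y]]])
    show "hp_class (S y) = \<phi> y" unfolding S_def using FU(2)[OF \<tau>D[OF y]] \<tau>(1)[OF y] by simp
    show "g y v w = dd S v y \<bullet> dd S w y - hprod (S y) (dd S v y) \<bullet> hprod (S y) (dd S w y)"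
      using metric[OF \<tau>D[OF y], of "dd \<tau> v y" "dd \<tau> w y"] by (simp add: \<tau>(1)[OF y] dF\<tau>[OF y] dS[OF y] S_def)
  next
    fix v
    have y0V: "y0 \<in> V" using V Fz0 by auto
    have "dd S v y0 = dd \<psi> (L v) z0" using dS[OF y0V, of v] \<tau>(2) \<tau>(3)[of v] by (simp add: Fz0)
    also have "\<dots> = dd \<psi> (R v) z0 - rmul (\<psi> z0) (hprod (\<psi> z0) (dd \<psi> (R v) z0))"
      by (simp add: L_def linear_diff[OF lin\<psi>[OF z0]] K(2)[OF imag[OF z0]])
    finally show "hprod (S y0) (dd S v y0) = 0"
      using \<tau>(2) \<psi>(5)[OF z0W] by (simp add: S_def Fz0 hprod.diff_right hprod_rmul hprod_self)
  qed
qed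

section \<open>The zero set of the moment map\<close>

lemma moment_rmul: "hprod (rmul u h) (killing \<alpha> \<beta> (rmul u h)) = qcnj h \<cdot>\<^sub>q (hprod u (killing \<alpha> \<beta> u) \<cdot>\<^sub>q h)"
  by (simp add: killing_rmul hprod_rmul hprod_rmul_left qmult_assoc)

text \<open>Membership provides some representative with vanishing moment; changing it by a unit
  quaternion only conjugates the moment.\<close>

lemma LH_set_moment:
  assumes "hp_class u \<in> LH_set p q"
  shows "hprod u (killing (real q) (real p) u) = 0"
proof -
  obtain u0 u1 u2 where u': "hp_class u = hp_class (u0, u1, u2)"
    and m: "real q *\<^sub>R (qcnj u0 \<cdot>\<^sub>q qj \<cdot>\<^sub>q u0) + real p *\<^sub>R (qcnj u1 \<cdot>\<^sub>q qj \<cdot>\<^sub>q u1)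
       + real p *\<^sub>R (qcnj u2 \<cdot>\<^sub>q qj \<cdot>\<^sub>q u2) = 0"
    using assms unfolding LH_set_def by blast
  have "hprod (u0, u1, u2) (killing (real q) (real p) (u0, u1, u2)) = 0"
    using m by (simp add: qmult.scaleR_right qmult_assoc)
  moreover obtain h where "u = rmul (u0, u1, u2) h" using hp_class_eqD[OF u'] by blast
  ultimately show ?thesis by (simp only: moment_rmul qmult.zero_left qmult.zero_right)
qed

text \<open>The lift of a chart of the projective plane is composed with the coordinate expression
  of the inclusion. Horizontality at the base point holds for all directions there and so passes to
  the submanifold.\<close>

lemma LH_lift:
  assumes chart: "(W, \<sigma>, h) \<in> LH p q" and w0: "w0 \<in> W"
  obtains V s where "open V" "w0 \<in> V" "V \<subseteq> W" "smooth_on V s"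
    "\<And>w. w \<in> V \<Longrightarrow> s w \<bullet> s w = 1" "\<And>w. w \<in> V \<Longrightarrow> hp_class (s w) = \<sigma> w"
    "\<And>w. w \<in> V \<Longrightarrow> hprod (s w) (killing (real q) (real p) (s w)) = 0"
    "\<And>w a b. w \<in> V \<Longrightarrow> h w a b = dd s a w \<bullet> dd s b w - hprod (s w) (dd s a w) \<bullet> hprod (s w) (dd s b w)"
    "\<And>a. hprod (s w0) (dd s a w0) = 0"
proof -
  have \<sigma>: "open W" "\<sigma> ` W \<subseteq> LH_set p q \<inter> points HP2"
    and imm: "\<And>U \<phi> g. (U, \<phi>, g) \<in> HP2 \<Longrightarrow> riemannian_immersion_on {y \<in> W. \<sigma> y \<in> \<phi> ` U} h (inv_into U \<phi> \<circ> \<sigma>) g"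
    using chart unfolding LH_def submanifold_atlas_def by blast+
  have "\<sigma> w0 \<in> points HP2" using \<sigma>(2) w0 by blast
  then obtain U \<phi> g y0 where U: "(U, \<phi>, g) \<in> HP2" and y0: "y0 \<in> U" "\<sigma> w0 = \<phi> y0"
    unfolding points_def by blast
  have inj: "inj_on \<phi> U" using U unfolding HP2_def quotient_atlas_def by blast
  define D where "D = {y \<in> W. \<sigma> y \<in> \<phi> ` U}"
  define f where "f = inv_into U \<phi> \<circ> \<sigma>"
  have D: "open D" and f: "smooth_on D f"
    and iso: "\<And>w a b. w \<in> D \<Longrightarrow> h w a b = g (f w) (dd f a w) (dd f b w)"
    using imm[OF U] unfolding riemannian_immersion_on_def D_def[symmetric] f_def[symmetric] by blast+
  have w0D: "w0 \<in> D" and fw0: "f w0 = y0" using w0 y0 inj by (auto simp: D_def f_def)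
  have f\<sigma>: "\<phi> (f w) = \<sigma> w" if "w \<in> D" for w using that unfolding D_def f_def by (auto simp: f_inv_into_f)
  obtain V8 S where V8: "open V8" "y0 \<in> V8" "V8 \<subseteq> U" "smooth_on V8 S"
    and S: "\<And>y. y \<in> V8 \<Longrightarrow> S y \<bullet> S y = 1" "\<And>y. y \<in> V8 \<Longrightarrow> hp_class (S y) = \<phi> y"
      "\<And>y v w. y \<in> V8 \<Longrightarrow> g y v w = dd S v y \<bullet> dd S w y - hprod (S y) (dd S v y) \<bullet> hprod (S y) (dd S w y)"
      "\<And>v. hprod (S y0) (dd S v y0) = 0"
    using HP2_lift[OF U y0(1)] by metis
  define V where "V = D \<inter> f -` V8"
  have V: "open V" unfolding V_def
    using continuous_open_preimage[OF smooth_on_continuous_on[OF f] D V8(1)] .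
  have VD: "w \<in> D" "f w \<in> V8" if "w \<in> V" for w using that by (auto simp: V_def)
  have fV: "smooth_on V f" by (rule smooth_on_subset[OF f]) (auto simp: V_def)
  define s where "s w = S (f w)" for w
  have ds: "dd s a w = dd S (dd f a w) (f w)" if "w \<in> V" for a w
    unfolding s_def[abs_def]
    by (rule dd_compose[OF smooth_on_differentiable[OF fV V that] smooth_on_differentiable[OF V8(4,1) VD(2)[OF that]]])
  show thesis
  proof (rule that[of V s])
    show "open V" by (rule V)
    show "w0 \<in> V" using w0D fw0 V8(2) by (simp add: V_def)
    then show "hprod (s w0) (dd s a w0) = 0" for a by (simp add: ds) (simp add: s_def fw0 S(4))
    show "V \<subseteq> W" by (auto simp: V_def D_def)
    show "smooth_on V s" unfolding s_def[abs_def]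
      by (rule smooth_on_compose[OF V V8(1) _ V8(4) fV]) (use VD in blast)
    fix w a b assume w: "w \<in> V"
    show "s w \<bullet> s w = 1" unfolding s_def by (rule S(1)[OF VD(2)[OF w]])
    show \<sigma>w: "hp_class (s w) = \<sigma> w" unfolding s_def using S(2)[OF VD(2)[OF w]] f\<sigma>[OF VD(1)[OF w]] by simp
    have "\<sigma> w \<in> LH_set p q" using \<sigma>(2) VD(1)[OF w] by (auto simp: D_def)
    then show "hprod (s w) (killing (real q) (real p) (s w)) = 0" using LH_set_moment \<sigma>w by metis
    show "h w a b = dd s a w \<bullet> dd s b w - hprod (s w) (dd s a w) \<bullet> hprod (s w) (dd s b w)"
      unfolding iso[OF VD(1)[OF w]] S(3)[OF VD(2)[OF w]] ds[OF w] s_def ..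
  qed
qed

section \<open>Fibres of the local quotient\<close>

lemma smooth_on_Pair:
  assumes "open U" "smooth_on U f" "smooth_on U g"
  shows "smooth_on U (\<lambda>x. (f x, g x))"
proof -
  have "smooth_on U (\<lambda>x. (f x, 0) + (0, g x))"
    by (intro smooth_on_add assms(1) smooth_on_bounded_linear[OF bounded_linear_Pair[OF bounded_linear_ident bounded_linear_zero]]
      smooth_on_bounded_linear[OF bounded_linear_Pair[OF bounded_linear_zero bounded_linear_ident]] assms)
  then show ?thesis by simp
qed

text \<open>A functional \<open>l\<close> with \<open>l \<kappa> = 1\<close> is adjoined to
  \<open>\<rho>\<close>. A local section of the pair, restricted to the points
  \<open>(\<rho> w, t)\<close>, is a curve in the fibre, and \<open>L (0, 1) = \<kappa>\<close>
  fixes its velocity.\<close>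

lemma fibre_curve:
  fixes \<rho> :: "'a::euclidean_space \<Rightarrow> 'b::euclidean_space"
  assumes W: "open W" and \<rho>: "smooth_on W \<rho>" and w: "w \<in> W" and surj: "surj (frechet_derivative \<rho> (at w))"
    and \<kappa>: "dd \<rho> \<kappa> w = 0" "\<kappa> \<noteq> 0"
  obtains c where "(c has_vector_derivative \<kappa>) (at 0)" "c 0 = w" "\<forall>\<^sub>F t in at 0. c t \<in> W \<and> \<rho> (c t) = \<rho> w"
proof -
  have d: "\<rho> differentiable (at w)" by (rule smooth_on_differentiable[OF \<rho> W w])
  note lin = linear_frechet_derivative[OF d]
  obtain R where R: "linear R" "\<And>y. dd \<rho> (R y) w = y"
    using linear_surjective_right_inverse[OF lin surj] by (auto simp: o_def id_def fun_eq_iff)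
  define l where "l v = (v \<bullet> \<kappa>) / (\<kappa> \<bullet> \<kappa>)" for v
  have l: "bounded_linear l" unfolding l_def[abs_def]
    by (rule bounded_linear_compose[OF bounded_linear_divide bounded_linear_inner_left, unfolded o_def])
  have l\<kappa>: "l \<kappa> = 1" using \<kappa> by (simp add: l_def)
  note llin = bounded_linear.linear[OF l]
  define \<Psi> where "\<Psi> x = (\<rho> x, l (x - w))" for x
  have \<Psi>: "smooth_on W \<Psi>" unfolding \<Psi>_def[abs_def]
    by (intro smooth_on_Pair W \<rho> smooth_on_bounded_linear[OF l] smooth_on_diff smooth_on_id smooth_on_const)
  define L where "L x = R (fst x) + (snd x - l (R (fst x))) *\<^sub>R \<kappa>" for x
  have L: "linear L"
    by (rule linearI) (simp_all add: L_def linear_add[OF R(1)] linear_scale[OF R(1)] linear_add[OF llin]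
        linear_scale[OF llin] algebra_simps)
  have "((\<lambda>x. l (x - w)) has_derivative (\<lambda>v. l (v - 0))) (at w)"
    by (intro bounded_linear.has_derivative[OF l] has_derivative_diff has_derivative_ident has_derivative_const)
  then have "(\<Psi> has_derivative (\<lambda>v. (dd \<rho> v w, l v))) (at w)"
    unfolding \<Psi>_def[abs_def] by (intro has_derivative_Pair differentiable_at_has_derivative[OF d]) simp
  then have d\<Psi>: "dd \<Psi> v w = (dd \<rho> v w, l v)" for v by (rule dd_eqI)
  have "dd \<Psi> (L x) w = x" for x
    by (simp add: d\<Psi> L_def linear_add[OF lin] linear_scale[OF lin] R(2) \<kappa>(1) linear_add[OF llin] linear_scale[OF llin] l\<kappa>)
  then obtain V \<tau> where V: "open V" "\<Psi> w \<in> V" "smooth_on V \<tau>" "\<tau> ` V \<subseteq> W"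
    and \<tau>: "\<And>x. x \<in> V \<Longrightarrow> \<Psi> (\<tau> x) = x" "\<tau> (\<Psi> w) = w" "\<And>v. dd \<tau> v (\<Psi> w) = L v"
    using smooth_local_section[OF W \<Psi> w L] by metis
  have \<Psi>w: "\<Psi> w = (\<rho> w, 0)" by (simp add: \<Psi>_def linear_0[OF llin])
  define \<gamma> where "\<gamma> t = (\<rho> w, t)" for t :: real
  have \<gamma>: "(\<gamma> has_vector_derivative (0, 1)) (at 0)" unfolding \<gamma>_def[abs_def]
    by (intro has_vector_derivative_Pair has_vector_derivative_const has_vector_derivative_id[unfolded id_def])
  show thesis
  proof (rule that[of "\<lambda>t. \<tau> (\<gamma> t)"])
    have "dd \<tau> (0, 1) (\<gamma> 0) = \<kappa>"
      using \<tau>(3)[of "(0, 1)"] by (simp add: \<gamma>_def \<Psi>w L_def linear_0[OF R(1)] linear_0[OF llin])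
    moreover have "\<tau> differentiable (at (\<gamma> 0))"
      using smooth_on_differentiable[OF V(3,1,2)] by (simp add: \<gamma>_def \<Psi>w)
    ultimately show "((\<lambda>t. \<tau> (\<gamma> t)) has_vector_derivative \<kappa>) (at 0)"
      using curve_compose[OF \<gamma>, of \<tau>] by simp
    show "\<tau> (\<gamma> 0) = w" using \<tau>(2) by (simp add: \<gamma>_def \<Psi>w)
    have "\<forall>\<^sub>F t in at 0. \<gamma> t \<in> V"
      using topological_tendstoD[OF has_vector_derivative_continuous[OF \<gamma>, unfolded isCont_def] V(1)] V(2)
      by (simp add: \<gamma>_def \<Psi>w)
    then show "\<forall>\<^sub>F t in at 0. \<tau> (\<gamma> t) \<in> W \<and> \<rho> (\<tau> (\<gamma> t)) = \<rho> w"
    proof eventually_elim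
      case (elim t)
      then show ?case using V(4) \<tau>(1)[OF elim] by (auto simp: \<gamma>_def \<Psi>_def)
    qed
  qed
qed

text \<open>A right inverse and a single kernel vector already fill the domain by dimension. This is
  used for dimensions 5 and 4, where it makes the fibres curves.\<close>

lemma one_dimensional_kernel:
  fixes D :: "'a::euclidean_space \<Rightarrow> 'b::euclidean_space"
  assumes D: "linear D" "surj D" and dim: "DIM('a) = DIM('b) + 1"
  obtains \<kappa> where "\<kappa> \<noteq> 0" "D \<kappa> = 0" "\<And>v. D v = 0 \<Longrightarrow> \<exists>t. v = t *\<^sub>R \<kappa>"
proof -
  obtain R where R: "linear R" "\<And>y. D (R y) = y"
    using linear_surjective_right_inverse[OF D] by (auto simp: o_def id_def fun_eq_iff)
  have "\<not> inj D"
  proof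
    assume "inj D"
    then have "R (D v) = v" for v by (metis R(2) injD)
    then have "range R = UNIV" by (metis surjI)
    then show False using dim_image_le[OF R(1), of UNIV] dim by simp
  qed
  then obtain \<kappa> where \<kappa>: "\<kappa> \<noteq> 0" "D \<kappa> = 0" using linear_injective_0[OF D(1)] by blast
  define \<Theta> where "\<Theta> x = R (fst x) + snd x *\<^sub>R \<kappa>" for x :: "'b \<times> real"
  have lin: "linear \<Theta>"
    by (rule linearI) (simp_all add: \<Theta>_def linear_add[OF R(1)] linear_scale[OF R(1)] algebra_simps)
  have D\<Theta>: "D (\<Theta> x) = fst x" for x by (simp add: \<Theta>_def linear_add[OF D(1)] linear_scale[OF D(1)] R(2) \<kappa>)
  have "inj \<Theta>"
  proof (subst linear_injective_0[OF lin], intro allI impI)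
    fix x assume 0: "\<Theta> x = 0"
    then have "fst x = 0" using D\<Theta>[of x] linear_0[OF D(1)] by simp
    moreover from this have "snd x = 0" using 0 \<kappa> by (simp add: \<Theta>_def linear_0[OF R(1)])
    ultimately show "x = 0" by (simp add: prod_eq_iff)
  qed
  then have "surj \<Theta>" using linear_injective_imp_surjective[OF lin] dim by simp
  show thesis
  proof (rule that[OF \<kappa>])
    fix v assume v: "D v = 0"
    obtain x where x: "v = \<Theta> x" using \<open>surj \<Theta>\<close> by blast
    then have "fst x = 0" using D\<Theta>[of x] v by simp
    then show "\<exists>t. v = t *\<^sub>R \<kappa>" by (auto simp: x \<Theta>_def linear_0[OF R(1)])
  qed
qed

lemma riemannian_metric_on_subset: "riemannian_metric_on U g \<Longrightarrow> V \<subseteq> U \<Longrightarrow> riemannian_metric_on V g"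
  unfolding riemannian_metric_on_def using smooth_on_subset by blast

lemma circle_action_eq: "circle_action p q t c = circle (real q) (real p) t ` c"
  unfolding circle_action_def by (rule image_cong) auto

lemma circle_orbit_eqD:
  assumes "circle_orbit p q (hp_class u') = circle_orbit p q (hp_class u)"
  shows "\<exists>a h. h \<bullet> h = 1 \<and> u' = rmul (circle (real q) (real p) a u) h"
proof -
  have "circle_action p q 0 (hp_class u') = hp_class u'" by (simp add: circle_action_eq)
  then have "hp_class u' \<in> circle_orbit p q (hp_class u')"
    unfolding circle_orbit_def using rangeI[of "\<lambda>t. circle_action p q t (hp_class u')" 0] by simp
  then have "hp_class u' \<in> circle_orbit p q (hp_class u)" unfolding assms .
  then obtain a where "hp_class u' = circle (real q) (real p) a ` hp_class u"
    unfolding circle_orbit_def circle_action_eq by blast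
  then have "u' \<in> circle (real q) (real p) a ` hp_class u" using mem_hp_class by blast
  then obtain h where "h \<bullet> h = 1" "u' = circle (real q) (real p) a (rmul u h)" unfolding hp_class_eq by blast
  then show ?thesis unfolding circle_rmul by blast
qed

text \<open>The section over a uniformizing chart is the lift of the zero set to the sphere composed
  with a section of the local quotient; the latter is prescribed at the base point to be orthogonal
  to the circle direction. Horizontality for the unit quaternions is inherited from the
  lift.\<close>

lemma galicki_lawson_horizontal_section:
  fixes p q :: nat
  assumes pq: "p > 0" "q > 0"
    and pinch: "real p ^ 2 < sqrt 2 * real q ^ 2" "sqrt 2 * real q ^ 2 < 2 * sqrt 2 * real p ^ 2"
    and chart: "(V, \<kappa>, g) \<in> galicki_lawson_orbifold p q" and x0: "x0 \<in> V"
  obtains V' s where "horizontal_section V' g (real q) (real p) s x0"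
proof -
  let ?X = "killing (real q) (real p)"
  obtain W \<sigma> h \<rho> where W: "(W, \<sigma>, h) \<in> LH p q" and \<rho>W: "\<rho> ` W = V" and orb: "\<And>x. x \<in> W \<Longrightarrow> \<kappa> (\<rho> x) = circle_orbit p q (\<sigma> x)"
    and sub: "riemannian_submersion_on W h \<rho> g" and gV: "riemannian_metric_on V g"
    using chart unfolding galicki_lawson_orbifold_def orbifold_quotient_atlas_def by blast
  obtain w0 where w0: "w0 \<in> W" "\<rho> w0 = x0" using \<rho>W x0 by blast
  have oW: "open W" and \<rho>: "smooth_on W \<rho>" and surj: "\<And>w. w \<in> W \<Longrightarrow> surj (frechet_derivative \<rho> (at w))"
    and iso: "\<And>w a b. w \<in> W \<Longrightarrow> a \<in> horizontal h \<rho> w \<Longrightarrow> b \<in> horizontal h \<rho> w \<Longrightarrow>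
      g (\<rho> w) (dd \<rho> a w) (dd \<rho> b w) = h w a b"
    using sub unfolding riemannian_submersion_on_def by blast+
  have hW: "riemannian_metric_on W h" using W unfolding LH_def submanifold_atlas_def by blast
  interpret h: riemannian_domain W h by unfold_locales (rule oW hW)+
  obtain A s where A: "open A" "w0 \<in> A" "A \<subseteq> W" "smooth_on A s"
    and s1: "\<And>w. w \<in> A \<Longrightarrow> s w \<bullet> s w = 1" and s\<sigma>: "\<And>w. w \<in> A \<Longrightarrow> hp_class (s w) = \<sigma> w"
    and moment: "\<And>w. w \<in> A \<Longrightarrow> hprod (s w) (?X (s w)) = 0"
    and hA: "\<And>w a b. w \<in> A \<Longrightarrow> h w a b = dd s a w \<bullet> dd s b w - hprod (s w) (dd s a w) \<bullet> hprod (s w) (dd s b w)"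
    and hor: "\<And>a. hprod (s w0) (dd s a w0) = 0"
    using LH_lift[OF W w0(1)] by metis
  have sdiff: "s differentiable (at w)" if "w \<in> A" for w using smooth_on_differentiable[OF A(4,1) that] .
  note lins = linear_frechet_derivative[OF sdiff]
  have AW: "w \<in> W" if "w \<in> A" for w using A(3) that by blast
  have \<rho>A: "smooth_on A \<rho>" by (rule smooth_on_subset[OF \<rho> A(3)])
  have \<rho>diff: "\<rho> differentiable (at w)" if "w \<in> A" for w using smooth_on_differentiable[OF \<rho>A A(1) that] .
  note lin\<rho> = linear_frechet_derivative[OF \<rho>diff]
  have Xs: "?X (s w) \<noteq> 0" if "w \<in> A" for w
    using killing_nonzero[of "real q" "real p" "s w"] pq s1[OF that] by (cases "s w = 0") auto
  have tangent: "snd (hprod (?X (s w)) (dd s a w)) = 0" if "w \<in> A" for w a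
    by (rule moment_tangent[OF A(1,4) that moment])
  \<comment> \<open>The kernel of the submersion is a line, and a curve in the fibre through it
    stays in an orbit, so the lifted kernel vector has only a component along the fibre of the Hopf
    map and one along the circle.\<close>
  have vertical: "\<exists>\<kappa> r. dd \<rho> \<kappa> w = 0 \<and> (\<forall>v. dd \<rho> v w = 0 \<longrightarrow> (\<exists>t. v = t *\<^sub>R \<kappa>)) \<and> r \<noteq> 0
      \<and> dd s \<kappa> w = rmul (s w) (hprod (s w) (dd s \<kappa> w)) + r *\<^sub>R ?X (s w)" if w: "w \<in> A" for w
  proof -
    obtain \<kappa>' where \<kappa>': "\<kappa>' \<noteq> 0" "dd \<rho> \<kappa>' w = 0" "\<And>v. dd \<rho> v w = 0 \<Longrightarrow> \<exists>t. v = t *\<^sub>R \<kappa>'"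
      using one_dimensional_kernel[OF lin\<rho>[OF w] surj[OF AW[OF w]]] by auto
    obtain c where c: "(c has_vector_derivative \<kappa>') (at 0)" "c 0 = w" "\<forall>\<^sub>F t in at 0. c t \<in> A \<and> \<rho> (c t) = \<rho> w"
      using fibre_curve[OF A(1) \<rho>A w surj[OF AW[OF w]] \<kappa>'(2,1)] by blast
    have sc: "((\<lambda>t. s (c t)) has_vector_derivative dd s \<kappa>' w) (at 0)"
      using curve_compose[OF c(1), of s] sdiff[OF w] by (simp add: c(2))
    have "\<exists>a h. h \<bullet> h = 1 \<and> s (c t) = rmul (circle (real q) (real p) a (s w)) h"
      if "c t \<in> A \<and> \<rho> (c t) = \<rho> w" for t
      using circle_orbit_eqD[of p q "s (c t)" "s w"] orb[OF AW[OF w]] orb[OF AW, of "c t"] s\<sigma>[OF w] s\<sigma>[of "c t"] that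
      by simp
    then have eq: "dd s \<kappa>' w = rmul (s w) (hprod (s w) (dd s \<kappa>' w))
      + ((?X (s w) \<bullet> dd s \<kappa>' w) / (?X (s w) \<bullet> ?X (s w))) *\<^sub>R ?X (s w)"
      using orbit_tangent[of "s w" q p "\<lambda>t. s (c t)" "dd s \<kappa>' w" "\<lambda>t. c t \<in> A \<and> \<rho> (c t) = \<rho> w"]
        s1[OF w] Xs[OF w] moment[OF w] sc c(2,3) tangent[OF w] by simp
    define r where "r = (?X (s w) \<bullet> dd s \<kappa>' w) / (?X (s w) \<bullet> ?X (s w))"
    \<comment> \<open>Otherwise a nonzero tangent vector of the zero set would lift into the Hopf
      fibre and have length 0.\<close>
    have "r \<noteq> 0"
    proof
      assume "r = 0"
      then have "dd s \<kappa>' w = rmul (s w) (hprod (s w) (dd s \<kappa>' w))" using eq unfolding r_def[symmetric] by simp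
      then have "dd s \<kappa>' w \<bullet> dd s \<kappa>' w = hprod (s w) (dd s \<kappa>' w) \<bullet> hprod (s w) (dd s \<kappa>' w)"
        using inner_rmul by metis
      then have "h w \<kappa>' \<kappa>' = 0" by (simp add: hA[OF w])
      then show False using h.pos[OF AW[OF w] \<kappa>'(1)] by simp
    qed
    then show ?thesis using \<kappa>' eq unfolding r_def by blast
  qed
  have horizontal_part: "\<exists>H. linear H \<and> (\<forall>a. dd \<rho> (H a) w = dd \<rho> a w \<and> dd s (H a) w \<bullet> ?X (s w) = 0 \<and> H a \<in> horizontal h \<rho> w)
      \<and> (\<forall>a b. h w (H a) (H b) = h w a b - (dd s a w \<bullet> ?X (s w)) * (dd s b w \<bullet> ?X (s w)) / (?X (s w) \<bullet> ?X (s w)))"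
    if w: "w \<in> A" for w
  proof -
    let ?Y = "?X (s w)" and ?u = "s w"
    obtain \<kappa>' r where \<kappa>': "dd \<rho> \<kappa>' w = 0" "\<And>v. dd \<rho> v w = 0 \<Longrightarrow> \<exists>t. v = t *\<^sub>R \<kappa>'" and r: "r \<noteq> 0"
      and eq: "dd s \<kappa>' w = rmul ?u (hprod ?u (dd s \<kappa>' w)) + r *\<^sub>R ?Y"
      using vertical[OF w] by blast
    define r2 where "r2 = ?Y \<bullet> ?Y"
    have r2: "r2 > 0" using Xs[OF w] by (simp add: r2_def)
    have uY: "rmul ?u k \<bullet> ?Y = 0" for k by (simp add: inner_rmul moment[OF w])
    have sY: "dd s \<kappa>' w \<bullet> ?Y = r * r2" by (subst eq) (simp add: inner_add_left uY r2_def)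
    have h\<kappa>: "h w a \<kappa>' = r * (dd s a w \<bullet> ?Y)" for a
    proof -
      have "dd s a w \<bullet> dd s \<kappa>' w = hprod ?u (dd s \<kappa>' w) \<bullet> hprod ?u (dd s a w) + r * (dd s a w \<bullet> ?Y)"
        by (subst eq) (simp add: inner_add_right inner_commute[of _ "rmul ?u _"] inner_rmul)
      then show ?thesis by (simp add: hA[OF w] inner_commute)
    qed
    \<comment> \<open>The denominator is the product of the lifted kernel vector with
      \<open>?Y\<close>, so subtracting this multiple of it makes the lift orthogonal to the circle
      direction.\<close>
    define \<mu> where "\<mu> a = (dd s a w \<bullet> ?Y) / (r * r2)" for a
    have \<mu>: "linear \<mu>"
      by (rule linearI) (simp_all add: \<mu>_def linear_add[OF lins[OF w]] linear_scale[OF lins[OF w]] inner_add_left add_divide_distrib)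
    define H where "H a = a - \<mu> a *\<^sub>R \<kappa>'" for a
    have "linear H" by (rule linearI) (simp_all add: H_def linear_add[OF \<mu>] linear_scale[OF \<mu>] algebra_simps)
    moreover have "dd \<rho> (H a) w = dd \<rho> a w" for a
      by (simp add: H_def linear_diff[OF lin\<rho>[OF w]] linear_scale[OF lin\<rho>[OF w]] \<kappa>'(1))
    moreover have HY: "dd s (H a) w \<bullet> ?Y = 0" for a
      using r r2 by (simp add: H_def linear_diff[OF lins[OF w]] linear_scale[OF lins[OF w]] inner_diff_left sY \<mu>_def)
    moreover have H\<kappa>: "h w (H a) \<kappa>' = 0" for a by (simp add: h\<kappa> HY)
    moreover have "H a \<in> horizontal h \<rho> w" for a
      unfolding horizontal_def
    proof (intro CollectI allI impI)
      fix v assume "dd \<rho> v w = 0"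
      then obtain t where "v = t *\<^sub>R \<kappa>'" using \<kappa>'(2) by blast
      then show "h w (H a) v = 0" by (simp add: linear_scale[OF h.linear_right[OF AW[OF w]]] H\<kappa>)
    qed
    moreover have "h w (H a) (H b) = h w a b - (dd s a w \<bullet> ?Y) * (dd s b w \<bullet> ?Y) / r2" for a b
    proof -
      have "h w (H a) (H b) = h w (H a) b"
        by (subst H_def[of b]) (simp add: linear_diff[OF h.linear_right[OF AW[OF w]]] linear_scale[OF h.linear_right[OF AW[OF w]]] H\<kappa>)
      also have "\<dots> = h w a b - \<mu> a * h w b \<kappa>'"
        by (simp add: H_def linear_diff[OF h.linear_left[OF AW[OF w]]] linear_scale[OF h.linear_left[OF AW[OF w]]]
            h.sym[OF AW[OF w], of \<kappa>'])
      also have "\<mu> a * h w b \<kappa>' = (dd s a w \<bullet> ?Y) * (dd s b w \<bullet> ?Y) / r2"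
        using r r2 by (simp add: \<mu>_def h\<kappa>)
      finally show ?thesis .
    qed
    ultimately show ?thesis unfolding r2_def by blast
  qed
  obtain H where H: "linear H" "\<And>a. dd \<rho> (H a) w0 = dd \<rho> a w0" "\<And>a. dd s (H a) w0 \<bullet> ?X (s w0) = 0"
    using horizontal_part[OF A(2)] by blast
  obtain R where R: "linear R" "\<And>y. dd \<rho> (R y) w0 = y"
    using linear_surjective_right_inverse[OF lin\<rho>[OF A(2)] surj[OF w0(1)]] by (auto simp: o_def id_def fun_eq_iff)
  have L: "linear (\<lambda>v. H (R v))" by (rule linear_compose[OF R(1) H(1), unfolded o_def])
  have \<rho>L: "dd \<rho> (H (R v)) w0 = v" for v by (simp add: H(2) R(2))
  obtain V' \<tau> where V': "open V'" "\<rho> w0 \<in> V'" "smooth_on V' \<tau>" "\<tau> ` V' \<subseteq> A"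
    and \<tau>: "\<And>x. x \<in> V' \<Longrightarrow> \<rho> (\<tau> x) = x" "\<tau> (\<rho> w0) = w0" "\<And>v. dd \<tau> v (\<rho> w0) = H (R v)"
    using smooth_local_section[OF A(1) \<rho>A A(2) L \<rho>L] by metis
  have \<tau>A: "\<tau> x \<in> A" if "x \<in> V'" for x using V'(4) that by blast
  have \<tau>diff: "\<tau> differentiable (at x)" if "x \<in> V'" for x using smooth_on_differentiable[OF V'(3,1) that] .
  define S where "S x = s (\<tau> x)" for x
  have dS: "dd S v x = dd s (dd \<tau> v x) (\<tau> x)" if "x \<in> V'" for v x
    unfolding S_def[abs_def] by (rule dd_compose[OF \<tau>diff[OF that] sdiff[OF \<tau>A[OF that]]])
  have d\<rho>\<tau>: "dd \<rho> (dd \<tau> v x) (\<tau> x) = v" if x: "x \<in> V'" for v x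
  proof -
    have "(\<lambda>x. \<rho> (\<tau> x)) differentiable (at x)"
      using differentiable_chain_at[OF \<tau>diff[OF x] \<rho>diff[OF \<tau>A[OF x]]] by (simp add: o_def)
    then have "dd (\<lambda>x. \<rho> (\<tau> x)) v x = dd (\<lambda>x. x) v x" by (rule dd_transform[OF _ V'(1) x \<tau>(1)])
    then show ?thesis
      using dd_compose[OF \<tau>diff[OF x] \<rho>diff[OF \<tau>A[OF x]], of v] dd_eqI[OF has_derivative_ident, of v x] by simp
  qed
  \<comment> \<open>Since this product is real, the circle component of the metric may be written
    with the full quaternionic product, the form that \<open>horizontal_section\<close>
    expects.\<close>
  have real_part: "hprod (?X (s w)) (dd s a w) = (dd s a w \<bullet> ?X (s w)) *\<^sub>R qone" if "w \<in> A" for w a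
    using tangent[OF that, of a] fst_hprod[of "?X (s w)" "dd s a w"]
    by (cases "hprod (?X (s w)) (dd s a w)") (simp add: qone_def zero_prod_def inner_commute)
  have one: "qone \<bullet> qone = 1" by (simp add: qone_def)
  have metric: "g x v w = dd S v x \<bullet> dd S w x - hprod (S x) (dd S v x) \<bullet> hprod (S x) (dd S w x)
      - (1 / (?X (S x) \<bullet> ?X (S x))) * (hprod (?X (S x)) (dd S v x) \<bullet> hprod (?X (S x)) (dd S w x))"
    if x: "x \<in> V'" for x v w
  proof -
    obtain H where H: "\<And>a. dd \<rho> (H a) (\<tau> x) = dd \<rho> a (\<tau> x)" "\<And>a. H a \<in> horizontal h \<rho> (\<tau> x)"
      and Hh: "\<And>a b. h (\<tau> x) (H a) (H b) = h (\<tau> x) a b - (dd s a (\<tau> x) \<bullet> ?X (s (\<tau> x))) * (dd s b (\<tau> x) \<bullet> ?X (s (\<tau> x)))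
        / (?X (s (\<tau> x)) \<bullet> ?X (s (\<tau> x)))"
      using horizontal_part[OF \<tau>A[OF x]] by blast
    have "g x v w = g (\<rho> (\<tau> x)) (dd \<rho> (H (dd \<tau> v x)) (\<tau> x)) (dd \<rho> (H (dd \<tau> w x)) (\<tau> x))"
      by (simp add: H(1) d\<rho>\<tau>[OF x] \<tau>(1)[OF x])
    also have "\<dots> = h (\<tau> x) (H (dd \<tau> v x)) (H (dd \<tau> w x))"
      by (rule iso[OF AW[OF \<tau>A[OF x]] H(2) H(2)])
    finally show ?thesis
      unfolding Hh unfolding hA[OF \<tau>A[OF x]] S_def[symmetric] dS[OF x, symmetric]
      using real_part[OF \<tau>A[OF x], of "dd \<tau> v x"] real_part[OF \<tau>A[OF x], of "dd \<tau> w x"]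
      by (simp add: S_def[symmetric] dS[OF x, symmetric] one)
  qed
  have "horizontal_section V' g (real q) (real p) S x0"
  proof unfold_locales
    show "open V'" by (rule V')
    have "V' \<subseteq> V"
    proof
      fix x assume x: "x \<in> V'"
      then have "\<rho> (\<tau> x) \<in> V" using \<rho>W AW[OF \<tau>A[OF x]] by blast
      then show "x \<in> V" by (simp add: \<tau>(1)[OF x])
    qed
    then show "riemannian_metric_on V' g" by (rule riemannian_metric_on_subset[OF gV])
    show "x0 \<in> V'" using V'(2) w0(2) by simp
    then have x0V: "x0 \<in> V'" .
    show "smooth_on V' S" unfolding S_def[abs_def] by (rule smooth_on_compose[OF V'(1) A(1) V'(4) A(4) V'(3)])
    have \<tau>x0: "\<tau> x0 = w0" "dd \<tau> v x0 = H (R v)" for v using \<tau>(2,3) w0(2) by auto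
    show "hprod (S x0) (dd S v x0) = 0" for v
      unfolding dS[OF x0V] by (simp add: S_def \<tau>x0 hor)
    show "hprod (?X (S x0)) (dd S v x0) = 0" for v
      unfolding dS[OF x0V] by (simp add: S_def \<tau>x0 real_part[OF A(2)] H(3))
  qed (use pq pinch s1 moment \<tau>A metric in \<open>auto simp: S_def\<close>)
  then show thesis by (rule that)
qed

theorem theorem6p2:
  fixes p q :: nat
  assumes "p > 0" and "q > 0" and "coprime p q"
    and "real p ^ 2 < sqrt 2 * real q ^ 2"
    and "sqrt 2 * real q ^ 2 < 2 * sqrt 2 * real p ^ 2"
  shows "positive_sectional_curvature (galicki_lawson_orbifold p q)"
  unfolding positive_sectional_curvature_def
proof (clarify)
  fix V \<kappa> g x and u v :: "real^4"
  assume chart: "(V, \<kappa>, g) \<in> galicki_lawson_orbifold p q" and x: "x \<in> V" and uv: "u \<noteq> v" "independent {u, v}"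
  obtain V' s where "horizontal_section V' g (real q) (real p) s x"
    using galicki_lawson_horizontal_section[OF assms(1,2,4,5) chart x] by blast
  then show "sectional_curvature g x u v > 0"
    using horizontal_section.sectional_curvature_pos uv by blast
qed

end
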